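(* For every $n\ge 3$, the group $\mathrm{SL}_n(\mathbb{Z})$ has Kazhdan's property (T). Moreover, with the generating set $S_n$ of elementary matrices, its Kazhdan radius is at most $2$.
   Context: For $i\ne j$, $E_{ij}\in\mathrm{SL}_n(\mathbb{Z})$ is the matrix differing from the identity only in position $(i,j)$, where its entry is $1$; $S_n=\{E_{ij}^{\pm1}:1\le i\ne j\le n\}$. For a group $G$ with finite symmetric generating set $S$: $*$ is the linear involution of $\mathbb{R}G$ induced by $g\mapsto g^{-1}$; the Laplacian is $\Delta=|S|-\sum_{s\in S}s\in\mathbb{R}G$; $B_R$ is the ball of radius $R$ about $1$ in the word metric of $S$; $\Sigma^2_R\mathbb{R}G$ is the set of finite sums $\sum_i\xi_i^*\xi_i$ with each $\xi_i\in\mathbb{R}G$ supported in $B_R$. $(G,S)$ has Kazhdan radius at most $R$ if $\Delta^2-\lambda\Delta\in\Sigma^2_R\mathbb{R}G$ for some $\lambda>0$. *)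

theory Defs
  imports "HOL-Analysis.Analysis" "HOL-Algebra.Group"
begin

section \<open>The group SL_n(Z) and its elementary generators\<close>

definition SL :: "(int^'n^'n) monoid" where
  "SL = \<lparr>carrier = {A. det A = 1}, mult = (**), one = mat 1\<rparr>"

text \<open>E i j: identity matrix with an extra entry 1 at position (i,j).\<close>
definition elem_mat :: "'n::finite \<Rightarrow> 'n \<Rightarrow> int^'n^'n" where
  "elem_mat i j = mat 1 + (\<chi> a b. if a = i \<and> b = j then 1 else 0)"

definition S_gen :: "(int^'n::finite^'n) set" where
  "S_gen = {elem_mat i j | i j. i \<noteq> j} \<union> {inv\<^bsub>SL\<^esub> (elem_mat i j) | i j. i \<noteq> j}"

section \<open>The real group ring RG as finitely supported functions on carrier G\<close>

definition gr_elem :: "('g, 'b) monoid_scheme \<Rightarrow> ('g \<Rightarrow> real) \<Rightarrow> bool" where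
  "gr_elem G a \<longleftrightarrow> finite {g. a g \<noteq> 0} \<and> {g. a g \<noteq> 0} \<subseteq> carrier G"

definition gr_mult :: "('g, 'b) monoid_scheme \<Rightarrow> ('g \<Rightarrow> real) \<Rightarrow> ('g \<Rightarrow> real) \<Rightarrow> ('g \<Rightarrow> real)" where
  "gr_mult G a b = (\<lambda>g. \<Sum>(h, k) \<in> {(h, k). a h \<noteq> 0 \<and> b k \<noteq> 0 \<and> h \<otimes>\<^bsub>G\<^esub> k = g}. a h * b k)"

text \<open>The involution * induced by g \<mapsto> g^{-1}.\<close>
definition gr_star :: "('g, 'b) monoid_scheme \<Rightarrow> ('g \<Rightarrow> real) \<Rightarrow> ('g \<Rightarrow> real)" where
  "gr_star G a = (\<lambda>g. if g \<in> carrier G then a (inv\<^bsub>G\<^esub> g) else 0)"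

text \<open>Laplacian |S| - sum of s over S.\<close>
definition laplacian :: "('g, 'b) monoid_scheme \<Rightarrow> 'g set \<Rightarrow> ('g \<Rightarrow> real)" where
  "laplacian G S = (\<lambda>g. real (card S) * (if g = \<one>\<^bsub>G\<^esub> then 1 else 0) - (if g \<in> S then 1 else 0))"

text \<open>Ball of radius R about 1 in the word metric of S.\<close>
definition word_ball :: "('g, 'b) monoid_scheme \<Rightarrow> 'g set \<Rightarrow> nat \<Rightarrow> 'g set" where
  "word_ball G S R = {foldr (\<lambda>s acc. s \<otimes>\<^bsub>G\<^esub> acc) ws \<one>\<^bsub>G\<^esub> | ws. set ws \<subseteq> S \<and> length ws \<le> R}"

text \<open>Sigma^2_R RG: finite sums of xi^* xi with supp xi inside B_R.\<close>
definition sos_R :: "('g, 'b) monoid_scheme \<Rightarrow> 'g set \<Rightarrow> nat \<Rightarrow> ('g \<Rightarrow> real) set" where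
  "sos_R G S R = {a. \<exists>(m::nat) (\<xi>::nat \<Rightarrow> 'g \<Rightarrow> real).
      (\<forall>i<m. gr_elem G (\<xi> i) \<and> {g. \<xi> i g \<noteq> 0} \<subseteq> word_ball G S R) \<and>
      a = (\<lambda>g. \<Sum>i<m. gr_mult G (gr_star G (\<xi> i)) (\<xi> i) g)}"

definition kazhdan_radius_le :: "('g, 'b) monoid_scheme \<Rightarrow> 'g set \<Rightarrow> nat \<Rightarrow> bool" where
  "kazhdan_radius_le G S R \<longleftrightarrow>
     (\<exists>c>0. (\<lambda>g. gr_mult G (laplacian G S) (laplacian G S) g - c * laplacian G S g) \<in> sos_R G S R)"

section \<open>Property (T), tested on orthogonal representations on real Hilbert spaces\<close>

definition orth_rep :: "('g, 'b) monoid_scheme \<Rightarrow> ('g \<Rightarrow> 'h::real_inner \<Rightarrow> 'h) \<Rightarrow> bool" where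
  "orth_rep G \<pi> \<longleftrightarrow>
     (\<forall>g\<in>carrier G. linear (\<pi> g) \<and> surj (\<pi> g) \<and> (\<forall>x. norm (\<pi> g x) = norm x)) \<and>
     \<pi> \<one>\<^bsub>G\<^esub> = id \<and>
     (\<forall>g\<in>carrier G. \<forall>h\<in>carrier G. \<pi> (g \<otimes>\<^bsub>G\<^esub> h) = \<pi> g \<circ> \<pi> h)"

text \<open>Property (T) condition for a single representation: almost invariant vectors
  (w.r.t. the finite generating set S) imply a nonzero invariant vector.\<close>
definition property_T_rep :: "('g, 'b) monoid_scheme \<Rightarrow> 'g set \<Rightarrow> ('g \<Rightarrow> 'h::real_inner \<Rightarrow> 'h) \<Rightarrow> bool" where
  "property_T_rep G S \<pi> \<longleftrightarrow>
     (orth_rep G \<pi> \<and> (\<forall>\<epsilon>>0. \<exists>v. norm v = 1 \<and> (\<forall>s\<in>S. norm (\<pi> s v - v) < \<epsilon>)) \<longrightarrow>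
        (\<exists>v. v \<noteq> 0 \<and> (\<forall>g\<in>carrier G. \<pi> g v = v)))"

end

(*
  Write Delta = sum of the edge Laplacians X_ij / 2 over ordered pairs, X_ij being 4 minus the four
  generators supported on the edge {i, j}. In Delta^2 the squares X_ij^2 and the products X_ij X_kl of
  disjoint (hence commuting) edges are sums of squares, so it suffices to treat the sum of the products
  X_ij X_ik over triples of distinct indices, i.e. a statement about SL_3 (this reduction is due to
  Kaluba, Kielak and Nowak). For a triple one needs Sum X_ij X_ik >= eps Sum X_ij with squares of
  elements supported in the ball of radius 2. Averaging over the signed permutations and the inverse
  transpose, a certificate exists already in the subgroup generated by E_13, E_23, E_12, E_21, and it
  only involves the Steinberg relations: all products that occur fall into 27 orbits.

  For property (T), Delta^2 >= c Delta makes the iteration v |-> v - t Delta v converge geometrically to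
  a vector in the kernel of Delta, which is fixed by the generators, hence, by the Euclidean algorithm,
  by all of SL_n(Z).
*)
theory Submission
  imports Defs "HOL-Library.Poly_Mapping"
begin

text \<open>The group is written additively: finitely supported functions over a
  \<open>group_add\<close> type form a ring under convolution, which is the group ring. The
  certificate is checked for arbitrary generators satisfying the Steinberg relations. Further
  coincidences between words in the actual group are harmless, since only a formal identity between
  orbit sums is used. The symmetries of three indices are absorbed in one sum over
  \<open>frames\<close>, which at the same time runs over all triples of the n indices. Hence two
  group words need only be compared up to symmetry and inversion. Products of edges have
  augmentation zero, so every square in the certificate must have it too; this forces the constants
  2 in \<open>ys_even\<close>. The sign changes split the squares into eigenspaces, which replaces
  one large Gram matrix by blocks of sizes 6, 5 and 8. Numerical semidefiniteness proves nothing by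
  itself: the blocks are integer matrices, and their positivity is reduced to diagonal dominance
  after subtracting an explicit square, which is a finite computation with integers.\<close>

abbreviation lookup where "lookup \<equiv> Poly_Mapping.lookup"
abbreviation keys where "keys \<equiv> Poly_Mapping.keys"

section \<open>Sums of squares in a real group ring\<close>

definition star :: "('g::group_add \<Rightarrow>\<^sub>0 real) \<Rightarrow> 'g \<Rightarrow>\<^sub>0 real" where
  "star x = Poly_Mapping.map_key uminus x"

abbreviation cst :: "real \<Rightarrow> 'g::group_add \<Rightarrow>\<^sub>0 real" where
  "cst c \<equiv> Poly_Mapping.single 0 c"

abbreviation pt :: "'g::group_add \<Rightarrow> 'g \<Rightarrow>\<^sub>0 real" where
  "pt g \<equiv> Poly_Mapping.single g 1"

lemma inj_uminus_group: "inj (uminus :: 'g::group_add \<Rightarrow> 'g)"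
  by (metis injI minus_minus)

lemma lookup_star [simp]: "lookup (star x) g = lookup x (- g)"
  by (simp add: star_def map_key.rep_eq inj_uminus_group)

lemma sum_singles: "(\<Sum>g\<in>keys x. Poly_Mapping.single g (lookup x g)) = (x :: 'g \<Rightarrow>\<^sub>0 real)"
  by (rule poly_mapping_eqI)
    (auto simp: lookup_sum lookup_single when_def in_keys_iff)

text \<open>Reduces an identity that is additive in \<open>x\<close> to scaled group elements, on
  which the product is just the group operation.\<close>

lemma gring_induct [case_names zero single add]:
  fixes x :: "'g \<Rightarrow>\<^sub>0 real"
  assumes "P 0" "\<And>g c. P (Poly_Mapping.single g c)" "\<And>x y. P x \<Longrightarrow> P y \<Longrightarrow> P (x + y)"
  shows "P x"
proof -
  have "P (\<Sum>g\<in>A. Poly_Mapping.single g (lookup x g))" if "finite A" for A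
    using that by induction (use assms in auto)
  from this[OF finite_keys[of x]] show ?thesis by (simp only: sum_singles)
qed

lemma star_zero [simp]: "star 0 = 0"
  and star_add: "star (x + y) = star x + star y"
  and star_diff: "star (x - y) = star x - star y"
  and star_star [simp]: "star (star x) = x"
  by (rule poly_mapping_eqI; simp add: lookup_add lookup_minus)+

lemma star_single [simp]: "star (Poly_Mapping.single g c) = Poly_Mapping.single (- g) c"
  by (rule poly_mapping_eqI) (auto simp: lookup_single when_def)

lemma star_one [simp]: "star 1 = 1"
  by (metis neg_0_equal_iff_equal neg_equal_0_iff_equal single_one star_single)

lemma star_sum: "star (sum f A) = (\<Sum>a\<in>A. star (f a))"
  by (induction A rule: infinite_finite_induct) (auto simp: star_add)

lemma star_mult: "star (x * y) = star y * star x"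
proof (induction x rule: gring_induct)
  case (single g c)
  show ?case
    by (induction y rule: gring_induct)
      (auto simp: mult_single star_add minus_add mult.commute ring_distribs)
qed (auto simp: star_add ring_distribs)

lemma lookup_cst_mult [simp]: "lookup (cst c * x) g = c * lookup x g"
  by (induction x rule: gring_induct)
    (auto simp: mult_single lookup_add lookup_single when_def ring_distribs)

lemma cst_commute: "x * cst c = cst c * x"
  by (induction x rule: gring_induct) (auto simp: mult_single mult.commute ring_distribs)

lemma cst_left_commute: "x * (cst c * y) = cst c * (x * y)"
  by (metis cst_commute mult.assoc)

lemma cst_mult_cst: "cst a * (cst b * x) = cst (a * b) * x"
  by (simp add: mult.assoc[symmetric] mult_single)

lemma star_cst_mult: "star (cst c * x) = cst c * star x"
  by (rule poly_mapping_eqI) simp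

lemma cst_mult_mult: "(cst a * x) * (cst b * y) = cst (a * b) * (x * y)"
  by (simp only: mult.assoc cst_left_commute[of x b y] cst_mult_cst)

lemma keys_cst_mult: "keys (cst c * x) \<subseteq> keys x"
  by (auto simp: in_keys_iff)

text \<open>The support condition bounds the factor \<open>x\<close>, not the square, as in
  \<open>sos_R\<close>. The inductive form allows the transfer to \<open>sos_R\<close> one square at
  a time.\<close>

inductive_set sos :: "'g::group_add set \<Rightarrow> ('g \<Rightarrow>\<^sub>0 real) set" for B where
  zero: "0 \<in> sos B"
| step: "a \<in> sos B \<Longrightarrow> keys x \<subseteq> B \<Longrightarrow> a + star x * x \<in> sos B"

lemma sos_square: "keys x \<subseteq> B \<Longrightarrow> star x * x \<in> sos B"
  using sos.step[OF sos.zero, of x B] by simp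

lemma sos_add: "b \<in> sos B \<Longrightarrow> a \<in> sos B \<Longrightarrow> a + b \<in> sos B"
  by (induction b rule: sos.induct) (auto simp: add.assoc[symmetric] intro: sos.intros)

lemma sos_sum: "(\<And>i. i \<in> I \<Longrightarrow> f i \<in> sos B) \<Longrightarrow> sum f I \<in> sos B"
  by (induction I rule: infinite_finite_induct) (auto intro: sos.zero sos_add)

lemma sos_cst_mult:
  assumes "c \<ge> 0" "a \<in> sos B" shows "cst c * a \<in> sos B"
  using assms(2)
proof induction
  case (step a x)
  have "cst c * (star x * x) = star (cst (sqrt c) * x) * (cst (sqrt c) * x)"
    using assms(1)
    by (simp add: star_cst_mult cst_mult_mult)
  moreover have "keys (cst (sqrt c) * x) \<subseteq> B"
    using step keys_cst_mult by blast
  ultimately show ?case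
    using step by (simp add: distrib_left sos.step)
qed (auto intro: sos.zero)

lemma sos_star: "a \<in> sos B \<Longrightarrow> star a = a"
  by (induction rule: sos.induct) (auto simp: star_add star_mult)

text \<open>An off-diagonal entry is absorbed by |R i j| times the square of Y i + sgn (R i j) Y j.
  This uses up |R i j| on the diagonal at i and at j, and dominance says that the rest of the
  diagonal is still nonnegative.\<close>

lemma sos_diag_dominant:
  fixes Y :: "nat \<Rightarrow> 'g::group_add \<Rightarrow>\<^sub>0 real" and R :: "nat \<Rightarrow> nat \<Rightarrow> real"
  assumes Y: "\<And>i. i < n \<Longrightarrow> keys (Y i) \<subseteq> B"
    and sym: "\<And>i j. i < n \<Longrightarrow> j < n \<Longrightarrow> R i j = R j i"
    and dd: "\<And>i. i < n \<Longrightarrow> (\<Sum>j\<in>{..<n}-{i}. \<bar>R i j\<bar>) \<le> R i i"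
  shows "(\<Sum>i<n. \<Sum>j<n. cst (R i j) * (star (Y i) * Y j)) \<in> sos B"
proof -
  define q where "q i j = star (Y i) * Y j" for i j
  define s where "s i j = Y i + cst (sgn (R i j)) * Y j" for i j
  have sq: "cst \<bar>R i j\<bar> * (star (s i j) * s i j)
      = cst \<bar>R i j\<bar> * q i i + cst (R i j) * q i j + cst (R i j) * q j i + cst \<bar>R i j\<bar> * q j j" for i j
  proof -
    have 1: "star (s i j) * s i j = q i i + cst (sgn (R i j)) * q i j + cst (sgn (R i j)) * q j i
        + cst (sgn (R i j) * sgn (R i j)) * q j j"
      using cst_mult_mult[of 1 "star (Y i)" "sgn (R i j)" "Y j"]
        cst_mult_mult[of "sgn (R i j)" "star (Y j)" 1 "Y i"]
      by (simp add: s_def q_def star_add star_cst_mult cst_mult_mult ring_distribs)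
    show ?thesis
      unfolding 1 by (simp add: distrib_left cst_mult_cst) (simp add: sgn_if)
  qed
  have sk: "s i j \<in> {x. keys x \<subseteq> B}" if "i < n" "j < n" for i j
    using Y[OF that(1)] Y[OF that(2)] keys_cst_mult[of "sgn (R i j)" "Y j"]
      Poly_Mapping.keys_add[of "Y i" "cst (sgn (R i j)) * Y j"]
    unfolding s_def by blast
  have sq1: "star (Y i) * Y i \<in> sos B" if "i < n" for i
    using Y[OF that] by (rule sos_square)
  have sq2: "star (s i j) * s i j \<in> sos B" if "i < n" "j < n" for i j
    using sk[OF that] by (intro sos_square) simp
  define d where "d i = R i i - (\<Sum>j\<in>{..<n}-{i}. \<bar>R i j\<bar>)" for i
  \<comment> \<open>Every unordered pair occurs twice in the double sum, hence the factor 1/2;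
    \<open>d i\<close> is what remains of the diagonal.\<close>
  have "(\<Sum>i<n. cst (d i) * q i i)
      + cst (1/2) * (\<Sum>i<n. \<Sum>j\<in>{..<n}-{i}. cst \<bar>R i j\<bar> * (star (s i j) * s i j)) \<in> sos B"
    using sq1 sq2 dd by (intro sos_add sos_sum sos_cst_mult) (auto simp: q_def d_def)
  also have "(\<Sum>i<n. cst (d i) * q i i)
      + cst (1/2) * (\<Sum>i<n. \<Sum>j\<in>{..<n}-{i}. cst \<bar>R i j\<bar> * (star (s i j) * s i j))
      = (\<Sum>i<n. \<Sum>j<n. cst (R i j) * q i j)"
  proof (rule poly_mapping_eqI)
    fix g
    define Q where "Q i j = lookup (q i j) g" for i j
    have off: "(\<Sum>i<n. \<Sum>j\<in>{..<n}-{i}. F i j) = (\<Sum>i<n. \<Sum>j\<in>{..<n}-{i}. F j i)" for F :: "nat \<Rightarrow> nat \<Rightarrow> real"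
    proof -
      have "(\<Sum>i<n. \<Sum>j\<in>{..<n}-{i}. F i j) = (\<Sum>i<n. \<Sum>j<n. if i = j then 0 else F i j)"
        by (intro sum.cong refl sum.mono_neutral_cong_left) auto
      also have "\<dots> = (\<Sum>i<n. \<Sum>j<n. if i = j then 0 else F j i)"
        by (subst sum.swap) (auto intro!: sum.cong)
      also have "\<dots> = (\<Sum>i<n. \<Sum>j\<in>{..<n}-{i}. F j i)"
        by (intro sum.cong refl sum.mono_neutral_cong_right) auto
      finally show ?thesis .
    qed
    have "(\<Sum>i<n. \<Sum>j\<in>{..<n}-{i}. \<bar>R i j\<bar> * Q i i + R i j * Q i j + R i j * Q j i + \<bar>R i j\<bar> * Q j j)
       = 2 * (\<Sum>i<n. \<Sum>j\<in>{..<n}-{i}. \<bar>R i j\<bar> * Q i i) + 2 * (\<Sum>i<n. \<Sum>j\<in>{..<n}-{i}. R i j * Q i j)"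
    proof -
      have "(\<Sum>i<n. \<Sum>j\<in>{..<n}-{i}. R i j * Q j i) = (\<Sum>i<n. \<Sum>j\<in>{..<n}-{i}. R i j * Q i j)"
        by (subst off) (auto intro!: sum.cong simp: sym)
      moreover have "(\<Sum>i<n. \<Sum>j\<in>{..<n}-{i}. \<bar>R i j\<bar> * Q j j) = (\<Sum>i<n. \<Sum>j\<in>{..<n}-{i}. \<bar>R i j\<bar> * Q i i)"
        by (subst off) (auto intro!: sum.cong simp: sym)
      ultimately show ?thesis by (simp add: sum.distrib)
    qed
    moreover have "(\<Sum>i<n. d i * Q i i) = (\<Sum>i<n. R i i * Q i i) - (\<Sum>i<n. \<Sum>j\<in>{..<n}-{i}. \<bar>R i j\<bar> * Q i i)"
      by (simp add: d_def left_diff_distrib sum_subtractf sum_distrib_right)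
    moreover have "(\<Sum>i<n. \<Sum>j<n. R i j * Q i j) = (\<Sum>i<n. R i i * Q i i) + (\<Sum>i<n. \<Sum>j\<in>{..<n}-{i}. R i j * Q i j)"
      by (subst sum.distrib[symmetric]) (auto intro!: sum.cong simp: sum.remove)
    ultimately show "lookup ((\<Sum>i<n. cst (d i) * q i i)
      + cst (1/2) * (\<Sum>i<n. \<Sum>j\<in>{..<n}-{i}. cst \<bar>R i j\<bar> * (star (s i j) * s i j))) g
      = lookup (\<Sum>i<n. \<Sum>j<n. cst (R i j) * q i j) g"
      by (simp add: lookup_add lookup_sum sq Q_def) (simp add: field_simps)
  qed
  finally show ?thesis by (simp add: q_def)
qed

text \<open>N M is the sum of L^T L, whose form is the sum of the squares of the rows of
  \<open>L\<close> applied to \<open>Y\<close>, and of a diagonally dominant remainder. So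
  \<open>L\<close> may be any approximate factor, and no exact square roots occur.\<close>

lemma sos_gram:
  fixes Y :: "nat \<Rightarrow> 'g::group_add \<Rightarrow>\<^sub>0 real" and M L :: "nat \<Rightarrow> nat \<Rightarrow> real"
  assumes Y: "\<And>i. i < n \<Longrightarrow> keys (Y i) \<subseteq> B"
    and N: "N > 0"
    and sym: "\<And>i j. i < n \<Longrightarrow> j < n \<Longrightarrow> M i j = M j i"
    and dd: "\<And>i. i < n \<Longrightarrow> (\<Sum>j\<in>{..<n}-{i}. \<bar>N * M i j - (\<Sum>k<n. L k i * L k j)\<bar>)
                 \<le> N * M i i - (\<Sum>k<n. L k i * L k i)"
  shows "(\<Sum>i<n. \<Sum>j<n. cst (M i j) * (star (Y i) * Y j)) \<in> sos B"
proof -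
  define R where "R i j = N * M i j - (\<Sum>k<n. L k i * L k j)" for i j
  define x where "x k = (\<Sum>i<n. cst (L k i) * Y i)" for k
  have xk: "keys (x k) \<subseteq> B" for k
    unfolding x_def using Y keys_cst_mult by (intro order_trans[OF Poly_Mapping.keys_sum]) blast
  have xx: "(\<Sum>k<n. star (x k) * x k) = (\<Sum>i<n. \<Sum>j<n. cst (\<Sum>k<n. L k i * L k j) * (star (Y i) * Y j))"
  proof -
    have "star (x k) * x k = (\<Sum>i<n. \<Sum>j<n. cst (L k i * L k j) * (star (Y i) * Y j))" for k
      by (simp add: x_def star_sum star_cst_mult sum_product cst_mult_mult)
    hence "(\<Sum>k<n. star (x k) * x k) = (\<Sum>k<n. \<Sum>i<n. \<Sum>j<n. cst (L k i * L k j) * (star (Y i) * Y j))"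
      by simp
    also have "\<dots> = (\<Sum>i<n. \<Sum>j<n. \<Sum>k<n. cst (L k i * L k j) * (star (Y i) * Y j))"
      by (subst sum.swap, rule sum.cong[OF refl], rule sum.swap)
    also have "\<dots> = (\<Sum>i<n. \<Sum>j<n. cst (\<Sum>k<n. L k i * L k j) * (star (Y i) * Y j))"
      by (simp add: poly_mapping_eq_iff fun_eq_iff lookup_sum sum_distrib_right)
    finally show ?thesis .
  qed
  have "cst (1/N) * ((\<Sum>i<n. \<Sum>j<n. cst (R i j) * (star (Y i) * Y j)) + (\<Sum>k<n. star (x k) * x k)) \<in> sos B"
    using N Y xk dd
    by (intro sos_cst_mult sos_add sos_sum sos_square sos_diag_dominant)
      (auto simp: R_def sym mult.commute)
  also have "cst (1/N) * ((\<Sum>i<n. \<Sum>j<n. cst (R i j) * (star (Y i) * Y j)) + (\<Sum>k<n. star (x k) * x k))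
     = (\<Sum>i<n. \<Sum>j<n. cst (M i j) * (star (Y i) * Y j))"
    unfolding xx
  proof (rule poly_mapping_eqI)
    fix g
    have "N * (\<Sum>i<n. \<Sum>j<n. M i j * lookup (star (Y i) * Y j) g)
        = (\<Sum>i<n. \<Sum>j<n. (R i j + (\<Sum>k<n. L k i * L k j)) * lookup (star (Y i) * Y j) g)"
      by (simp add: R_def sum_distrib_left mult.assoc)
    with N show "lookup (cst (1/N) * ((\<Sum>i<n. \<Sum>j<n. cst (R i j) * (star (Y i) * Y j))
        + (\<Sum>i<n. \<Sum>j<n. cst (\<Sum>k<n. L k i * L k j) * (star (Y i) * Y j)))) g
      = lookup (\<Sum>i<n. \<Sum>j<n. cst (M i j) * (star (Y i) * Y j)) g"
      by (simp add: lookup_sum lookup_add distrib_right sum.distrib field_simps)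
  qed
  finally show ?thesis .
qed

section \<open>Steinberg relations and their symmetries\<close>

text \<open>The second clause is the relation [e i j, e j k] = e i k, written as a rule for moving
  \<open>e i j\<close> past \<open>e j k\<close>.\<close>

definition steinberg :: "('a \<Rightarrow> 'a \<Rightarrow> 'g::group_add) \<Rightarrow> bool" where
  "steinberg e \<longleftrightarrow>
     (\<forall>i j k l. i \<noteq> j \<longrightarrow> k \<noteq> l \<longrightarrow> j \<noteq> k \<longrightarrow> i \<noteq> l \<longrightarrow> e i j + e k l = e k l + e i j) \<and>
     (\<forall>i j k. i \<noteq> j \<longrightarrow> j \<noteq> k \<longrightarrow> i \<noteq> k \<longrightarrow> e i j + e j k = e i k + (e j k + e i j))"

lemma commute_uminus:
  fixes a b :: "'g::group_add"
  assumes "a + b = b + a"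
  shows "a + - b = - b + a" "- a + b = b + - a" "- a + - b = - b + - a"
proof -
  have 1: "a + - b = - b + a" if "a + b = b + a" for a b :: 'g
    using that by (metis add.assoc add.right_inverse add_0_right minus_add_cancel)
  show "a + - b = - b + a" by (rule 1[OF assms])
  show 2: "- a + b = b + - a" using 1[OF assms[symmetric]] by simp
  show "- a + - b = - b + - a"
    using 1[OF 2[symmetric, THEN sym]] by simp
qed

text \<open>Since \<open>a\<close> commutes with \<open>u\<close> and \<open>b\<close>, their
  commutator behaves bilinearly: inverting one of them inverts \<open>a\<close>, inverting both
  leaves it alone.\<close>

lemma commutator_uminus:
  fixes u b a :: "'g::group_add"
  assumes c: "u + b = a + (b + u)" and ua: "u + a = a + u" and ba: "b + a = a + b"
  shows "u + - b = - a + (- b + u)" "- u + b = - a + (b + - u)" "- u + - b = a + (- b + - u)"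
proof -
  have ua': "u + (a + z) = a + (u + z)" and ba': "b + (a + z) = a + (b + z)"
    and c': "u + (b + z) = a + (b + (u + z))" for z
    by (simp_all add: add.assoc[symmetric] ua ba c)
  have "b + (a + (u + - b)) = u"
    using c'[of "- b"] by (simp add: ba')
  hence "a + (u + - b) = - b + u"
    by (metis minus_add_cancel)
  thus 1: "u + - b = - a + (- b + u)"
    by (metis minus_add_cancel)
  have "u + (a + (- u + b)) = u + (b + - u)"
    by (simp add: ua' c' del: add_uminus_conv_diff)
  hence "a + (- u + b) = b + - u" by simp
  thus "- u + b = - a + (b + - u)"
    by (metis minus_add_cancel)
  have "u + (- b + - u) = (u + - b) + - u"
    by (simp only: add.assoc)
  also have "\<dots> = - a + - b"
    by (simp only: 1 add.assoc right_minus add_0_right)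
  finally have "u + (a + (- b + - u)) = - b"
    by (simp only: ua' add_minus_cancel)
  thus "- u + - b = a + (- b + - u)"
    by (metis minus_add_cancel)
qed

text \<open>The symmetries of the relations: relabel the indices by \<open>p\<close>, conjugate by the diagonal sign
  matrix \<open>s\<close>, and, if \<open>t\<close> holds, apply the inverse transpose.\<close>

definition act :: "('b \<Rightarrow> 'a) \<Rightarrow> ('b \<Rightarrow> bool) \<Rightarrow> bool \<Rightarrow> ('a \<Rightarrow> 'a \<Rightarrow> 'g::group_add) \<Rightarrow> 'b \<Rightarrow> 'b \<Rightarrow> 'g" where
  "act p s t x i j = (let y = if t then - x (p j) (p i) else x (p i) (p j) in if s i = s j then y else - y)"

lemma act_act: "act p s t (act m s' t' e) = act (m \<circ> p) (\<lambda>i. s i \<noteq> s' (p i)) (t \<noteq> t') e"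
  by (intro ext) (auto simp: act_def Let_def)

lemma steinberg_commute:
  "steinberg e \<Longrightarrow> i \<noteq> j \<Longrightarrow> k \<noteq> l \<Longrightarrow> j \<noteq> k \<Longrightarrow> i \<noteq> l \<Longrightarrow> e i j + e k l = e k l + e i j"
  by (simp add: steinberg_def)

lemma steinberg_commutator:
  "steinberg e \<Longrightarrow> i \<noteq> j \<Longrightarrow> j \<noteq> k \<Longrightarrow> i \<noteq> k \<Longrightarrow> e i j + e j k = e i k + (e j k + e i j)"
  by (simp add: steinberg_def)

text \<open>The signs on the edges ij and jk multiply to the sign on ik, which is exactly the
  pattern of \<open>commutator_uminus\<close>.\<close>

lemma steinberg_act:
  fixes e :: "'a \<Rightarrow> 'a \<Rightarrow> 'g::group_add"
  assumes e: "steinberg e" and "inj p"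
  shows "steinberg (act p s t e)"
proof -
  have c1: "act p s t e i j + act p s t e k l = act p s t e k l + act p s t e i j"
    if "i \<noteq> j" "k \<noteq> l" "j \<noteq> k" "i \<noteq> l" for i j k l
  proof -
    have "p i \<noteq> p j" "p k \<noteq> p l" "p j \<noteq> p k" "p i \<noteq> p l"
      using that \<open>inj p\<close> by (auto dest: injD)
    hence "e (p i) (p j) + e (p k) (p l) = e (p k) (p l) + e (p i) (p j)"
      "e (p j) (p i) + e (p l) (p k) = e (p l) (p k) + e (p j) (p i)"
      using steinberg_commute[OF e] by metis+
    from this[THEN commute_uminus(1)] this[THEN commute_uminus(2)] this[THEN commute_uminus(3)] this
    show ?thesis by (simp add: act_def Let_def)
  qed
  moreover have "act p s t e i j + act p s t e j k
      = act p s t e i k + (act p s t e j k + act p s t e i j)"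
    if "i \<noteq> j" "j \<noteq> k" "i \<noteq> k" for i j k
  proof -
    have *: "p i \<noteq> p j" "p j \<noteq> p k" "p i \<noteq> p k"
      using that \<open>inj p\<close> by (auto dest: injD)
    define u b a where d: "u = e (p i) (p j)" "b = e (p j) (p k)" "a = e (p i) (p k)"
    define u' b' a' where d': "u' = - e (p j) (p i)" "b' = - e (p k) (p j)" "a' = - e (p k) (p i)"
    have 1: "u + b = a + (b + u)" "u + a = a + u" "b + a = a + b"
      unfolding d using * steinberg_commutator[OF e] steinberg_commute[OF e] by metis+
    \<comment> \<open>The commutator relation for the reversed path k, j, i. Inverting both sides
      reverses the products and yields the relation for \<open>u'\<close>, \<open>b'\<close>,
      \<open>a'\<close> in the original order.\<close>
    have "- b' + - u' = - a' + (- u' + - b')" "- u' + - a' = - a' + - u'" "- b' + - a' = - a' + - b'"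
      unfolding d' minus_minus using * steinberg_commutator[OF e] steinberg_commute[OF e] by metis+
    hence 2: "u' + b' = a' + (b' + u')" "u' + a' = a' + u'" "b' + a' = a' + b'"
      by (metis minus_add minus_minus add.assoc)+
    have "act p s t e i j = (if s i = s j then if t then u' else u else - (if t then u' else u))"
      "act p s t e j k = (if s j = s k then if t then b' else b else - (if t then b' else b))"
      "act p s t e i k = (if s i = s k then if t then a' else a else - (if t then a' else a))"
      by (simp_all add: act_def Let_def d d')
    with commutator_uminus[OF 1] commutator_uminus[OF 2] 1 2 show ?thesis by auto
  qed
  ultimately show ?thesis unfolding steinberg_def by blast
qed

section \<open>Placements of three abstract indices, with signs and inverse transpose\<close>

datatype idx = I1 | I2 | I3

lemma UNIV_idx: "UNIV = {I1, I2, I3}"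
  using idx.exhaust by blast

instance idx :: finite
  by standard (simp add: UNIV_idx)

text \<open>A global change of all signs acts trivially, so every system of generators is counted
  several times. The multiplicity is the same for all triples and is divided out in
  \<open>triple_sum_sos\<close>.\<close>

definition frames :: "((idx \<Rightarrow> 'i::finite) \<times> (idx \<Rightarrow> bool) \<times> bool) set" where
  "frames = {m. inj m} \<times> UNIV"

definition fr :: "('i \<Rightarrow> 'i \<Rightarrow> 'g) \<Rightarrow> (idx \<Rightarrow> 'i::finite) \<times> (idx \<Rightarrow> bool) \<times> bool \<Rightarrow> idx \<Rightarrow> idx \<Rightarrow> 'g::group_add" where
  "fr e f = (case f of (m, s, t) \<Rightarrow> act m s t e)"

lemma finite_frames [simp]: "finite frames"
  by (simp add: frames_def)

lemma steinberg_fr: "steinberg e \<Longrightarrow> f \<in> frames \<Longrightarrow> steinberg (fr e f)"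
  by (auto simp: frames_def fr_def steinberg_act)

text \<open>By \<open>act_act\<close> a symmetry of the three indices applied to a frame gives
  another frame, and this permutes \<open>frames\<close>; \<open>k\<close> is the inverse of
  \<open>h\<close>.\<close>

lemma sum_frames_act:
  fixes e :: "'i::finite \<Rightarrow> 'i \<Rightarrow> 'g::group_add"
  assumes "bij p"
  shows "(\<Sum>f\<in>frames. F (act p s t (fr e f))) = (\<Sum>f\<in>frames. F (fr e f))"
proof -
  define h where "h = (\<lambda>(m :: idx \<Rightarrow> 'i, s', t'). (m \<circ> p, \<lambda>i. s i \<noteq> s' (p i), t \<noteq> t'))"
  define k where "k = (\<lambda>(m :: idx \<Rightarrow> 'i, s', t'). (m \<circ> inv_into UNIV p, \<lambda>i. s (inv_into UNIV p i) \<noteq> s' (inv_into UNIV p i), t \<noteq> t'))"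
  have p: "p (inv_into UNIV p i) = i" "inv_into UNIV p (p i) = i" for i
    using assms by (simp_all add: bij_is_surj surj_f_inv_f bij_is_inj)
  have "bij_betw h frames frames"
  proof (rule bij_betw_byWitness[where f' = k])
    show "\<forall>a\<in>frames. k (h a) = a" "\<forall>a\<in>frames. h (k a) = a"
      by (auto simp: h_def k_def p fun_eq_iff)
    show "h ` frames \<subseteq> frames" "k ` frames \<subseteq> frames"
      using assms by (auto simp: h_def k_def frames_def bij_is_inj bij_imp_bij_inv intro: inj_compose)
  qed
  from sum.reindex_bij_betw[OF this, of "\<lambda>f. F (fr e f)"] show ?thesis
    by (simp add: h_def fr_def act_act case_prod_unfold)
qed

section \<open>Orbit sums of group words\<close>

text \<open>Adding the coefficient at the inverse loses nothing on self-adjoint elements, and lets a word be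
  identified with its inverse.\<close>

definition hcoeff :: "'g::group_add \<Rightarrow> ('g \<Rightarrow>\<^sub>0 real) \<Rightarrow> real" where
  "hcoeff g x = lookup x g + lookup x (- g)"

lemma hcoeff_add: "hcoeff g (x + y) = hcoeff g x + hcoeff g y"
  and hcoeff_diff: "hcoeff g (x - y) = hcoeff g x - hcoeff g y"
  and hcoeff_cst_mult: "hcoeff g (cst c * x) = c * hcoeff g x"
  by (simp_all add: hcoeff_def lookup_add lookup_minus algebra_simps)

lemma hcoeff_sum: "hcoeff g (sum f A) = (\<Sum>a\<in>A. hcoeff g (f a))"
  by (simp add: hcoeff_def lookup_sum sum.distrib)

lemma hcoeff_single: "hcoeff g (Poly_Mapping.single h c) = c * hcoeff g (pt h)"
  by (simp add: hcoeff_def lookup_single when_def)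

lemma hcoeff_uminus_pt: "hcoeff g (pt (- h)) = hcoeff g (pt h)"
  by (auto simp: hcoeff_def lookup_single when_def)

lemma self_adjoint_eqI:
  assumes "star x = x" "star y = y" "\<And>g. hcoeff g x = hcoeff g y"
  shows "x = y"
proof (rule poly_mapping_eqI)
  fix g
  have "lookup z (- g) = lookup z g" if "star z = z" for z :: "'a \<Rightarrow>\<^sub>0 real"
    by (metis that lookup_star)
  with assms show "lookup x g = lookup y g"
    by (metis hcoeff_def mult_2 mult_left_cancel zero_neq_numeral)
qed

text \<open>A group word is encoded as the function \<open>w\<close> evaluating it at a system of
  generators, so that symmetries act by precomposition. The value is the coefficient at
  \<open>g\<close> and \<open>- g\<close> of the sum of the word over all frames.\<close>

definition orb :: "'g::group_add \<Rightarrow> ('i::finite \<Rightarrow> 'i \<Rightarrow> 'g) \<Rightarrow> ((idx \<Rightarrow> idx \<Rightarrow> 'g) \<Rightarrow> 'g) \<Rightarrow> real" where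
  "orb g e w = (\<Sum>f\<in>frames. hcoeff g (pt (w (fr e f))))"

lemma orb_act: "bij p \<Longrightarrow> orb g e (\<lambda>x. w (act p s t x)) = orb g e w"
  unfolding orb_def by (rule sum_frames_act)

lemma orb_cong:
  assumes "steinberg e" "\<And>x. steinberg x \<Longrightarrow> w x = w' x"
  shows "orb g e w = orb g e w'"
  unfolding orb_def using assms by (intro sum.cong refl) (simp add: steinberg_fr)

text \<open>The words need to agree only modulo the Steinberg relations, after moving one of them by
  a symmetry.\<close>

lemma orb_eqI:
  assumes "steinberg e" "bij p" "\<And>x. steinberg x \<Longrightarrow> w (act p s t x) = w' x"
  shows "orb g e w = orb g e w'"
  using orb_cong[OF assms(1), of "\<lambda>x. w (act p s t x)"] orb_act[OF assms(2), of g e w s t] assms(3) by simp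

lemma orb_eqI_uminus:
  assumes "steinberg e" "bij p" "\<And>x. steinberg x \<Longrightarrow> w (act p s t x) = - w' x"
  shows "orb g e w = orb g e w'"
  using orb_eqI[OF assms(1,2), of w s t "\<lambda>x. - w' x" g] assms(3) by (simp add: orb_def hcoeff_uminus_pt)

text \<open>Formal combinations of words: products can be expanded and collected symbolically before
  any evaluation in the group ring.\<close>

type_synonym 'g vec = "(real \<times> ((idx \<Rightarrow> idx \<Rightarrow> 'g) \<Rightarrow> 'g)) list"

definition ev :: "'g::group_add vec \<Rightarrow> (idx \<Rightarrow> idx \<Rightarrow> 'g) \<Rightarrow> 'g \<Rightarrow>\<^sub>0 real" where
  "ev y x = (\<Sum>(c, w)\<leftarrow>y. Poly_Mapping.single (w x) c)"

text \<open>By \<open>sum_hcoeff_ev\<close> this is the coefficient at \<open>g\<close> and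
  \<open>- g\<close> of y^* z summed over all frames, with the dependence on the group hidden in the
  values of \<open>orb\<close>.\<close>

definition gram :: "'g::group_add \<Rightarrow> ('i::finite \<Rightarrow> 'i \<Rightarrow> 'g) \<Rightarrow> 'g vec \<Rightarrow> 'g vec \<Rightarrow> real" where
  "gram g e y z = (\<Sum>(c, w)\<leftarrow>y. \<Sum>(d, w')\<leftarrow>z. c * d * orb g e (\<lambda>x. - w x + w' x))"

lemma star_ev_mult_ev:
  "star (ev y x) * ev z x = (\<Sum>(c, w)\<leftarrow>y. \<Sum>(d, w')\<leftarrow>z. Poly_Mapping.single (- w x + w' x) (c * d))"
proof (induction y)
  case (Cons a y)
  have "Poly_Mapping.single h c * ev z x = (\<Sum>(d, w')\<leftarrow>z. Poly_Mapping.single (h + w' x) (c * d))" for h c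
    by (induction z) (auto simp: ev_def mult_single distrib_left)
  with Cons show ?case
    by (cases a) (simp add: ev_def star_add distrib_right)
qed (simp add: ev_def)

lemma sum_hcoeff_ev:
  "(\<Sum>f\<in>frames. hcoeff g (star (ev y (fr e f)) * ev z (fr e f))) = gram g e y z"
proof -
  have hcoeff_zero: "hcoeff g 0 = 0"
    by (simp add: hcoeff_def)
  have 1: "(\<Sum>f\<in>frames. hcoeff g (\<Sum>(d, w')\<leftarrow>z. Poly_Mapping.single (- w (fr e f) + w' (fr e f)) (c * d)))
      = (\<Sum>(d, w')\<leftarrow>z. c * d * orb g e (\<lambda>x. - w x + w' x))" for c w
    by (induction z)
      (auto simp: hcoeff_zero hcoeff_add sum.distrib hcoeff_single[of _ _ "_ * _"] orb_def sum_distrib_left)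
  show ?thesis
    unfolding star_ev_mult_ev gram_def
    by (induction y) (auto simp: hcoeff_zero hcoeff_add sum.distrib 1)
qed

text \<open>On the \<open>\<plusminus>1\<close>-eigenspaces of the two sign changes \<open>flip I1\<close>, \<open>flip I2\<close> the Gram form, summed over
  all frames, can be evaluated with one factor left unsymmetrised.\<close>

definition flip :: "idx \<Rightarrow> 'g::group_add vec \<Rightarrow> 'g vec" where
  "flip i y = map (\<lambda>(c, w). (c, \<lambda>x. w (act id (\<lambda>j. j = i) False x))) y"

definition scal :: "real \<Rightarrow> 'g::group_add vec \<Rightarrow> 'g vec" where
  "scal a y = map (\<lambda>(c, w). (a * c, w)) y"

text \<open>For signs a and b this is four times the projection onto the joint eigenspace on which
  the flips of \<open>I1\<close> and \<open>I2\<close> act by a and b.\<close>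

definition isotypic :: "real \<Rightarrow> real \<Rightarrow> 'g::group_add vec \<Rightarrow> 'g vec" where
  "isotypic a b y = y @ scal a (flip I1 y) @ scal b (flip I2 y) @ scal (a * b) (flip I1 (flip I2 y))"

lemma act_id [simp]: "act (\<lambda>i. i) (\<lambda>i. False) False x = x"
  by (intro ext) (simp add: act_def)

lemma flip_flip: "flip i (flip i y) = y" "flip i (flip j y) = flip j (flip i y)"
proof -
  have "(\<lambda>ia. (ia = j) = (ia \<noteq> i)) = (\<lambda>ia. (ia = i) = (ia \<noteq> j))"
    by auto
  thus "flip i (flip j y) = flip j (flip i y)"
    by (simp add: flip_def act_act case_prod_unfold comp_def)
qed (auto simp: flip_def act_act case_prod_unfold comp_def intro!: map_idI)

lemma flip_append: "flip i (y @ z) = flip i y @ flip i z"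
  and flip_scal: "flip i (scal a y) = scal a (flip i y)"
  by (auto simp: flip_def scal_def)

lemma gram_append:
  "gram g e (y @ y') z = gram g e y z + gram g e y' z"
  "gram g e y (z @ z') = gram g e y z + gram g e y z'"
  by (induction y) (auto simp: gram_def algebra_simps)

lemma gram_scal:
  "gram g e (scal a y) z = a * gram g e y z"
  "gram g e y (scal a z) = a * gram g e y z"
proof -
  show "gram g e (scal a y) z = a * gram g e y z"
    by (induction y) (auto simp: gram_def scal_def algebra_simps sum_list_const_mult case_prod_unfold)
  have "(\<Sum>(d, w')\<leftarrow>scal a z. c * d * orb g e (\<lambda>x. - w x + w' x))
      = a * (\<Sum>(d, w')\<leftarrow>z. c * d * orb g e (\<lambda>x. - w x + w' x))" for c w
    by (induction z) (auto simp: scal_def algebra_simps)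
  thus "gram g e y (scal a z) = a * gram g e y z"
    by (induction y) (auto simp: gram_def algebra_simps)
qed

lemma gram_flip: "gram g e (flip i y) (flip i z) = gram g e y z"
proof -
  have "(\<Sum>(d, w')\<leftarrow>flip i z. c * d * orb g e (\<lambda>x. - w (act id (\<lambda>j. j = i) False x) + w' x))
      = (\<Sum>(d, w')\<leftarrow>z. c * d * orb g e (\<lambda>x. - w x + w' x))" for c w
    using orb_act[of id g e "\<lambda>x. - w x + w' x" "\<lambda>j. j = i" False for w']
    by (induction z) (auto simp: flip_def)
  thus ?thesis
    by (induction y) (auto simp: gram_def flip_def)
qed

text \<open>The flips are commuting involutions that preserve \<open>gram\<close>, hence
  self-adjoint for it; so is \<open>isotypic\<close>, and applying it twice multiplies it by 4. One
  symmetrised factor suffices, which divides the number of words to be classified by four.\<close>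

lemma gram_isotypic:
  assumes "a * a = 1" "b * b = 1"
  shows "gram g e (isotypic a b y) (isotypic a b z) = 4 * gram g e y (isotypic a b z)"
proof -
  have f: "gram g e (flip i y) z = gram g e y (flip i z)" for i y z
    by (metis gram_flip flip_flip(1))
  have 1: "a * (a * c) = c" "b * (b * c) = c" for c
    using assms by (simp_all flip: mult.assoc)
  have 2: "a * (b * (a * b)) = 1"
    using assms by (metis 1(1) mult.left_commute)
  show ?thesis
    unfolding isotypic_def[of a b y] isotypic_def[of a b z]
    by (simp add: gram_append gram_scal f flip_append flip_scal flip_flip ring_distribs 1 2 assms)
qed

section \<open>Normal forms of group words\<close>

text \<open>Oriented as rewrite rules. The elements \<open>x I1 I3\<close> and
  \<open>x I2 I3\<close> generate an abelian group normalised by \<open>x I1 I2\<close> and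
  \<open>x I2 I1\<close>, so every word can be brought to powers of \<open>x I1 I3\<close>, then of
  \<open>x I2 I3\<close>, then a word in the other two. Each sign pattern needs its own
  rule.\<close>

lemma steinberg_nf:
  assumes "steinberg x"
  shows
    "x I2 I3 + x I1 I3 = x I1 I3 + x I2 I3"
    "x I2 I3 + - x I1 I3 = - x I1 I3 + x I2 I3"
    "- x I2 I3 + x I1 I3 = x I1 I3 + - x I2 I3"
    "- x I2 I3 + - x I1 I3 = - x I1 I3 + - x I2 I3"
    "x I1 I2 + x I1 I3 = x I1 I3 + x I1 I2"
    "x I1 I2 + - x I1 I3 = - x I1 I3 + x I1 I2"
    "- x I1 I2 + x I1 I3 = x I1 I3 + - x I1 I2"
    "- x I1 I2 + - x I1 I3 = - x I1 I3 + - x I1 I2"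
    "x I2 I1 + x I2 I3 = x I2 I3 + x I2 I1"
    "x I2 I1 + - x I2 I3 = - x I2 I3 + x I2 I1"
    "- x I2 I1 + x I2 I3 = x I2 I3 + - x I2 I1"
    "- x I2 I1 + - x I2 I3 = - x I2 I3 + - x I2 I1"
    "x I1 I2 + x I2 I3 = x I1 I3 + (x I2 I3 + x I1 I2)"
    "x I2 I1 + x I1 I3 = x I1 I3 + (x I2 I3 + x I2 I1)"
    "x I1 I2 + - x I2 I3 = - x I1 I3 + (- x I2 I3 + x I1 I2)"
    "x I2 I1 + - x I1 I3 = - x I1 I3 + (- x I2 I3 + x I2 I1)"
    "- x I1 I2 + x I2 I3 = - x I1 I3 + (x I2 I3 + - x I1 I2)"
    "- x I2 I1 + x I1 I3 = x I1 I3 + (- x I2 I3 + - x I2 I1)"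
    "- x I1 I2 + - x I2 I3 = x I1 I3 + (- x I2 I3 + - x I1 I2)"
    "- x I2 I1 + - x I1 I3 = - x I1 I3 + (x I2 I3 + - x I2 I1)"
proof -
  have 1: "x I2 I3 + x I1 I3 = x I1 I3 + x I2 I3" "x I1 I2 + x I1 I3 = x I1 I3 + x I1 I2"
    "x I2 I1 + x I2 I3 = x I2 I3 + x I2 I1"
    using assms by (simp_all add: steinberg_commute)
  note 2 = this[THEN commute_uminus(1)] this[THEN commute_uminus(2)] this[THEN commute_uminus(3)]
  have "x I1 I2 + x I2 I3 = x I1 I3 + (x I2 I3 + x I1 I2)"
    "x I2 I1 + x I1 I3 = x I2 I3 + (x I1 I3 + x I2 I1)"
    using assms by (simp_all add: steinberg_commutator)
  note 3 = this(1) commutator_uminus[OF this(1) 1(2) 1(1)] this(2) commutator_uminus[OF this(2) 1(3) 1(1)[symmetric]]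
  \<comment> \<open>The commutator of \<open>x I2 I1\<close> with \<open>x I1 I3\<close> puts
    \<open>x I2 I3\<close> in front; these rules restore the chosen order, also inside longer
    words.\<close>
  have 4: "x I2 I3 + (x I1 I3 + z) = x I1 I3 + (x I2 I3 + z)"
    "x I2 I3 + (- x I1 I3 + z) = - x I1 I3 + (x I2 I3 + z)"
    "- x I2 I3 + (x I1 I3 + z) = x I1 I3 + (- x I2 I3 + z)"
    "- x I2 I3 + (- x I1 I3 + z) = - x I1 I3 + (- x I2 I3 + z)" for z
    using 1(1) 2 by (simp_all only: add.assoc[symmetric])
  show "x I2 I3 + x I1 I3 = x I1 I3 + x I2 I3"
    by (simp only: 1 2 3 4)
  show "x I2 I3 + - x I1 I3 = - x I1 I3 + x I2 I3"
    by (simp only: 1 2 3 4)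
  show "- x I2 I3 + x I1 I3 = x I1 I3 + - x I2 I3"
    by (simp only: 1 2 3 4)
  show "- x I2 I3 + - x I1 I3 = - x I1 I3 + - x I2 I3"
    by (simp only: 1 2 3 4)
  show "x I1 I2 + x I1 I3 = x I1 I3 + x I1 I2"
    by (simp only: 1 2 3 4)
  show "x I1 I2 + - x I1 I3 = - x I1 I3 + x I1 I2"
    by (simp only: 1 2 3 4)
  show "- x I1 I2 + x I1 I3 = x I1 I3 + - x I1 I2"
    by (simp only: 1 2 3 4)
  show "- x I1 I2 + - x I1 I3 = - x I1 I3 + - x I1 I2"
    by (simp only: 1 2 3 4)
  show "x I2 I1 + x I2 I3 = x I2 I3 + x I2 I1"
    by (simp only: 1 2 3 4)
  show "x I2 I1 + - x I2 I3 = - x I2 I3 + x I2 I1"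
    by (simp only: 1 2 3 4)
  show "- x I2 I1 + x I2 I3 = x I2 I3 + - x I2 I1"
    by (simp only: 1 2 3 4)
  show "- x I2 I1 + - x I2 I3 = - x I2 I3 + - x I2 I1"
    by (simp only: 1 2 3 4)
  show "x I1 I2 + x I2 I3 = x I1 I3 + (x I2 I3 + x I1 I2)"
    by (simp only: 1 2 3 4)
  show "x I2 I1 + x I1 I3 = x I1 I3 + (x I2 I3 + x I2 I1)"
    by (simp only: 1 2 3 4)
  show "x I1 I2 + - x I2 I3 = - x I1 I3 + (- x I2 I3 + x I1 I2)"
    by (simp only: 1 2 3 4)
  show "x I2 I1 + - x I1 I3 = - x I1 I3 + (- x I2 I3 + x I2 I1)"
    by (simp only: 1 2 3 4)
  show "- x I1 I2 + x I2 I3 = - x I1 I3 + (x I2 I3 + - x I1 I2)"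
    by (simp only: 1 2 3 4)
  show "- x I2 I1 + x I1 I3 = x I1 I3 + (- x I2 I3 + - x I2 I1)"
    by (simp only: 1 2 3 4)
  show "- x I1 I2 + - x I2 I3 = x I1 I3 + (- x I2 I3 + - x I1 I2)"
    by (simp only: 1 2 3 4)
  show "- x I2 I1 + - x I1 I3 = - x I1 I3 + (x I2 I3 + - x I2 I1)"
    by (simp only: 1 2 3 4)
qed

lemma steinberg_nf_left:
  assumes "steinberg x"
  shows
    "x I2 I3 + (x I1 I3 + z) = x I1 I3 + (x I2 I3 + z)"
    "x I2 I3 + (- x I1 I3 + z) = - x I1 I3 + (x I2 I3 + z)"
    "- x I2 I3 + (x I1 I3 + z) = x I1 I3 + (- x I2 I3 + z)"
    "- x I2 I3 + (- x I1 I3 + z) = - x I1 I3 + (- x I2 I3 + z)"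
    "x I1 I2 + (x I1 I3 + z) = x I1 I3 + (x I1 I2 + z)"
    "x I1 I2 + (- x I1 I3 + z) = - x I1 I3 + (x I1 I2 + z)"
    "- x I1 I2 + (x I1 I3 + z) = x I1 I3 + (- x I1 I2 + z)"
    "- x I1 I2 + (- x I1 I3 + z) = - x I1 I3 + (- x I1 I2 + z)"
    "x I2 I1 + (x I2 I3 + z) = x I2 I3 + (x I2 I1 + z)"
    "x I2 I1 + (- x I2 I3 + z) = - x I2 I3 + (x I2 I1 + z)"
    "- x I2 I1 + (x I2 I3 + z) = x I2 I3 + (- x I2 I1 + z)"
    "- x I2 I1 + (- x I2 I3 + z) = - x I2 I3 + (- x I2 I1 + z)"
    "x I1 I2 + (x I2 I3 + z) = x I1 I3 + (x I2 I3 + (x I1 I2 + z))"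
    "x I2 I1 + (x I1 I3 + z) = x I1 I3 + (x I2 I3 + (x I2 I1 + z))"
    "x I1 I2 + (- x I2 I3 + z) = - x I1 I3 + (- x I2 I3 + (x I1 I2 + z))"
    "x I2 I1 + (- x I1 I3 + z) = - x I1 I3 + (- x I2 I3 + (x I2 I1 + z))"
    "- x I1 I2 + (x I2 I3 + z) = - x I1 I3 + (x I2 I3 + (- x I1 I2 + z))"
    "- x I2 I1 + (x I1 I3 + z) = x I1 I3 + (- x I2 I3 + (- x I2 I1 + z))"
    "- x I1 I2 + (- x I2 I3 + z) = x I1 I3 + (- x I2 I3 + (- x I1 I2 + z))"
    "- x I2 I1 + (- x I1 I3 + z) = - x I1 I3 + (x I2 I3 + (- x I2 I1 + z))"
  using steinberg_nf[OF assms] by (simp_all only: add.assoc[symmetric])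

definition perm :: "idx \<Rightarrow> idx \<Rightarrow> idx \<Rightarrow> idx \<Rightarrow> idx" where
  "perm p q r i = (case i of I1 \<Rightarrow> p | I2 \<Rightarrow> q | I3 \<Rightarrow> r)"

text \<open>Only the equality of two signs enters \<open>act\<close>, so the sign at
  \<open>I3\<close> can be normalised.\<close>

definition signs :: "bool \<Rightarrow> bool \<Rightarrow> idx \<Rightarrow> bool" where
  "signs a b i = (case i of I1 \<Rightarrow> a | I2 \<Rightarrow> b | I3 \<Rightarrow> False)"

lemma perm_simps [simp]: "perm p q r I1 = p" "perm p q r I2 = q" "perm p q r I3 = r"
  by (simp_all add: perm_def)

lemma signs_simps [simp]: "signs a b I1 = a" "signs a b I2 = b" "signs a b I3 = False"
  by (simp_all add: signs_def)

lemma bij_perm: "distinct [p, q, r] \<Longrightarrow> bij (perm p q r)"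
proof -
  assume "distinct [p, q, r]"
  hence "inj (perm p q r)"
    by (auto simp: inj_def perm_def split: idx.splits)
  thus ?thesis
    by (simp add: bij_def finite_UNIV_inj_surj)
qed

text \<open>Representatives, up to the symmetries and inversion, of the group words \<open>- g + h\<close> that occur in
  the certificate; they are indexed by \<open>int\<close> in \<open>cls\<close> so that simplification does not turn the index
  \<open>1\<close> into \<open>Suc 0\<close>.\<close>

definition words :: "((idx \<Rightarrow> idx \<Rightarrow> 'g::group_add) \<Rightarrow> 'g) list" where
  "words = [
\<lambda>x. 0,
     \<lambda>x. x I1 I3,
     \<lambda>x. x I1 I3 + x I2 I3,
     \<lambda>x. x I1 I3 + x I2 I1,
     \<lambda>x. - x I1 I2 + x I2 I1,
     \<lambda>x. - x I1 I3 + - x I1 I3,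
     \<lambda>x. - x I1 I2 + - x I2 I1,
     \<lambda>x. - x I1 I3 + (x I2 I3 + x I1 I2),
     \<lambda>x. x I1 I3 + (- x I1 I2 + x I2 I1),
     \<lambda>x. x I1 I3 + (- x I2 I1 + x I1 I2),
     \<lambda>x. - x I1 I3 + (- x I1 I3 + x I2 I3),
     \<lambda>x. - x I1 I3 + (- x I1 I3 + x I2 I1),
     \<lambda>x. x I1 I3 + (- x I1 I2 + - x I2 I1),
     \<lambda>x. - x I1 I3 + (- x I2 I1 + - x I1 I2),
     \<lambda>x. - x I1 I3 + (- x I1 I3 + (x I2 I3 + x I2 I3)),
     \<lambda>x. - x I1 I3 + (- x I1 I3 + (- x I2 I3 + x I2 I1)),
     \<lambda>x. - x I1 I3 + (- x I1 I3 + (- x I1 I2 + x I2 I1)),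
     \<lambda>x. - x I1 I3 + (- x I1 I3 + (- x I2 I1 + x I1 I2)),
     \<lambda>x. - x I1 I3 + (- x I2 I3 + (- x I1 I2 + x I2 I1)),
     \<lambda>x. - x I1 I3 + (- x I1 I3 + (- x I2 I3 + - x I1 I2)),
     \<lambda>x. - x I1 I3 + (- x I1 I3 + (- x I2 I3 + - x I2 I1)),
     \<lambda>x. - x I1 I3 + (- x I1 I3 + (- x I1 I2 + - x I2 I1)),
     \<lambda>x. - x I1 I3 + (- x I2 I3 + (- x I1 I2 + - x I2 I1)),
     \<lambda>x. - x I1 I3 + (x I2 I3 + (x I2 I3 + (- x I2 I1 + x I1 I2))),
     \<lambda>x. - x I1 I3 + (- x I1 I3 + (x I2 I3 + (- x I2 I1 + - x I2 I1))),
     \<lambda>x. - x I1 I3 + (- x I1 I3 + (x I2 I3 + (x I2 I3 + (- x I2 I1 + - x I2 I1)))),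
     \<lambda>x. - x I1 I3 + (- x I1 I3 + (- x I1 I3 + (x I2 I3 + (- x I1 I2 + - x I2 I1))))]"

definition cls :: "'g::group_add \<Rightarrow> ('i::finite \<Rightarrow> 'i \<Rightarrow> 'g) \<Rightarrow> int \<Rightarrow> real" where
  "cls g e k = orb g e (words ! nat k)"

text \<open>Bases of three isotypic components of the span of the words of length at most two in
  \<open>x I1 I3\<close>, \<open>x I2 I3\<close>, \<open>x I1 I2\<close>, \<open>x I2 I1\<close>, before symmetrisation over the sign changes. The first two
  are even, respectively odd, under exchanging \<open>I1\<close> and \<open>I2\<close>.\<close>

definition ys_even :: "'g::group_add vec list" where
  "ys_even = [
[(2, \<lambda>x. 0), (-1, \<lambda>x. x I1 I3), (-1, \<lambda>x. x I2 I3)],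
     [(2, \<lambda>x. 0), (-1, \<lambda>x. x I1 I2), (-1, \<lambda>x. x I2 I1)],
     [(2, \<lambda>x. 0), (-1, \<lambda>x. x I1 I3 + x I2 I3), (-1, \<lambda>x. x I2 I3 + x I1 I3)],
     [(2, \<lambda>x. 0), (-1, \<lambda>x. x I1 I2 + x I1 I3), (-1, \<lambda>x. x I2 I1 + x I2 I3)],
     [(2, \<lambda>x. 0), (-1, \<lambda>x. x I1 I2 + x I2 I3), (-1, \<lambda>x. x I2 I1 + x I1 I3)],
     [(2, \<lambda>x. 0), (-1, \<lambda>x. x I2 I3 + x I1 I2), (-1, \<lambda>x. x I1 I3 + x I2 I1)]]"

definition ys_odd :: "'g::group_add vec list" where
  "ys_odd = [
[(1, \<lambda>x. x I1 I3), (-1, \<lambda>x. x I2 I3)],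
     [(1, \<lambda>x. x I1 I2), (-1, \<lambda>x. x I2 I1)],
     [(1, \<lambda>x. x I1 I2 + x I1 I3), (-1, \<lambda>x. x I2 I1 + x I2 I3)],
     [(1, \<lambda>x. x I1 I2 + x I2 I3), (-1, \<lambda>x. x I2 I1 + x I1 I3)],
     [(1, \<lambda>x. x I2 I3 + x I1 I2), (-1, \<lambda>x. x I1 I3 + x I2 I1)]]"

text \<open>These are symmetrised with the signs (-1, 1). Each word becomes antisymmetric, so its
  augmentation vanishes without a constant term. The signs (1, -1) are obtained from these by
  exchanging \<open>I1\<close> and \<open>I2\<close>, which a sum over frames does not see.\<close>

definition ys_vec :: "'g::group_add vec list" where
  "ys_vec = [
[(1, \<lambda>x. x I1 I3)],
     [(1, \<lambda>x. x I1 I3 + x I2 I3)],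
     [(1, \<lambda>x. x I1 I2 + x I1 I3)],
     [(1, \<lambda>x. x I2 I1 + x I2 I3)],
     [(1, \<lambda>x. x I1 I2 + x I2 I3)],
     [(1, \<lambda>x. x I2 I1 + x I1 I3)],
     [(1, \<lambda>x. x I2 I3 + x I1 I2)],
     [(1, \<lambda>x. x I1 I3 + x I2 I1)]]"

context
  fixes g :: "'g::group_add" and e :: "'i::finite \<Rightarrow> 'i \<Rightarrow> 'g"
  assumes e: "steinberg e"
begin

text \<open>The symmetry is supplied explicitly by \<open>p\<close>, \<open>q\<close>,
  \<open>r\<close>, \<open>a\<close>, \<open>b\<close>, \<open>t\<close>; what remains is a
  rewriting to normal form.\<close>

lemma orb_clsI:
  assumes "distinct [p, q, r]"
    and "\<And>x. steinberg x \<Longrightarrow> w (act (perm p q r) (signs a b) t x) = (words ! nat k) x"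
  shows "orb g e w = cls g e k"
  unfolding cls_def
  by (rule orb_eqI[OF e bij_perm[OF assms(1)], where w = w and s = "signs a b" and t = t]) (rule assms(2))

lemma orb_clsI_uminus:
  assumes "distinct [p, q, r]"
    and "\<And>x. steinberg x \<Longrightarrow> w (act (perm p q r) (signs a b) t x) = - (words ! nat k) x"
  shows "orb g e w = cls g e k"
  unfolding cls_def
  by (rule orb_eqI_uminus[OF e bij_perm[OF assms(1)], where w = w and s = "signs a b" and t = t]) (rule assms(2))

lemmas word_simps = act_def words_def minus_add add.assoc steinberg_nf steinberg_nf_left

section \<open>Orbits of the words of the certificate, grouped by the symmetry that reaches the
  representative\<close>

lemma orb_words1:
  "orb g e (\<lambda>x. 0) = cls g e 0"
  "orb g e (\<lambda>x. x I1 I3) = cls g e 1"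
  "orb g e (\<lambda>x. x I1 I3 + x I2 I3) = cls g e 2"
  "orb g e (\<lambda>x. x I1 I3 + x I2 I1) = cls g e 3"
  "orb g e (\<lambda>x. - x I1 I2 + x I2 I1) = cls g e 4"
  "orb g e (\<lambda>x. - x I1 I3 + - x I1 I3) = cls g e 5"
  "orb g e (\<lambda>x. - x I1 I2 + - x I2 I1) = cls g e 6"
  "orb g e (\<lambda>x. - x I1 I3 + (x I2 I3 + x I1 I2)) = cls g e 7"
  "orb g e (\<lambda>x. x I1 I3 + (- x I1 I2 + x I2 I1)) = cls g e 8"
  "orb g e (\<lambda>x. x I1 I3 + (- x I2 I1 + x I1 I2)) = cls g e 9"
  "orb g e (\<lambda>x. - x I1 I3 + (- x I1 I3 + x I2 I3)) = cls g e 10"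
  "orb g e (\<lambda>x. - x I1 I3 + (- x I1 I3 + x I2 I1)) = cls g e 11"
  "orb g e (\<lambda>x. x I1 I3 + (- x I1 I2 + - x I2 I1)) = cls g e 12"
  "orb g e (\<lambda>x. - x I1 I3 + (- x I2 I1 + - x I1 I2)) = cls g e 13"
  "orb g e (\<lambda>x. - x I1 I3 + (- x I1 I3 + (x I2 I3 + x I2 I3))) = cls g e 14"
  "orb g e (\<lambda>x. - x I1 I3 + (- x I1 I3 + (- x I2 I3 + x I2 I1))) = cls g e 15"
  "orb g e (\<lambda>x. - x I1 I3 + (- x I1 I3 + (- x I1 I2 + x I2 I1))) = cls g e 16"
  "orb g e (\<lambda>x. - x I1 I3 + (- x I1 I3 + (- x I2 I1 + x I1 I2))) = cls g e 17"
  "orb g e (\<lambda>x. - x I1 I3 + (- x I2 I3 + (- x I1 I2 + x I2 I1))) = cls g e 18"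
  "orb g e (\<lambda>x. - x I1 I3 + (- x I1 I3 + (- x I2 I3 + - x I1 I2))) = cls g e 19"
  "orb g e (\<lambda>x. - x I1 I3 + (- x I1 I3 + (- x I2 I3 + - x I2 I1))) = cls g e 20"
  "orb g e (\<lambda>x. - x I1 I3 + (- x I1 I3 + (- x I1 I2 + - x I2 I1))) = cls g e 21"
  "orb g e (\<lambda>x. - x I1 I3 + (- x I2 I3 + (- x I1 I2 + - x I2 I1))) = cls g e 22"
  "orb g e (\<lambda>x. - x I1 I3 + (x I2 I3 + (x I2 I3 + (- x I2 I1 + x I1 I2)))) = cls g e 23"
  "orb g e (\<lambda>x. - x I1 I3 + (- x I1 I3 + (x I2 I3 + (- x I2 I1 + - x I2 I1)))) = cls g e 24"
  "orb g e (\<lambda>x. - x I1 I3 + (- x I1 I3 + (x I2 I3 + (x I2 I3 + (- x I2 I1 + - x I2 I1))))) = cls g e 25"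
  "orb g e (\<lambda>x. - x I1 I3 + (- x I1 I3 + (- x I1 I3 + (x I2 I3 + (- x I1 I2 + - x I2 I1))))) = cls g e 26"
  by (rule orb_clsI[of I1 I2 I3 _ False False False];
      simp add: word_simps del: add_uminus_conv_diff)+

lemma orb_words2:
  "orb g e (\<lambda>x. x I2 I3) = cls g e 1"
  "orb g e (\<lambda>x. x I2 I3 + x I1 I2) = cls g e 3"
  "orb g e (\<lambda>x. - x I2 I3 + - x I2 I3) = cls g e 5"
  "orb g e (\<lambda>x. x I1 I3 + (- x I2 I3 + x I2 I1)) = cls g e 7"
  "orb g e (\<lambda>x. x I2 I3 + (- x I2 I1 + x I1 I2)) = cls g e 8"
  "orb g e (\<lambda>x. x I1 I3 + (- x I2 I3 + - x I2 I3)) = cls g e 10"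
  "orb g e (\<lambda>x. - x I2 I3 + (- x I2 I3 + x I1 I2)) = cls g e 11"
  "orb g e (\<lambda>x. x I2 I3 + (- x I2 I1 + - x I1 I2)) = cls g e 12"
  "orb g e (\<lambda>x. - x I2 I3 + (- x I1 I2 + - x I2 I1)) = cls g e 13"
  "orb g e (\<lambda>x. - x I1 I3 + (- x I2 I3 + (- x I2 I3 + x I1 I2))) = cls g e 15"
  "orb g e (\<lambda>x. - x I1 I3 + (- x I2 I3 + (- x I2 I1 + x I1 I2))) = cls g e 18"
  "orb g e (\<lambda>x. - x I2 I3 + (- x I2 I3 + (- x I2 I1 + x I1 I2))) = cls g e 16"
  "orb g e (\<lambda>x. - x I1 I3 + (- x I2 I3 + (- x I2 I3 + - x I1 I2))) = cls g e 20"
  "orb g e (\<lambda>x. - x I1 I3 + (- x I2 I3 + (- x I2 I3 + - x I2 I1))) = cls g e 19"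
  "orb g e (\<lambda>x. - x I1 I3 + (- x I2 I3 + (- x I2 I1 + - x I1 I2))) = cls g e 22"
  "orb g e (\<lambda>x. - x I2 I3 + (- x I2 I3 + (- x I2 I1 + - x I1 I2))) = cls g e 21"
  "orb g e (\<lambda>x. x I1 I3 + (- x I2 I3 + (- x I2 I3 + (- x I1 I2 + - x I1 I2)))) = cls g e 24"
  "orb g e (\<lambda>x. x I1 I3 + (x I1 I3 + (- x I2 I3 + (- x I2 I3 + (- x I1 I2 + - x I1 I2))))) = cls g e 25"
  "orb g e (\<lambda>x. x I1 I3 + (- x I2 I3 + (- x I2 I3 + (- x I2 I3 + (- x I2 I1 + - x I1 I2))))) = cls g e 26"
  by (rule orb_clsI[of I2 I1 I3 _ False False False];
      simp add: word_simps del: add_uminus_conv_diff)+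

lemma orb_words3:
  "orb g e (\<lambda>x. x I1 I2) = cls g e 1"
  "orb g e (\<lambda>x. - x I1 I2 + - x I1 I2) = cls g e 5"
  by (rule orb_clsI[of I1 I3 I2 _ False False False];
      simp add: word_simps del: add_uminus_conv_diff)+

lemma orb_words4:
  "orb g e (\<lambda>x. x I2 I1) = cls g e 1"
  "orb g e (\<lambda>x. - x I2 I1 + - x I2 I1) = cls g e 5"
  by (rule orb_clsI[of I3 I1 I2 _ False False False];
      simp add: word_simps del: add_uminus_conv_diff)+

lemma orb_words5:
  "orb g e (\<lambda>x. - x I1 I3) = cls g e 1"
  "orb g e (\<lambda>x. - x I2 I1 + x I1 I2) = cls g e 4"
  "orb g e (\<lambda>x. - x I1 I3 + - x I2 I3) = cls g e 2"
  "orb g e (\<lambda>x. - x I1 I3 + (x I2 I3 + - x I2 I1)) = cls g e 3"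
  "orb g e (\<lambda>x. - x I2 I3 + (- x I1 I2 + x I2 I1)) = cls g e 9"
  "orb g e (\<lambda>x. - x I1 I3 + (x I2 I3 + (- x I2 I1 + x I1 I2))) = cls g e 8"
  "orb g e (\<lambda>x. x I1 I3 + (x I1 I3 + (- x I2 I3 + - x I2 I3))) = cls g e 14"
  "orb g e (\<lambda>x. x I1 I3 + (x I1 I3 + (- x I2 I3 + - x I1 I2))) = cls g e 7"
  "orb g e (\<lambda>x. x I1 I3 + (x I1 I3 + (- x I2 I3 + (- x I1 I2 + x I2 I1)))) = cls g e 23"
  by (rule orb_clsI_uminus[of I1 I2 I3 _ False False False];
      simp add: word_simps del: add_uminus_conv_diff)+

lemma orb_words6:
  "orb g e (\<lambda>x. - x I2 I3) = cls g e 1"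
  "orb g e (\<lambda>x. x I1 I3 + (- x I2 I3 + - x I1 I2)) = cls g e 3"
  "orb g e (\<lambda>x. - x I1 I3 + (x I2 I3 + (x I2 I3 + - x I2 I1))) = cls g e 7"
  "orb g e (\<lambda>x. x I1 I3 + (- x I2 I3 + (- x I1 I2 + x I2 I1))) = cls g e 8"
  by (rule orb_clsI_uminus[of I2 I1 I3 _ False False False];
      simp add: word_simps del: add_uminus_conv_diff)+

lemma orb_words7:
  "orb g e (\<lambda>x. - x I1 I2) = cls g e 1"
  by (rule orb_clsI_uminus[of I1 I3 I2 _ False False False];
      simp add: word_simps del: add_uminus_conv_diff)+

lemma orb_words8:
  "orb g e (\<lambda>x. - x I2 I1) = cls g e 1"
  by (rule orb_clsI_uminus[of I3 I1 I2 _ False False False];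
      simp add: word_simps del: add_uminus_conv_diff)+

lemma orb_words9:
  "orb g e (\<lambda>x. x I1 I3 + x I1 I2) = cls g e 2"
  "orb g e (\<lambda>x. x I1 I3 + (- x I1 I2 + - x I1 I2)) = cls g e 10"
  "orb g e (\<lambda>x. - x I1 I3 + (x I2 I3 + (- x I1 I2 + - x I1 I2))) = cls g e 15"
  by (rule orb_clsI_uminus[of I3 I1 I2 _ False False True];
      simp add: word_simps del: add_uminus_conv_diff)+

lemma orb_words10:
  "orb g e (\<lambda>x. x I2 I3 + x I2 I1) = cls g e 2"
  "orb g e (\<lambda>x. x I2 I3 + (- x I2 I1 + - x I2 I1)) = cls g e 10"
  "orb g e (\<lambda>x. x I1 I3 + (- x I2 I3 + (- x I2 I1 + - x I2 I1))) = cls g e 15"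
  by (rule orb_clsI_uminus[of I1 I3 I2 _ False False True];
      simp add: word_simps del: add_uminus_conv_diff)+

lemma orb_words11:
  "orb g e (\<lambda>x. - x I1 I3 + x I2 I3) = cls g e 2"
  "orb g e (\<lambda>x. - x I2 I1 + - x I1 I2) = cls g e 6"
  "orb g e (\<lambda>x. - x I1 I3 + (- x I2 I3 + x I2 I1)) = cls g e 3"
  "orb g e (\<lambda>x. - x I1 I3 + (x I2 I3 + (- x I2 I1 + - x I1 I2))) = cls g e 12"
  "orb g e (\<lambda>x. x I1 I3 + (x I1 I3 + (- x I2 I3 + (- x I1 I2 + - x I2 I1)))) = cls g e 13"
  by (rule orb_clsI_uminus[of I1 I2 I3 _ False True False];
      simp add: word_simps del: add_uminus_conv_diff)+

lemma orb_words12: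
  "orb g e (\<lambda>x. - x I1 I3 + x I1 I2) = cls g e 2"
  "orb g e (\<lambda>x. - x I1 I3 + (- x I1 I2 + - x I1 I2)) = cls g e 10"
  "orb g e (\<lambda>x. - x I1 I3 + (- x I1 I3 + (- x I1 I2 + - x I1 I2))) = cls g e 14"
  "orb g e (\<lambda>x. - x I1 I3 + (- x I1 I3 + (x I2 I3 + (- x I1 I2 + - x I1 I2)))) = cls g e 11"
  by (rule orb_clsI[of I3 I1 I2 _ False True True];
      simp add: word_simps del: add_uminus_conv_diff)+

lemma orb_words13:
  "orb g e (\<lambda>x. - x I1 I3 + x I2 I1) = cls g e 3"
  "orb g e (\<lambda>x. x I1 I3 + (- x I2 I3 + x I1 I2)) = cls g e 7"
  "orb g e (\<lambda>x. - x I1 I3 + (- x I1 I2 + x I2 I1)) = cls g e 8"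
  "orb g e (\<lambda>x. - x I1 I3 + (- x I2 I1 + x I1 I2)) = cls g e 9"
  "orb g e (\<lambda>x. - x I1 I3 + (- x I1 I2 + - x I2 I1)) = cls g e 12"
  "orb g e (\<lambda>x. x I1 I3 + (- x I2 I3 + (- x I2 I3 + (- x I2 I1 + x I1 I2)))) = cls g e 23"
  by (rule orb_clsI[of I1 I2 I3 _ True True False];
      simp add: word_simps del: add_uminus_conv_diff)+

lemma orb_words14:
  "orb g e (\<lambda>x. x I1 I3 + - x I2 I3) = cls g e 2"
  "orb g e (\<lambda>x. x I1 I3 + - x I2 I1) = cls g e 3"
  "orb g e (\<lambda>x. - x I1 I3 + (- x I1 I3 + - x I2 I3)) = cls g e 10"
  "orb g e (\<lambda>x. - x I1 I3 + (- x I1 I3 + - x I2 I1)) = cls g e 11"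
  "orb g e (\<lambda>x. - x I1 I3 + (- x I2 I3 + - x I1 I2)) = cls g e 7"
  "orb g e (\<lambda>x. - x I1 I3 + (- x I1 I3 + (x I2 I3 + - x I2 I1))) = cls g e 15"
  "orb g e (\<lambda>x. - x I1 I3 + (- x I1 I3 + (- x I2 I3 + - x I2 I3))) = cls g e 14"
  by (rule orb_clsI[of I1 I2 I3 _ False True False];
      simp add: word_simps del: add_uminus_conv_diff)+

lemma orb_words15:
  "orb g e (\<lambda>x. x I1 I3 + - x I1 I2) = cls g e 2"
  by (rule orb_clsI_uminus[of I3 I1 I2 _ False True True];
      simp add: word_simps del: add_uminus_conv_diff)+

lemma orb_words16:
  "orb g e (\<lambda>x. - x I2 I3 + x I1 I2) = cls g e 3"
  "orb g e (\<lambda>x. - x I1 I3 + (x I2 I3 + x I2 I1)) = cls g e 7"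
  "orb g e (\<lambda>x. - x I2 I3 + (- x I2 I1 + x I1 I2)) = cls g e 8"
  "orb g e (\<lambda>x. - x I2 I3 + (- x I2 I1 + - x I1 I2)) = cls g e 12"
  by (rule orb_clsI[of I2 I1 I3 _ True True False];
      simp add: word_simps del: add_uminus_conv_diff)+

lemma orb_words17:
  "orb g e (\<lambda>x. - x I2 I3 + x I2 I1) = cls g e 2"
  "orb g e (\<lambda>x. - x I2 I3 + (- x I2 I1 + - x I2 I1)) = cls g e 10"
  "orb g e (\<lambda>x. - x I2 I3 + (- x I2 I3 + (- x I2 I1 + - x I2 I1))) = cls g e 14"
  "orb g e (\<lambda>x. x I1 I3 + (- x I2 I3 + (- x I2 I3 + (- x I2 I1 + - x I2 I1)))) = cls g e 11"
  by (rule orb_clsI[of I1 I3 I2 _ True False True];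
      simp add: word_simps del: add_uminus_conv_diff)+

lemma orb_words18:
  "orb g e (\<lambda>x. x I2 I3 + - x I1 I2) = cls g e 3"
  "orb g e (\<lambda>x. - x I1 I3 + (- x I2 I3 + - x I2 I1)) = cls g e 7"
  "orb g e (\<lambda>x. - x I2 I3 + (- x I2 I3 + - x I1 I2)) = cls g e 11"
  "orb g e (\<lambda>x. x I1 I3 + (- x I2 I3 + (- x I2 I3 + - x I1 I2))) = cls g e 15"
  by (rule orb_clsI[of I2 I1 I3 _ True False False];
      simp add: word_simps del: add_uminus_conv_diff)+

lemma orb_words19:
  "orb g e (\<lambda>x. x I2 I3 + - x I2 I1) = cls g e 2"
  by (rule orb_clsI_uminus[of I1 I3 I2 _ True False True];
      simp add: word_simps del: add_uminus_conv_diff)+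

lemma orb_words20:
  "orb g e (\<lambda>x. - x I1 I3 + - x I1 I2) = cls g e 2"
  by (rule orb_clsI[of I3 I1 I2 _ False False True];
      simp add: word_simps del: add_uminus_conv_diff)+

lemma orb_words21:
  "orb g e (\<lambda>x. - x I1 I3 + - x I2 I1) = cls g e 3"
  by (rule orb_clsI[of I1 I2 I3 _ True False False];
      simp add: word_simps del: add_uminus_conv_diff)+

lemma orb_words22:
  "orb g e (\<lambda>x. - x I2 I3 + - x I1 I2) = cls g e 3"
  by (rule orb_clsI[of I2 I1 I3 _ False True False];
      simp add: word_simps del: add_uminus_conv_diff)+

lemma orb_words23:
  "orb g e (\<lambda>x. - x I2 I3 + - x I2 I1) = cls g e 2"
  by (rule orb_clsI[of I1 I3 I2 _ False False True];
      simp add: word_simps del: add_uminus_conv_diff)+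

lemma orb_words24:
  "orb g e (\<lambda>x. x I1 I3 + (x I2 I3 + x I1 I2)) = cls g e 3"
  "orb g e (\<lambda>x. - x I1 I3 + (- x I2 I3 + - x I2 I3)) = cls g e 10"
  "orb g e (\<lambda>x. - x I1 I3 + (- x I2 I3 + (- x I2 I3 + x I2 I1))) = cls g e 7"
  "orb g e (\<lambda>x. - x I1 I3 + (x I2 I3 + (- x I1 I2 + - x I2 I1))) = cls g e 12"
  "orb g e (\<lambda>x. - x I1 I3 + (- x I1 I3 + (- x I2 I3 + (- x I2 I3 + x I1 I2)))) = cls g e 11"
  "orb g e (\<lambda>x. x I1 I3 + (- x I2 I3 + (- x I2 I3 + (- x I2 I1 + - x I1 I2)))) = cls g e 13"
  "orb g e (\<lambda>x. x I1 I3 + (x I1 I3 + (- x I2 I3 + (- x I2 I3 + (- x I1 I2 + - x I2 I1))))) = cls g e 21"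
  by (rule orb_clsI_uminus[of I2 I1 I3 _ False True False];
      simp add: word_simps del: add_uminus_conv_diff)+

lemma orb_words25:
  "orb g e (\<lambda>x. x I1 I3 + (x I2 I3 + x I2 I1)) = cls g e 3"
  "orb g e (\<lambda>x. - x I1 I3 + (- x I1 I3 + (- x I2 I3 + x I1 I2))) = cls g e 7"
  "orb g e (\<lambda>x. x I1 I3 + (- x I2 I3 + (- x I2 I1 + - x I1 I2))) = cls g e 12"
  "orb g e (\<lambda>x. - x I1 I3 + (- x I1 I3 + (- x I2 I3 + (- x I2 I3 + x I2 I1)))) = cls g e 11"
  "orb g e (\<lambda>x. - x I1 I3 + (- x I1 I3 + (x I2 I3 + (- x I1 I2 + - x I2 I1)))) = cls g e 13"
  "orb g e (\<lambda>x. - x I1 I3 + (- x I1 I3 + (x I2 I3 + (x I2 I3 + (- x I2 I1 + - x I1 I2))))) = cls g e 21"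
  by (rule orb_clsI_uminus[of I1 I2 I3 _ True False False];
      simp add: word_simps del: add_uminus_conv_diff)+

lemma orb_words26:
  "orb g e (\<lambda>x. x I2 I3 + (- x I1 I2 + x I2 I1)) = cls g e 9"
  "orb g e (\<lambda>x. x I1 I3 + (- x I2 I3 + - x I2 I1)) = cls g e 3"
  "orb g e (\<lambda>x. x I1 I3 + (- x I2 I3 + (- x I2 I1 + x I1 I2))) = cls g e 8"
  "orb g e (\<lambda>x. - x I1 I3 + (- x I1 I3 + (x I2 I3 + - x I1 I2))) = cls g e 7"
  "orb g e (\<lambda>x. - x I2 I3 + (- x I2 I3 + (- x I1 I2 + x I2 I1))) = cls g e 17"
  "orb g e (\<lambda>x. - x I1 I3 + (- x I1 I3 + (x I2 I3 + (- x I1 I2 + x I2 I1)))) = cls g e 23"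
  by (rule orb_clsI_uminus[of I1 I2 I3 _ True True False];
      simp add: word_simps del: add_uminus_conv_diff)+

lemma orb_words27:
  "orb g e (\<lambda>x. - x I1 I3 + (- x I1 I3 + x I1 I2)) = cls g e 10"
  by (rule orb_clsI_uminus[of I3 I2 I1 _ False False True];
      simp add: word_simps del: add_uminus_conv_diff)+

lemma orb_words28:
  "orb g e (\<lambda>x. - x I1 I3 + (- x I2 I3 + x I1 I2)) = cls g e 3"
  "orb g e (\<lambda>x. x I1 I3 + (- x I2 I3 + (- x I1 I2 + - x I2 I1))) = cls g e 12"
  "orb g e (\<lambda>x. - x I1 I3 + (x I2 I3 + (x I2 I3 + (- x I2 I1 + - x I1 I2)))) = cls g e 13"
  by (rule orb_clsI_uminus[of I2 I1 I3 _ True False False];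
      simp add: word_simps del: add_uminus_conv_diff)+

lemma orb_words29:
  "orb g e (\<lambda>x. - x I1 I3 + (x I2 I3 + - x I1 I2)) = cls g e 3"
  "orb g e (\<lambda>x. - x I1 I3 + (x I2 I3 + (- x I1 I2 + x I2 I1))) = cls g e 8"
  "orb g e (\<lambda>x. x I1 I3 + (- x I2 I3 + (- x I2 I3 + - x I2 I1))) = cls g e 7"
  by (rule orb_clsI_uminus[of I2 I1 I3 _ True True False];
      simp add: word_simps del: add_uminus_conv_diff)+

lemma orb_words30:
  "orb g e (\<lambda>x. - x I2 I3 + (- x I2 I3 + x I2 I1)) = cls g e 10"
  by (rule orb_clsI_uminus[of I2 I3 I1 _ False False True];
      simp add: word_simps del: add_uminus_conv_diff)+

lemma orb_words31:
  "orb g e (\<lambda>x. - x I1 I3 + (- x I1 I3 + - x I1 I2)) = cls g e 10"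
  by (rule orb_clsI_uminus[of I3 I2 I1 _ False True True];
      simp add: word_simps del: add_uminus_conv_diff)+

lemma orb_words32:
  "orb g e (\<lambda>x. - x I1 I3 + (- x I2 I1 + - x I2 I1)) = cls g e 11"
  by (rule orb_clsI_uminus[of I1 I3 I2 _ True True True];
      simp add: word_simps del: add_uminus_conv_diff)+

lemma orb_words33:
  "orb g e (\<lambda>x. - x I2 I3 + (- x I2 I3 + - x I2 I1)) = cls g e 10"
  by (rule orb_clsI_uminus[of I2 I3 I1 _ True False True];
      simp add: word_simps del: add_uminus_conv_diff)+

lemma orb_words34:
  "orb g e (\<lambda>x. - x I2 I3 + (- x I1 I2 + - x I1 I2)) = cls g e 11"
  by (rule orb_clsI_uminus[of I3 I1 I2 _ True True True];
      simp add: word_simps del: add_uminus_conv_diff)+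

lemma orb_words35:
  "orb g e (\<lambda>x. - x I1 I3 + (x I2 I3 + (- x I2 I1 + - x I2 I1))) = cls g e 15"
  "orb g e (\<lambda>x. - x I1 I3 + (x I2 I3 + (x I2 I3 + (- x I2 I1 + - x I2 I1)))) = cls g e 11"
  "orb g e (\<lambda>x. x I1 I3 + (- x I2 I3 + (- x I2 I3 + (- x I2 I3 + (- x I2 I1 + - x I2 I1))))) = cls g e 20"
  by (rule orb_clsI[of I1 I3 I2 _ False True True];
      simp add: word_simps del: add_uminus_conv_diff)+

lemma orb_words36:
  "orb g e (\<lambda>x. x I1 I3 + (- x I2 I3 + (- x I1 I2 + - x I1 I2))) = cls g e 15"
  "orb g e (\<lambda>x. x I1 I3 + (x I1 I3 + (- x I2 I3 + (- x I1 I2 + - x I1 I2)))) = cls g e 11"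
  "orb g e (\<lambda>x. - x I1 I3 + (- x I1 I3 + (- x I1 I3 + (x I2 I3 + (- x I1 I2 + - x I1 I2))))) = cls g e 20"
  by (rule orb_clsI[of I3 I1 I2 _ True False True];
      simp add: word_simps del: add_uminus_conv_diff)+

lemmas orb_words = orb_words1 orb_words2 orb_words3 orb_words4 orb_words5 orb_words6 orb_words7 orb_words8 orb_words9 orb_words10 orb_words11 orb_words12 orb_words13 orb_words14 orb_words15 orb_words16 orb_words17 orb_words18 orb_words19 orb_words20 orb_words21 orb_words22 orb_words23 orb_words24 orb_words25 orb_words26 orb_words27 orb_words28 orb_words29 orb_words30 orb_words31 orb_words32 orb_words33 orb_words34 orb_words35 orb_words36

section \<open>Gram entries of the three bases in terms of the 27 orbit sums\<close>

lemmas gram_simps = gram_def isotypic_def flip_def scal_def act_def ys_even_def ys_odd_def ys_vec_def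
  minus_add add.assoc steinberg_nf steinberg_nf_left orb_words

text \<open>Only the entries on and above the diagonal are tabulated;
  \<open>gram_isotypic_commute\<close> gives the others. The congruence rule lets simplification
  assume \<open>steinberg x\<close> inside the bound words, where the normal form rules need it. In
  each line the coefficients add up to zero, as the augmentation requires.\<close>

lemma gram_ys_even0:
  "gram g e (ys_even ! 0) (isotypic 1 1 (ys_even ! 0)) = 20 * cls g e 0 - 32 * cls g e 1 + 8 * cls g e 2 + 4 * cls g e 5"
  "gram g e (ys_even ! 0) (isotypic 1 1 (ys_even ! 1)) = 16 * cls g e 0 - 32 * cls g e 1 + 8 * cls g e 2 + 8 * cls g e 3"
  "gram g e (ys_even ! 0) (isotypic 1 1 (ys_even ! 2)) = 16 * cls g e 0 - 8 * cls g e 1 - 16 * cls g e 2 + 8 * cls g e 10"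
  "gram g e (ys_even ! 0) (isotypic 1 1 (ys_even ! 3)) = 16 * cls g e 0 - 12 * cls g e 1 - 16 * cls g e 2 + 4 * cls g e 3 + 4 * cls g e 7 + 4 * cls g e 10"
  "gram g e (ys_even ! 0) (isotypic 1 1 (ys_even ! 4)) = 16 * cls g e 0 - 16 * cls g e 1 + 4 * cls g e 2 - 12 * cls g e 3 + 4 * cls g e 7 + 4 * cls g e 15"
  "gram g e (ys_even ! 0) (isotypic 1 1 (ys_even ! 5)) = 16 * cls g e 0 - 12 * cls g e 1 - 12 * cls g e 3 + 4 * cls g e 7 + 4 * cls g e 11"
  by (simp_all add: gram_simps cong: orb_cong[OF e] del: add_uminus_conv_diff)

lemma gram_ys_even1:
  "gram g e (ys_even ! 1) (isotypic 1 1 (ys_even ! 1)) = 20 * cls g e 0 - 32 * cls g e 1 + 4 * cls g e 4 + 4 * cls g e 5 + 4 * cls g e 6"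
  "gram g e (ys_even ! 1) (isotypic 1 1 (ys_even ! 2)) = 16 * cls g e 0 - 16 * cls g e 1 - 16 * cls g e 2 + 8 * cls g e 3 + 8 * cls g e 7"
  "gram g e (ys_even ! 1) (isotypic 1 1 (ys_even ! 3)) = 16 * cls g e 0 - 12 * cls g e 1 - 16 * cls g e 2 + 4 * cls g e 8 + 4 * cls g e 10 + 4 * cls g e 12"
  "gram g e (ys_even ! 1) (isotypic 1 1 (ys_even ! 4)) = 16 * cls g e 0 - 12 * cls g e 1 - 16 * cls g e 3 + 4 * cls g e 9 + 4 * cls g e 11 + 4 * cls g e 13"
  "gram g e (ys_even ! 1) (isotypic 1 1 (ys_even ! 5)) = 16 * cls g e 0 - 16 * cls g e 1 + 4 * cls g e 2 - 16 * cls g e 3 + 4 * cls g e 8 + 4 * cls g e 12 + 4 * cls g e 15"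
  by (simp_all add: gram_simps cong: orb_cong[OF e] del: add_uminus_conv_diff)

lemma gram_ys_even2:
  "gram g e (ys_even ! 2) (isotypic 1 1 (ys_even ! 2)) = 20 * cls g e 0 - 32 * cls g e 2 + 8 * cls g e 5 + 4 * cls g e 14"
  "gram g e (ys_even ! 2) (isotypic 1 1 (ys_even ! 3)) = 16 * cls g e 0 - 32 * cls g e 2 + 8 * cls g e 3 + 4 * cls g e 7 + 4 * cls g e 19"
  "gram g e (ys_even ! 2) (isotypic 1 1 (ys_even ! 4)) = 16 * cls g e 0 + 4 * cls g e 1 - 16 * cls g e 2 - 16 * cls g e 3 + 4 * cls g e 10 + 8 * cls g e 11"
  "gram g e (ys_even ! 2) (isotypic 1 1 (ys_even ! 5)) = 16 * cls g e 0 - 8 * cls g e 2 - 16 * cls g e 3 + 4 * cls g e 15 + 4 * cls g e 20"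
  by (simp_all add: gram_simps cong: orb_cong[OF e] del: add_uminus_conv_diff)

lemma gram_ys_even3:
  "gram g e (ys_even ! 3) (isotypic 1 1 (ys_even ! 3)) = 18 * cls g e 0 - 32 * cls g e 2 + 4 * cls g e 5 + 2 * cls g e 9 + 4 * cls g e 13 + 2 * cls g e 14 + 2 * cls g e 23"
  "gram g e (ys_even ! 3) (isotypic 1 1 (ys_even ! 4)) = 16 * cls g e 0 - 12 * cls g e 2 - 16 * cls g e 3 + 2 * cls g e 8 + 2 * cls g e 12 + 2 * cls g e 15 + 2 * cls g e 18 + 2 * cls g e 20 + 2 * cls g e 26"
  "gram g e (ys_even ! 3) (isotypic 1 1 (ys_even ! 5)) = 16 * cls g e 0 + 2 * cls g e 1 - 16 * cls g e 2 - 16 * cls g e 3 + 2 * cls g e 4 + 2 * cls g e 6 + 2 * cls g e 10 + 4 * cls g e 11 + 2 * cls g e 16 + 2 * cls g e 21"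
  by (simp_all add: gram_simps cong: orb_cong[OF e] del: add_uminus_conv_diff)

lemma gram_ys_even4:
  "gram g e (ys_even ! 4) (isotypic 1 1 (ys_even ! 4)) = 18 * cls g e 0 - 32 * cls g e 3 + 2 * cls g e 4 + 2 * cls g e 5 + 2 * cls g e 14 + 2 * cls g e 17 + 4 * cls g e 21 + 2 * cls g e 25"
  "gram g e (ys_even ! 4) (isotypic 1 1 (ys_even ! 5)) = 16 * cls g e 0 + 2 * cls g e 1 - 32 * cls g e 3 + 2 * cls g e 8 + 4 * cls g e 10 + 2 * cls g e 12 + 2 * cls g e 18 + 2 * cls g e 22 + 2 * cls g e 24"
  by (simp_all add: gram_simps cong: orb_cong[OF e] del: add_uminus_conv_diff)

lemma gram_ys_even5:
  "gram g e (ys_even ! 5) (isotypic 1 1 (ys_even ! 5)) = 18 * cls g e 0 - 32 * cls g e 3 + 2 * cls g e 5 + 2 * cls g e 9 + 4 * cls g e 13 + 2 * cls g e 14 + 2 * cls g e 23 + 2 * cls g e 25"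
  by (simp_all add: gram_simps cong: orb_cong[OF e] del: add_uminus_conv_diff)

lemma gram_ys_odd0:
  "gram g e (ys_odd ! 0) (isotypic 1 1 (ys_odd ! 0)) = 4 * cls g e 0 - 8 * cls g e 2 + 4 * cls g e 5"
  "gram g e (ys_odd ! 0) (isotypic 1 1 (ys_odd ! 1)) = 8 * cls g e 2 - 8 * cls g e 3"
  "gram g e (ys_odd ! 0) (isotypic 1 1 (ys_odd ! 2)) = 4 * cls g e 1 - 4 * cls g e 3 - 4 * cls g e 7 + 4 * cls g e 10"
  "gram g e (ys_odd ! 0) (isotypic 1 1 (ys_odd ! 3)) = - 4 * cls g e 2 + 4 * cls g e 3 + 4 * cls g e 7 - 4 * cls g e 15"
  "gram g e (ys_odd ! 0) (isotypic 1 1 (ys_odd ! 4)) = - 4 * cls g e 1 + 4 * cls g e 3 + 4 * cls g e 7 - 4 * cls g e 11"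
  by (simp_all add: gram_simps cong: orb_cong[OF e] del: add_uminus_conv_diff)

lemma gram_ys_odd1:
  "gram g e (ys_odd ! 1) (isotypic 1 1 (ys_odd ! 1)) = 4 * cls g e 0 - 4 * cls g e 4 + 4 * cls g e 5 - 4 * cls g e 6"
  "gram g e (ys_odd ! 1) (isotypic 1 1 (ys_odd ! 2)) = 4 * cls g e 1 - 4 * cls g e 8 + 4 * cls g e 10 - 4 * cls g e 12"
  "gram g e (ys_odd ! 1) (isotypic 1 1 (ys_odd ! 3)) = 4 * cls g e 1 - 4 * cls g e 9 + 4 * cls g e 11 - 4 * cls g e 13"
  "gram g e (ys_odd ! 1) (isotypic 1 1 (ys_odd ! 4)) = 4 * cls g e 2 - 4 * cls g e 8 - 4 * cls g e 12 + 4 * cls g e 15"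
  by (simp_all add: gram_simps cong: orb_cong[OF e] del: add_uminus_conv_diff)

lemma gram_ys_odd2:
  "gram g e (ys_odd ! 2) (isotypic 1 1 (ys_odd ! 2)) = 2 * cls g e 0 + 4 * cls g e 5 - 2 * cls g e 9 - 4 * cls g e 13 + 2 * cls g e 14 - 2 * cls g e 23"
  "gram g e (ys_odd ! 2) (isotypic 1 1 (ys_odd ! 3)) = 4 * cls g e 2 - 2 * cls g e 8 - 2 * cls g e 12 + 2 * cls g e 15 - 2 * cls g e 18 + 2 * cls g e 20 - 2 * cls g e 26"
  "gram g e (ys_odd ! 2) (isotypic 1 1 (ys_odd ! 4)) = 2 * cls g e 1 - 2 * cls g e 4 - 2 * cls g e 6 + 2 * cls g e 10 + 4 * cls g e 11 - 2 * cls g e 16 - 2 * cls g e 21"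
  by (simp_all add: gram_simps cong: orb_cong[OF e] del: add_uminus_conv_diff)

lemma gram_ys_odd3:
  "gram g e (ys_odd ! 3) (isotypic 1 1 (ys_odd ! 3)) = 2 * cls g e 0 - 2 * cls g e 4 + 2 * cls g e 5 + 2 * cls g e 14 - 2 * cls g e 17 - 4 * cls g e 21 + 2 * cls g e 25"
  "gram g e (ys_odd ! 3) (isotypic 1 1 (ys_odd ! 4)) = 2 * cls g e 1 - 2 * cls g e 8 + 4 * cls g e 10 - 2 * cls g e 12 - 2 * cls g e 18 - 2 * cls g e 22 + 2 * cls g e 24"
  by (simp_all add: gram_simps cong: orb_cong[OF e] del: add_uminus_conv_diff)

lemma gram_ys_odd4:
  "gram g e (ys_odd ! 4) (isotypic 1 1 (ys_odd ! 4)) = 2 * cls g e 0 + 2 * cls g e 5 - 2 * cls g e 9 - 4 * cls g e 13 + 2 * cls g e 14 - 2 * cls g e 23 + 2 * cls g e 25"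
  by (simp_all add: gram_simps cong: orb_cong[OF e] del: add_uminus_conv_diff)

lemma gram_ys_vec0:
  "gram g e (ys_vec ! 0) (isotypic (-1) 1 (ys_vec ! 0)) = 2 * cls g e 0 - 2 * cls g e 5"
  "gram g e (ys_vec ! 0) (isotypic (-1) 1 (ys_vec ! 1)) = 2 * cls g e 1 - 2 * cls g e 10"
  "gram g e (ys_vec ! 0) (isotypic (-1) 1 (ys_vec ! 2)) = 2 * cls g e 1 - 2 * cls g e 10"
  "gram g e (ys_vec ! 0) (isotypic (-1) 1 (ys_vec ! 3)) = - 2 * cls g e 3 + 2 * cls g e 7"
  "gram g e (ys_vec ! 0) (isotypic (-1) 1 (ys_vec ! 4)) = 2 * cls g e 3 - 2 * cls g e 7"
  "gram g e (ys_vec ! 0) (isotypic (-1) 1 (ys_vec ! 5)) = 2 * cls g e 2 - 2 * cls g e 15"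
  "gram g e (ys_vec ! 0) (isotypic (-1) 1 (ys_vec ! 6)) = - 2 * cls g e 3 + 2 * cls g e 7"
  "gram g e (ys_vec ! 0) (isotypic (-1) 1 (ys_vec ! 7)) = 2 * cls g e 1 - 2 * cls g e 11"
  by (simp_all add: gram_simps cong: orb_cong[OF e] del: add_uminus_conv_diff)

lemma gram_ys_vec1:
  "gram g e (ys_vec ! 1) (isotypic (-1) 1 (ys_vec ! 1)) = cls g e 0 - cls g e 14"
  "gram g e (ys_vec ! 1) (isotypic (-1) 1 (ys_vec ! 2)) = 2 * cls g e 3 - cls g e 7 - cls g e 19"
  "gram g e (ys_vec ! 1) (isotypic (-1) 1 (ys_vec ! 3)) = - cls g e 7 + cls g e 19"
  "gram g e (ys_vec ! 1) (isotypic (-1) 1 (ys_vec ! 4)) = cls g e 1 - cls g e 10"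
  "gram g e (ys_vec ! 1) (isotypic (-1) 1 (ys_vec ! 5)) = cls g e 1 + cls g e 10 - 2 * cls g e 11"
  "gram g e (ys_vec ! 1) (isotypic (-1) 1 (ys_vec ! 6)) = - cls g e 15 + cls g e 20"
  "gram g e (ys_vec ! 1) (isotypic (-1) 1 (ys_vec ! 7)) = 2 * cls g e 2 - cls g e 15 - cls g e 20"
  by (simp_all add: gram_simps cong: orb_cong[OF e] del: add_uminus_conv_diff)

lemma gram_ys_vec2:
  "gram g e (ys_vec ! 2) (isotypic (-1) 1 (ys_vec ! 2)) = cls g e 0 - cls g e 14"
  "gram g e (ys_vec ! 2) (isotypic (-1) 1 (ys_vec ! 3)) = - cls g e 9 + cls g e 23"
  "gram g e (ys_vec ! 2) (isotypic (-1) 1 (ys_vec ! 4)) = cls g e 15 - cls g e 20"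
  "gram g e (ys_vec ! 2) (isotypic (-1) 1 (ys_vec ! 5)) = cls g e 8 + cls g e 12 - cls g e 18 - cls g e 26"
  "gram g e (ys_vec ! 2) (isotypic (-1) 1 (ys_vec ! 6)) = - cls g e 1 + cls g e 10"
  "gram g e (ys_vec ! 2) (isotypic (-1) 1 (ys_vec ! 7)) = cls g e 4 + cls g e 6 - cls g e 16 - cls g e 21"
  by (simp_all add: gram_simps cong: orb_cong[OF e] del: add_uminus_conv_diff)

lemma gram_ys_vec3:
  "gram g e (ys_vec ! 3) (isotypic (-1) 1 (ys_vec ! 3)) = cls g e 0 - 2 * cls g e 5 + cls g e 14"
  "gram g e (ys_vec ! 3) (isotypic (-1) 1 (ys_vec ! 4)) = cls g e 8 - cls g e 12 - cls g e 18 + cls g e 26"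
  "gram g e (ys_vec ! 3) (isotypic (-1) 1 (ys_vec ! 5)) = - cls g e 15 + cls g e 20"
  "gram g e (ys_vec ! 3) (isotypic (-1) 1 (ys_vec ! 6)) = cls g e 4 - cls g e 6 - cls g e 16 + cls g e 21"
  "gram g e (ys_vec ! 3) (isotypic (-1) 1 (ys_vec ! 7)) = - cls g e 1 + cls g e 10"
  by (simp_all add: gram_simps cong: orb_cong[OF e] del: add_uminus_conv_diff)

lemma gram_ys_vec4:
  "gram g e (ys_vec ! 4) (isotypic (-1) 1 (ys_vec ! 4)) = cls g e 0 - cls g e 5 - cls g e 14 + cls g e 25"
  "gram g e (ys_vec ! 4) (isotypic (-1) 1 (ys_vec ! 5)) = cls g e 4 - cls g e 17"
  "gram g e (ys_vec ! 4) (isotypic (-1) 1 (ys_vec ! 6)) = cls g e 1 - 2 * cls g e 10 + cls g e 24"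
  "gram g e (ys_vec ! 4) (isotypic (-1) 1 (ys_vec ! 7)) = cls g e 8 + cls g e 12 - cls g e 18 - cls g e 22"
  by (simp_all add: gram_simps cong: orb_cong[OF e] del: add_uminus_conv_diff)

lemma gram_ys_vec5:
  "gram g e (ys_vec ! 5) (isotypic (-1) 1 (ys_vec ! 5)) = cls g e 0 - cls g e 5 + cls g e 14 - cls g e 25"
  "gram g e (ys_vec ! 5) (isotypic (-1) 1 (ys_vec ! 6)) = cls g e 8 - cls g e 12 - cls g e 18 + cls g e 22"
  "gram g e (ys_vec ! 5) (isotypic (-1) 1 (ys_vec ! 7)) = cls g e 1 - cls g e 24"
  by (simp_all add: gram_simps cong: orb_cong[OF e] del: add_uminus_conv_diff)

lemma gram_ys_vec6:
  "gram g e (ys_vec ! 6) (isotypic (-1) 1 (ys_vec ! 6)) = cls g e 0 - cls g e 5 - cls g e 14 + cls g e 25"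
  "gram g e (ys_vec ! 6) (isotypic (-1) 1 (ys_vec ! 7)) = - cls g e 9 + cls g e 23"
  by (simp_all add: gram_simps cong: orb_cong[OF e] del: add_uminus_conv_diff)

lemma gram_ys_vec7:
  "gram g e (ys_vec ! 7) (isotypic (-1) 1 (ys_vec ! 7)) = cls g e 0 + cls g e 5 - cls g e 14 - cls g e 25"
  by (simp_all add: gram_simps cong: orb_cong[OF e] del: add_uminus_conv_diff)

end

section \<open>The certificate\<close>

text \<open>The Gram matrices were found by semidefinite programming, rounded to integers, and then corrected
  so that the linear equations expressing the identity in \<open>frame_sum_sos\<close> hold exactly. Each \<open>L\<close> is a
  rounded, scaled Cholesky factor of \<open>M\<close> minus a small diagonal matrix, so that
  \<open>N M - L\<^sup>T L\<close> is diagonally dominant.\<close>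

definition M_even :: "real list list" where
  "M_even = [
     [2944, 1092, -1020, -426, 234, -972],
     [1092, 1642, 164, -1030, -1318, 576],
     [-1020, 164, 660, -76, -700, 570],
     [-426, -1030, -76, 1391, 1080, -1266],
     [234, -1318, -700, 1080, 1684, -1281],
     [-972, 576, 570, -1266, -1281, 1841]]"

text \<open>Triangular after a reordering of the columns: the pivots are not taken in the natural
  order. The same holds for \<open>L_odd\<close> and \<open>L_vec\<close>.\<close>

definition L_even :: "real list list" where
  "L_even = [
     [2900, -1719, -1701, 3777, 3822, -5491],
     [2013, 4171, 1379, -904, -3602, 0],
     [5979, 2421, -2434, -2695, 0, 0],
     [0, 133, 208, -645, 0, 0],
     [0, 784, -157, 0, 0, 0],
     [0, 0, 138, 0, 0, 0]]"

definition M_odd :: "real list list" where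
  "M_odd = [
     [1662, -462, -984, 654, 930],
     [-462, 1428, -550, -616, -68],
     [-984, -550, 1182, -237, -628],
     [654, -616, -237, 622, 200],
     [930, -68, -628, 200, 646]]"

definition L_odd :: "real list list" where
  "L_odd = [
     [1832, 1024, -2200, 441, 1169],
     [1856, -2030, 0, 1008, 898],
     [0, 822, 0, -1129, 424],
     [0, 0, 0, 245, -505],
     [0, 0, 0, 0, 168]]"

definition M_vec :: "real list list" where
  "M_vec = [
     [26432, -8096, -6314, 1316, 5756, -1496, 1054, -12468],
     [-8096, 5082, -226, 78, -3018, -1792, -80, 5638],
     [-6314, -226, 5294, -792, -802, 3310, 756, -214],
     [1316, 78, -792, 2086, 676, 950, -1062, -1092],
     [5756, -3018, -802, 676, 2332, 1062, -661, -3638],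
     [-1496, -1792, 3310, 950, 1062, 4206, -676, -2823],
     [1054, -80, 756, -1062, -661, -676, 1622, -612],
     [-12468, 5638, -214, -1092, -3638, -2823, -612, 9334]]"

definition L_vec :: "real list list" where
  "L_vec = [
     [20560, -12903, 574, -198, 7664, 4551, 203, -14318],
     [16622, 0, -13157, 1964, 2332, -8045, -1874, -92],
     [1225, 0, 0, -6611, -2582, -7235, 5273, 3881],
     [12678, 0, 0, 1380, -82, 0, 4080, -9260],
     [1194, 0, 0, 4317, 495, 0, -428, 0],
     [1733, 0, 0, 0, -2117, 0, 2212, 0],
     [497, 0, 0, 0, -887, 0, 0, 0],
     [417, 0, 0, 0, 0, 0, 0, 0]]"

text \<open>Every row becomes a rewrite rule of its own, so that evaluating one entry does not
  unfold the whole matrix.\<close>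

lemmas M_even_rows =
  M_even_def[THEN arg_cong[of _ _ "\<lambda>m. m ! 0"], simplified]
  M_even_def[THEN arg_cong[of _ _ "\<lambda>m. m ! 1"], simplified]
  M_even_def[THEN arg_cong[of _ _ "\<lambda>m. m ! 2"], simplified]
  M_even_def[THEN arg_cong[of _ _ "\<lambda>m. m ! 3"], simplified]
  M_even_def[THEN arg_cong[of _ _ "\<lambda>m. m ! 4"], simplified]
  M_even_def[THEN arg_cong[of _ _ "\<lambda>m. m ! 5"], simplified]

lemmas L_even_rows =
  L_even_def[THEN arg_cong[of _ _ "\<lambda>m. m ! 0"], simplified]
  L_even_def[THEN arg_cong[of _ _ "\<lambda>m. m ! 1"], simplified]
  L_even_def[THEN arg_cong[of _ _ "\<lambda>m. m ! 2"], simplified]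
  L_even_def[THEN arg_cong[of _ _ "\<lambda>m. m ! 3"], simplified]
  L_even_def[THEN arg_cong[of _ _ "\<lambda>m. m ! 4"], simplified]
  L_even_def[THEN arg_cong[of _ _ "\<lambda>m. m ! 5"], simplified]

lemmas M_odd_rows =
  M_odd_def[THEN arg_cong[of _ _ "\<lambda>m. m ! 0"], simplified]
  M_odd_def[THEN arg_cong[of _ _ "\<lambda>m. m ! 1"], simplified]
  M_odd_def[THEN arg_cong[of _ _ "\<lambda>m. m ! 2"], simplified]
  M_odd_def[THEN arg_cong[of _ _ "\<lambda>m. m ! 3"], simplified]
  M_odd_def[THEN arg_cong[of _ _ "\<lambda>m. m ! 4"], simplified]

lemmas L_odd_rows =
  L_odd_def[THEN arg_cong[of _ _ "\<lambda>m. m ! 0"], simplified]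
  L_odd_def[THEN arg_cong[of _ _ "\<lambda>m. m ! 1"], simplified]
  L_odd_def[THEN arg_cong[of _ _ "\<lambda>m. m ! 2"], simplified]
  L_odd_def[THEN arg_cong[of _ _ "\<lambda>m. m ! 3"], simplified]
  L_odd_def[THEN arg_cong[of _ _ "\<lambda>m. m ! 4"], simplified]

lemmas M_vec_rows =
  M_vec_def[THEN arg_cong[of _ _ "\<lambda>m. m ! 0"], simplified]
  M_vec_def[THEN arg_cong[of _ _ "\<lambda>m. m ! 1"], simplified]
  M_vec_def[THEN arg_cong[of _ _ "\<lambda>m. m ! 2"], simplified]
  M_vec_def[THEN arg_cong[of _ _ "\<lambda>m. m ! 3"], simplified]
  M_vec_def[THEN arg_cong[of _ _ "\<lambda>m. m ! 4"], simplified]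
  M_vec_def[THEN arg_cong[of _ _ "\<lambda>m. m ! 5"], simplified]
  M_vec_def[THEN arg_cong[of _ _ "\<lambda>m. m ! 6"], simplified]
  M_vec_def[THEN arg_cong[of _ _ "\<lambda>m. m ! 7"], simplified]

lemmas L_vec_rows =
  L_vec_def[THEN arg_cong[of _ _ "\<lambda>m. m ! 0"], simplified]
  L_vec_def[THEN arg_cong[of _ _ "\<lambda>m. m ! 1"], simplified]
  L_vec_def[THEN arg_cong[of _ _ "\<lambda>m. m ! 2"], simplified]
  L_vec_def[THEN arg_cong[of _ _ "\<lambda>m. m ! 3"], simplified]
  L_vec_def[THEN arg_cong[of _ _ "\<lambda>m. m ! 4"], simplified]
  L_vec_def[THEN arg_cong[of _ _ "\<lambda>m. m ! 5"], simplified]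
  L_vec_def[THEN arg_cong[of _ _ "\<lambda>m. m ! 6"], simplified]
  L_vec_def[THEN arg_cong[of _ _ "\<lambda>m. m ! 7"], simplified]

section \<open>Symmetry of the Gram form and the finite positivity checks\<close>

lemma sum_list_swap:
  fixes F :: "'a \<Rightarrow> 'b \<Rightarrow> real"
  shows "(\<Sum>a\<leftarrow>y. \<Sum>b\<leftarrow>z. F a b) = (\<Sum>b\<leftarrow>z. \<Sum>a\<leftarrow>y. F a b)"
  by (induction y) (simp_all add: sum_list_addf)

text \<open>The words \<open>- w x + w' x\<close> and \<open>- w' x + w x\<close> are inverse to
  each other, and \<open>hcoeff\<close> does not distinguish inverses.\<close>

lemma gram_commute: "gram g e y z = gram g e z y"
proof -
  have "hcoeff g (pt (- a + b)) = hcoeff g (pt (- b + a))" for a b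
    using hcoeff_uminus_pt[of g "- a + b"] by (simp add: minus_add)
  hence *: "orb g e (\<lambda>x. - w x + w' x) = orb g e (\<lambda>x. - w' x + w x)" for w w'
    by (simp add: orb_def)
  define F where "F y z = fst y * fst z * orb g e (\<lambda>x. - snd y x + snd z x)" for y z :: "real \<times> _"
  have "F y z = F z y" for y z
    using *[of "snd y" "snd z"] by (simp add: F_def)
  hence "(\<Sum>a\<leftarrow>y. \<Sum>b\<leftarrow>z. F a b) = (\<Sum>a\<leftarrow>y. \<Sum>b\<leftarrow>z. F b a)" by simp
  also have "\<dots> = (\<Sum>b\<leftarrow>z. \<Sum>a\<leftarrow>y. F b a)" by (rule sum_list_swap)
  finally show ?thesis
    by (simp add: gram_def F_def case_prod_unfold)
qed

lemma gram_isotypic_commute: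
  assumes "a * a = 1" "b * b = 1"
  shows "gram g e y (isotypic a b z) = gram g e z (isotypic a b y)"
  using gram_isotypic[OF assms, of g e y z] gram_isotypic[OF assms, of g e z y]
    gram_commute[of g e "isotypic a b y" "isotypic a b z"] by simp

lemma sum_symmetric:
  fixes F :: "nat \<Rightarrow> nat \<Rightarrow> real"
  assumes "\<And>i j. i < n \<Longrightarrow> j < n \<Longrightarrow> F i j = F j i"
  shows "(\<Sum>i<n. \<Sum>j<n. F i j) = (\<Sum>i<n. F i i + 2 * (\<Sum>j<i. F j i))"
  using assms
proof (induction n)
  case (Suc n)
  have "(\<Sum>i<n. F i n) = (\<Sum>j<n. F n j)"
    by (intro sum.cong refl Suc.prems) auto
  with Suc show ?case by (simp add: sum.distrib)
qed simp

text \<open>The lengths below 5 serve the inner sums over j < i produced by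
  \<open>sum_symmetric\<close>.\<close>

lemma sum_lessThan_small:
  fixes f :: "nat \<Rightarrow> real"
  shows "(\<Sum>i<2. f i) = f 0 + f 1"
    "(\<Sum>i<3. f i) = f 0 + f 1 + f 2" "(\<Sum>i<4. f i) = f 0 + f 1 + f 2 + f 3"
    "(\<Sum>i<5. f i) = f 0 + f 1 + f 2 + f 3 + f 4"
    "(\<Sum>i<6. f i) = f 0 + f 1 + f 2 + f 3 + f 4 + f 5"
    "(\<Sum>i<7. f i) = f 0 + f 1 + f 2 + f 3 + f 4 + f 5 + f 6"
    "(\<Sum>i<8. f i) = f 0 + f 1 + f 2 + f 3 + f 4 + f 5 + f 6 + f 7"
  by (simp_all add: eval_nat_numeral)

lemma all_less_small:
  "(\<forall>i<5. P i) \<longleftrightarrow> P 0 \<and> P 1 \<and> P 2 \<and> P 3 \<and> P (4::nat)"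
  "(\<forall>i<6. P i) \<longleftrightarrow> P 0 \<and> P 1 \<and> P 2 \<and> P 3 \<and> P 4 \<and> P (5::nat)"
  "(\<forall>i<8. P i) \<longleftrightarrow> P 0 \<and> P 1 \<and> P 2 \<and> P 3 \<and> P 4 \<and> P 5 \<and> P 6 \<and> P (7::nat)"
  by (auto simp: numeral_eq_Suc All_less_Suc2)

lemma M_symmetric:
  "\<forall>i<6. \<forall>j<6. M_even ! i ! j = M_even ! j ! i"
  "\<forall>i<5. \<forall>j<5. M_odd ! i ! j = M_odd ! j ! i"
  "\<forall>i<8. \<forall>j<8. M_vec ! i ! j = M_vec ! j ! i"
  unfolding all_less_small by (simp_all add: M_even_rows M_odd_rows M_vec_rows)

text \<open>The factor 16384 scales the real Cholesky factor by 128 before it is rounded to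
  integers. The rounding errors have to stay below the small diagonal that was set aside; the
  factors 4096 and 32768 below play the same part.\<close>

lemma diag_dominant_even:
  "\<forall>i<6. (\<Sum>j<6. if j = i then 0 else \<bar>16384 * M_even ! i ! j - (\<Sum>k<6. L_even ! k ! i * L_even ! k ! j)\<bar>)
      \<le> 16384 * M_even ! i ! i - (\<Sum>k<6. L_even ! k ! i * L_even ! k ! i)"
  unfolding all_less_small by (intro conjI; simp add: sum_lessThan_small M_even_rows L_even_rows)

lemma diag_dominant_odd:
  "\<forall>i<5. (\<Sum>j<5. if j = i then 0 else \<bar>4096 * M_odd ! i ! j - (\<Sum>k<5. L_odd ! k ! i * L_odd ! k ! j)\<bar>)
      \<le> 4096 * M_odd ! i ! i - (\<Sum>k<5. L_odd ! k ! i * L_odd ! k ! i)"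
  unfolding all_less_small by (intro conjI; simp add: sum_lessThan_small M_odd_rows L_odd_rows)

lemma diag_dominant_vec:
  "\<forall>i<8. (\<Sum>j<8. if j = i then 0 else \<bar>32768 * M_vec ! i ! j - (\<Sum>k<8. L_vec ! k ! i * L_vec ! k ! j)\<bar>)
      \<le> 32768 * M_vec ! i ! i - (\<Sum>k<8. L_vec ! k ! i * L_vec ! k ! i)"
  unfolding all_less_small by (intro conjI; simp add: sum_lessThan_small M_vec_rows L_vec_rows)

text \<open>The conditional in the dominance sum replaces a set difference, so that the sum can be
  evaluated term by term.\<close>

lemma sos_gram_list:
  fixes Y :: "nat \<Rightarrow> 'g::group_add \<Rightarrow>\<^sub>0 real" and M L :: "real list list"
  assumes "\<And>i. i < n \<Longrightarrow> keys (Y i) \<subseteq> B" "N > 0"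
    and "\<forall>i<n. \<forall>j<n. M ! i ! j = M ! j ! i"
    and "\<forall>i<n. (\<Sum>j<n. if j = i then 0 else \<bar>N * M ! i ! j - (\<Sum>k<n. L ! k ! i * L ! k ! j)\<bar>)
                 \<le> N * M ! i ! i - (\<Sum>k<n. L ! k ! i * L ! k ! i)"
  shows "(\<Sum>i<n. \<Sum>j<n. cst (M ! i ! j) * (star (Y i) * Y j)) \<in> sos B"
proof (rule sos_gram[OF assms(1,2)])
  fix i assume "i < n"
  hence "(\<Sum>j\<in>{..<n}-{i}. \<bar>N * M ! i ! j - (\<Sum>k<n. L ! k ! i * L ! k ! j)\<bar>)
      = (\<Sum>j<n. if j = i then 0 else \<bar>N * M ! i ! j - (\<Sum>k<n. L ! k ! i * L ! k ! j)\<bar>)"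
    by (intro sum.mono_neutral_cong_left) auto
  with assms(4) \<open>i < n\<close>
  show "(\<Sum>j\<in>{..<n}-{i}. \<bar>N * M ! i ! j - (\<Sum>k<n. L ! k ! i * L ! k ! j)\<bar>)
      \<le> N * M ! i ! i - (\<Sum>k<n. L ! k ! i * L ! k ! i)" by simp
qed (use assms(3) in auto)

section \<open>Edge Laplacians and the coefficients of the certificate\<close>

definition edge :: "('a \<Rightarrow> 'a \<Rightarrow> 'g::group_add) \<Rightarrow> 'a \<Rightarrow> 'a \<Rightarrow> 'g \<Rightarrow>\<^sub>0 real" where
  "edge x i j = 4 - pt (x i j) - pt (- x i j) - pt (x j i) - pt (- x j i)"

definition edge_vec :: "idx \<Rightarrow> idx \<Rightarrow> 'g::group_add vec" where
  "edge_vec i j = [(4, \<lambda>x. 0), (-1, \<lambda>x. x i j), (-1, \<lambda>x. - x i j), (-1, \<lambda>x. x j i), (-1, \<lambda>x. - x j i)]"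

lemma ev_edge_vec: "ev (edge_vec i j) x = edge x i j"
  by (simp add: edge_def edge_vec_def ev_def single_uminus flip: single_numeral)

lemma star_edge: "star (edge x i j) = edge x i j"
  by (simp add: edge_def star_diff flip: single_numeral)

lemma edge_commute: "edge x i j = edge x j i"
  by (simp add: edge_def)

text \<open>Sign changes and inverse transpose only permute the four generators of an edge. This is
  why a sum over frames of products of edges collapses to a sum over triples.\<close>

lemma edge_act: "edge (act p s t x) i j = edge x (p i) (p j)"
  by (simp add: edge_def act_def Let_def)

context
  fixes g :: "'g::group_add" and e :: "'i::finite \<Rightarrow> 'i \<Rightarrow> 'g"
  assumes e: "steinberg e"
begin

lemma orb_edge1:
  "orb g e (\<lambda>x. x I1 I2) = cls g e 1"
  "orb g e (\<lambda>x. x I1 I2 + x I3 I1) = cls g e 3"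
  by (rule orb_clsI[OF e, of I1 I3 I2 _ False False False];
      simp add: word_simps del: add_uminus_conv_diff)+

lemma orb_edge2:
  "orb g e (\<lambda>x. - x I1 I2) = cls g e 1"
  "orb g e (\<lambda>x. - x I1 I2 + x I3 I1) = cls g e 3"
  by (rule orb_clsI[OF e, of I1 I3 I2 _ False True False];
      simp add: word_simps del: add_uminus_conv_diff)+

lemma orb_edge3:
  "orb g e (\<lambda>x. x I2 I1) = cls g e 1"
  "orb g e (\<lambda>x. x I2 I1 + x I3 I1) = cls g e 2"
  by (rule orb_clsI[OF e, of I3 I1 I2 _ False False False];
      simp add: word_simps del: add_uminus_conv_diff)+

lemma orb_edge4:
  "orb g e (\<lambda>x. - x I2 I1) = cls g e 1"
  "orb g e (\<lambda>x. - x I2 I1 + x I3 I1) = cls g e 2"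
  by (rule orb_clsI[OF e, of I3 I1 I2 _ False True False];
      simp add: word_simps del: add_uminus_conv_diff)+

lemma orb_edge5:
  "orb g e (\<lambda>x. x I1 I3) = cls g e 1"
  by (rule orb_clsI[OF e, of I1 I2 I3 _ False False False];
      simp add: word_simps del: add_uminus_conv_diff)+

lemma orb_edge6:
  "orb g e (\<lambda>x. - x I1 I3) = cls g e 1"
  by (rule orb_clsI[OF e, of I1 I2 I3 _ True False False];
      simp add: word_simps del: add_uminus_conv_diff)+

lemma orb_edge7:
  "orb g e (\<lambda>x. x I3 I1) = cls g e 1"
  by (rule orb_clsI[OF e, of I3 I2 I1 _ False False False];
      simp add: word_simps del: add_uminus_conv_diff)+

lemma orb_edge8:
  "orb g e (\<lambda>x. - x I3 I1) = cls g e 1"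
  by (rule orb_clsI[OF e, of I3 I2 I1 _ True False False];
      simp add: word_simps del: add_uminus_conv_diff)+

lemma orb_edge9:
  "orb g e (\<lambda>x. x I1 I2 + x I1 I3) = cls g e 2"
  by (rule orb_clsI[OF e, of I3 I1 I2 _ True False True];
      simp add: word_simps del: add_uminus_conv_diff)+

lemma orb_edge10:
  "orb g e (\<lambda>x. x I1 I2 + - x I1 I3) = cls g e 2"
  by (rule orb_clsI[OF e, of I3 I1 I2 _ False True True];
      simp add: word_simps del: add_uminus_conv_diff)+

lemma orb_edge11:
  "orb g e (\<lambda>x. - x I1 I2 + x I1 I3) = cls g e 2"
  by (rule orb_clsI[OF e, of I3 I1 I2 _ True True True];
      simp add: word_simps del: add_uminus_conv_diff)+

lemma orb_edge12:
  "orb g e (\<lambda>x. - x I1 I2 + - x I1 I3) = cls g e 2"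
  by (rule orb_clsI[OF e, of I3 I1 I2 _ False False True];
      simp add: word_simps del: add_uminus_conv_diff)+

lemma orb_edge13:
  "orb g e (\<lambda>x. x I1 I2 + - x I3 I1) = cls g e 3"
  by (rule orb_clsI[OF e, of I1 I3 I2 _ True True False];
      simp add: word_simps del: add_uminus_conv_diff)+

lemma orb_edge14:
  "orb g e (\<lambda>x. - x I1 I2 + - x I3 I1) = cls g e 3"
  by (rule orb_clsI[OF e, of I1 I3 I2 _ True False False];
      simp add: word_simps del: add_uminus_conv_diff)+

lemma orb_edge15:
  "orb g e (\<lambda>x. x I2 I1 + x I1 I3) = cls g e 3"
  by (rule orb_clsI[OF e, of I1 I3 I2 _ True False True];
      simp add: word_simps del: add_uminus_conv_diff)+

lemma orb_edge16:
  "orb g e (\<lambda>x. x I2 I1 + - x I1 I3) = cls g e 3"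
  by (rule orb_clsI[OF e, of I1 I3 I2 _ False True True];
      simp add: word_simps del: add_uminus_conv_diff)+

lemma orb_edge17:
  "orb g e (\<lambda>x. - x I2 I1 + x I1 I3) = cls g e 3"
  by (rule orb_clsI[OF e, of I1 I3 I2 _ True True True];
      simp add: word_simps del: add_uminus_conv_diff)+

lemma orb_edge18:
  "orb g e (\<lambda>x. - x I2 I1 + - x I1 I3) = cls g e 3"
  by (rule orb_clsI[OF e, of I1 I3 I2 _ False False True];
      simp add: word_simps del: add_uminus_conv_diff)+

lemma orb_edge19:
  "orb g e (\<lambda>x. x I2 I1 + - x I3 I1) = cls g e 2"
  by (rule orb_clsI[OF e, of I3 I1 I2 _ True True False];
      simp add: word_simps del: add_uminus_conv_diff)+

lemma orb_edge20:
  "orb g e (\<lambda>x. - x I2 I1 + - x I3 I1) = cls g e 2"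
  by (rule orb_clsI[OF e, of I3 I1 I2 _ True False False];
      simp add: word_simps del: add_uminus_conv_diff)+

lemmas orb_edge = orb_edge1 orb_edge2 orb_edge3 orb_edge4 orb_edge5 orb_edge6 orb_edge7 orb_edge8 orb_edge9 orb_edge10 orb_edge11 orb_edge12 orb_edge13 orb_edge14 orb_edge15 orb_edge16 orb_edge17 orb_edge18 orb_edge19 orb_edge20

text \<open>Of the sixteen products of two generators, eight are of commuting pairs in a common row
  or column (class 2), and eight are of pairs with a nontrivial Steinberg commutator (class 3). The
  vector \<open>[(1, \<lambda>x. 0)]\<close> is the identity, so the linear term is a Gram value as
  well.\<close>

lemma gram_edge:
  "gram g e (edge_vec I1 I2) (edge_vec I1 I3)
     = 16 * cls g e 0 - 32 * cls g e 1 + 8 * cls g e 2 + 8 * cls g e 3"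
  "gram g e [(1, \<lambda>x. 0)] (edge_vec I1 I2) = 4 * cls g e 0 - 4 * cls g e 1"
  by (simp_all add: gram_def edge_vec_def orb_edge orb_words1[OF e] del: add_uminus_conv_diff)

lemmas gram_values =
  gram_ys_even0[OF e] gram_ys_even1[OF e] gram_ys_even2[OF e] gram_ys_even3[OF e] gram_ys_even4[OF e]
  gram_ys_even5[OF e] gram_ys_odd0[OF e] gram_ys_odd1[OF e] gram_ys_odd2[OF e] gram_ys_odd3[OF e]
  gram_ys_odd4[OF e] gram_ys_vec0[OF e] gram_ys_vec1[OF e] gram_ys_vec2[OF e] gram_ys_vec3[OF e]
  gram_ys_vec4[OF e] gram_ys_vec5[OF e] gram_ys_vec6[OF e] gram_ys_vec7[OF e]

lemma sum_gram_even:
  "(\<Sum>i<6. \<Sum>j<6. M_even ! i ! j * gram g e (ys_even ! i) (isotypic 1 1 (ys_even ! j)))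
     = 53472 * cls g e 0 - 157372 * cls g e 1 + 88592 * cls g e 2 + 36224 * cls g e 3 + 4872 *
       cls g e 4 + 36238 * cls g e 5 + 1504 * cls g e 6 - 7296 * cls g e 7 - 4436 * cls g e 8 -
       4080 * cls g e 9 - 48880 * cls g e 10 - 39648 * cls g e 11 - 4436 * cls g e 12 + 2384 *
       cls g e 13 + 12472 * cls g e 14 + 15360 * cls g e 15 - 5064 * cls g e 16 + 3368 * cls g e
       17 - 804 * cls g e 18 - 608 * cls g e 19 + 8880 * cls g e 20 + 1672 * cls g e 21 - 5124 *
       cls g e 22 + 6464 * cls g e 23 - 5124 * cls g e 24 + 7050 * cls g e 25 + 4320 * cls g e 26"
proof -
  let ?F = "\<lambda>i j. M_even ! i ! j * gram g e (ys_even ! i) (isotypic 1 1 (ys_even ! j))"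
  have "?F i j = ?F j i" if "i < 6" "j < 6" for i j
    using M_symmetric that by (simp add: gram_isotypic_commute[of _ _ g e "ys_even ! i"])
  \<comment> \<open>Simplification turns the list index \<open>1\<close> into \<open>Suc 0\<close>,
    so the table of Gram values is put into the same form.\<close>
  from sum_symmetric[of 6 ?F, OF this] show ?thesis
    by (simp add: sum_lessThan_small M_even_rows gram_values[unfolded One_nat_def])
qed

lemma sum_gram_odd:
  "(\<Sum>i<5. \<Sum>j<5. M_odd ! i ! j * gram g e (ys_odd ! i) (isotypic 1 1 (ys_odd ! j)))
     = 17260 * cls g e 0 - 26352 * cls g e 1 - 28360 * cls g e 2 + 27936 * cls g e 3 - 4444 * cls
       g e 4 + 19624 * cls g e 5 - 3200 * cls g e 6 + 20544 * cls g e 7 + 5092 * cls g e 8 + 1272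
       * cls g e 9 - 13184 * cls g e 10 - 17392 * cls g e 11 + 5092 * cls g e 12 - 2384 * cls g e
       13 + 4900 * cls g e 14 - 6724 * cls g e 15 + 2512 * cls g e 16 - 1244 * cls g e 17 + 148 *
       cls g e 18 - 948 * cls g e 20 + 24 * cls g e 21 - 800 * cls g e 22 - 3656 * cls g e 23 +
       800 * cls g e 24 + 2536 * cls g e 25 + 948 * cls g e 26"
proof -
  let ?F = "\<lambda>i j. M_odd ! i ! j * gram g e (ys_odd ! i) (isotypic 1 1 (ys_odd ! j))"
  have "?F i j = ?F j i" if "i < 5" "j < 5" for i j
    using M_symmetric that by (simp add: gram_isotypic_commute[of _ _ g e "ys_odd ! i"])
  from sum_symmetric[of 5 ?F, OF this] show ?thesis
    by (simp add: sum_lessThan_small M_odd_rows gram_values[unfolded One_nat_def])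
qed

lemma sum_gram_vec:
  "(\<Sum>i<8. \<Sum>j<8. M_vec ! i ! j * gram g e (ys_vec ! i) (isotypic (-1) 1 (ys_vec ! j)))
     = 82820 * cls g e 0 - 123428 * cls g e 1 + 16568 * cls g e 2 + 12640 * cls g e 3 - 428 * cls
       g e 4 - 55862 * cls g e 5 + 1696 * cls g e 6 - 13248 * cls g e 7 - 656 * cls g e 8 + 2808
       * cls g e 9 + 62064 * cls g e 10 + 57040 * cls g e 11 - 656 * cls g e 12 - 17372 * cls g e
       14 - 8636 * cls g e 15 + 2552 * cls g e 16 - 2124 * cls g e 17 + 656 * cls g e 18 + 608 *
       cls g e 19 - 7932 * cls g e 20 - 1696 * cls g e 21 + 5924 * cls g e 22 - 2808 * cls g e 23
       + 4324 * cls g e 24 - 9586 * cls g e 25 - 5268 * cls g e 26"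
proof -
  let ?F = "\<lambda>i j. M_vec ! i ! j * gram g e (ys_vec ! i) (isotypic (-1) 1 (ys_vec ! j))"
  have "?F i j = ?F j i" if "i < 8" "j < 8" for i j
    using M_symmetric that by (simp add: gram_isotypic_commute[of _ _ g e "ys_vec ! i"])
  from sum_symmetric[of 8 ?F, OF this] show ?thesis
    by (simp add: sum_lessThan_small M_vec_rows gram_values[unfolded One_nat_def])
qed

end

section \<open>Supports in the ball of radius two\<close>

definition gens :: "('i \<Rightarrow> 'i \<Rightarrow> 'g::group_add) \<Rightarrow> 'g set" where
  "gens e = {e i j | i j. i \<noteq> j} \<union> {- e i j | i j. i \<noteq> j}"

definition ball2 :: "('i \<Rightarrow> 'i \<Rightarrow> 'g::group_add) \<Rightarrow> 'g set" where
  "ball2 e = insert 0 (gens e) \<union> (\<Union>x\<in>gens e. (+) x ` gens e)"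

lemma uminus_gens: "x \<in> gens e \<Longrightarrow> - x \<in> gens e"
  by (auto simp: gens_def)

lemma ball2I: "0 \<in> ball2 e" "x \<in> gens e \<Longrightarrow> x \<in> ball2 e"
  "x \<in> gens e \<Longrightarrow> y \<in> gens e \<Longrightarrow> x + y \<in> ball2 e"
  by (auto simp: ball2_def)

lemma gensI: "i \<noteq> j \<Longrightarrow> e i j \<in> gens e" "i \<noteq> j \<Longrightarrow> - e i j \<in> gens e"
  by (auto simp: gens_def)

lemma act_in_gens: "inj m \<Longrightarrow> i \<noteq> j \<Longrightarrow> act m s t e i j \<in> gens e"
  by (auto simp: act_def Let_def inj_eq intro!: gensI)

text \<open>Quantifying over all actions makes the condition stable under the flips and applicable
  to every frame at once.\<close>

definition in_ball2 :: "('i \<Rightarrow> 'i \<Rightarrow> 'g::group_add) \<Rightarrow> 'g vec \<Rightarrow> bool" where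
  "in_ball2 e y \<longleftrightarrow> (\<forall>(c, w)\<in>set y. \<forall>m s t. inj m \<longrightarrow> w (act m s t e) \<in> ball2 e)"

lemma in_ball2_isotypic: "in_ball2 e y \<Longrightarrow> in_ball2 e (isotypic a b y)"
  by (force simp: in_ball2_def isotypic_def scal_def flip_def act_act)

lemma keys_ev:
  assumes "in_ball2 e y" "f \<in> frames"
  shows "keys (ev y (fr e f)) \<subseteq> ball2 e"
  using assms(1)
proof (induction y)
  case (Cons a y)
  have "keys (ev (a # y) (fr e f)) \<subseteq> keys (Poly_Mapping.single (snd a (fr e f)) (fst a)) \<union> keys (ev y (fr e f))"
    using Poly_Mapping.keys_add[of "Poly_Mapping.single (snd a (fr e f)) (fst a)" "ev y (fr e f)"]
    by (simp add: ev_def case_prod_unfold)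
  moreover have "snd a (fr e f) \<in> ball2 e"
    using Cons.prems assms(2) by (auto simp: in_ball2_def fr_def frames_def)
  ultimately show ?case
    using Cons by (auto simp: in_ball2_def split: if_splits)
qed (simp add: ev_def)

lemma in_ball2_ys:
  "\<forall>i<6. in_ball2 e (ys_even ! i)" "\<forall>i<5. in_ball2 e (ys_odd ! i)" "\<forall>i<8. in_ball2 e (ys_vec ! i)"
  unfolding all_less_small
  by (simp_all add: in_ball2_def ys_even_def ys_odd_def ys_vec_def ball2I act_in_gens)

lemma sum_hcoeff_isotypic:
  assumes "a * a = 1" "b * b = 1"
  shows "(\<Sum>f\<in>frames. hcoeff g (\<Sum>i<n. \<Sum>j<n. cst (M i j) *
           (star (ev (isotypic a b (y i)) (fr e f)) * ev (isotypic a b (y j)) (fr e f))))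
    = 4 * (\<Sum>i<n. \<Sum>j<n. M i j * gram g e (y i) (isotypic a b (y j)))"
proof -
  have "(\<Sum>f\<in>frames. hcoeff g (\<Sum>i<n. \<Sum>j<n. cst (M i j) *
           (star (ev (isotypic a b (y i)) (fr e f)) * ev (isotypic a b (y j)) (fr e f))))
      = (\<Sum>f\<in>frames. \<Sum>i<n. \<Sum>j<n. M i j *
           hcoeff g (star (ev (isotypic a b (y i)) (fr e f)) * ev (isotypic a b (y j)) (fr e f)))"
    by (simp add: hcoeff_sum hcoeff_cst_mult)
  also have "\<dots> = (\<Sum>i<n. \<Sum>j<n. M i j * (\<Sum>f\<in>frames.
           hcoeff g (star (ev (isotypic a b (y i)) (fr e f)) * ev (isotypic a b (y j)) (fr e f))))"
    by (subst sum.swap, rule sum.cong[OF refl], subst sum.swap) (simp add: sum_distrib_left)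
  also have "\<dots> = 4 * (\<Sum>i<n. \<Sum>j<n. M i j * gram g e (y i) (isotypic a b (y j)))"
    by (simp add: sum_hcoeff_ev gram_isotypic[OF assms] sum_distrib_left mult.left_commute)
  finally show ?thesis .
qed

text \<open>The factors 38400 and 48 clear denominators, so that the Gram matrices can be integral;
  only their ratio 1/800 matters in the end.\<close>

theorem frame_sum_sos:
  fixes e :: "'i::finite \<Rightarrow> 'i \<Rightarrow> 'g::group_add"
  assumes e: "steinberg e"
  shows "(\<Sum>f\<in>frames. cst 38400 * (edge (fr e f) I1 I2 * edge (fr e f) I1 I3)
            - cst 48 * edge (fr e f) I1 I2) \<in> sos (ball2 e)" (is "?T \<in> _")
proof -
  define Ye where "Ye f i = ev (isotypic 1 1 (ys_even ! i)) (fr e f)" for f i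
  define Yo where "Yo f i = ev (isotypic 1 1 (ys_odd ! i)) (fr e f)" for f i
  define Yv where "Yv f i = ev (isotypic (- 1) 1 (ys_vec ! i)) (fr e f)" for f i
  define Ze where "Ze f = (\<Sum>i<6. \<Sum>j<6. cst (M_even ! i ! j) * (star (Ye f i) * Ye f j))" for f
  define Zo where "Zo f = (\<Sum>i<5. \<Sum>j<5. cst (M_odd ! i ! j) * (star (Yo f i) * Yo f j))" for f
  define Zv where "Zv f = (\<Sum>i<8. \<Sum>j<8. cst (M_vec ! i ! j) * (star (Yv f i) * Yv f j))" for f
  have "Ze f \<in> sos (ball2 e)" "Zo f \<in> sos (ball2 e)" "Zv f \<in> sos (ball2 e)" if "f \<in> frames" for f
    unfolding Ze_def Zo_def Zv_def
    by ((rule sos_gram_list[OF _ _ M_symmetric(1) diag_dominant_even]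
        sos_gram_list[OF _ _ M_symmetric(2) diag_dominant_odd]
        sos_gram_list[OF _ _ M_symmetric(3) diag_dominant_vec];
        simp add: Ye_def Yo_def Yv_def keys_ev in_ball2_isotypic in_ball2_ys[rule_format] that)+)
  hence sos: "(\<Sum>f\<in>frames. Ze f + Zo f + Zv f) \<in> sos (ball2 e)"
    by (intro sos_sum sos_add)
  have "?T = (\<Sum>f\<in>frames. Ze f + Zo f + Zv f)"
  proof (rule self_adjoint_eqI)
    \<comment> \<open>The two edges do not commute, so a single summand need not be self-adjoint. In
      the sum over frames, exchanging \<open>I2\<close> and \<open>I3\<close> exchanges the
      factors.\<close>
    have "(\<Sum>f\<in>frames. edge (fr e f) I1 I3 * edge (fr e f) I1 I2)
        = (\<Sum>f\<in>frames. edge (fr e f) I1 I2 * edge (fr e f) I1 I3)"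
      using sum_frames_act[of "perm I1 I3 I2" "\<lambda>x. edge x I1 I2 * edge x I1 I3" "\<lambda>_. False" False e]
        bij_perm[of I1 I3 I2] by (simp add: edge_act)
    thus "star ?T = ?T"
      by (simp add: star_sum star_diff star_cst_mult star_mult star_edge sum_subtractf
          cst_commute[of "sum _ _"] flip: sum_distrib_left del: single_numeral)
    show "star (\<Sum>f\<in>frames. Ze f + Zo f + Zv f) = (\<Sum>f\<in>frames. Ze f + Zo f + Zv f)"
      by (rule sos_star[OF sos])
    fix g
    have "hcoeff g ?T = 38400 * gram g e (edge_vec I1 I2) (edge_vec I1 I3)
        - 48 * gram g e [(1, \<lambda>x. 0)] (edge_vec I1 I2)"
      unfolding sum_hcoeff_ev[symmetric]
      by (simp add: hcoeff_sum hcoeff_diff hcoeff_cst_mult ev_edge_vec star_edge sum_subtractf sum_distrib_left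
          del: single_numeral)
         (simp add: ev_def)
    \<comment> \<open>A comparison of the 27 coefficients: the classes 4 to 26 cancel among the
      three blocks, and the classes 0 to 3 match those of the edges. The factor 4 comes from
      \<open>gram_isotypic\<close>.\<close>
    also have "\<dots> = 4 * (\<Sum>i<6. \<Sum>j<6. M_even ! i ! j * gram g e (ys_even ! i) (isotypic 1 1 (ys_even ! j)))
        + 4 * (\<Sum>i<5. \<Sum>j<5. M_odd ! i ! j * gram g e (ys_odd ! i) (isotypic 1 1 (ys_odd ! j)))
        + 4 * (\<Sum>i<8. \<Sum>j<8. M_vec ! i ! j * gram g e (ys_vec ! i) (isotypic (-1) 1 (ys_vec ! j)))"
      unfolding gram_edge[OF e] sum_gram_even[OF e] sum_gram_odd[OF e] sum_gram_vec[OF e]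
      by (simp add: algebra_simps)
    also have "\<dots> = (\<Sum>f\<in>frames. hcoeff g (Ze f)) + (\<Sum>f\<in>frames. hcoeff g (Zo f)) + (\<Sum>f\<in>frames. hcoeff g (Zv f))"
      unfolding Ze_def Zo_def Zv_def Ye_def Yo_def Yv_def
      by (simp add: sum_hcoeff_isotypic)
    finally show "hcoeff g ?T = hcoeff g (\<Sum>f\<in>frames. Ze f + Zo f + Zv f)"
      by (simp add: hcoeff_sum hcoeff_add sum.distrib)
  qed
  with sos show ?thesis by simp
qed

section \<open>The square of the Laplacian\<close>

definition triples :: "('i \<times> 'i \<times> 'i) set" where
  "triples = {(i, j, k). i \<noteq> j \<and> j \<noteq> k \<and> i \<noteq> k}"

lemma sum_inj_idx:
  fixes F :: "'i::finite \<Rightarrow> 'i \<Rightarrow> 'i \<Rightarrow> 'c::comm_monoid_add"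
  shows "(\<Sum>m | inj m. F (m I1) (m I2) (m I3)) = (\<Sum>(i, j, k)\<in>triples. F i j k)"
proof -
  define h where "h m = (m I1, m I2, m I3)" for m :: "idx \<Rightarrow> 'i"
  define h' where "h' = (\<lambda>(i :: 'i, j, k) x. case x of I1 \<Rightarrow> i | I2 \<Rightarrow> j | I3 \<Rightarrow> k)"
  have "bij_betw h {m. inj m} triples"
    by (rule bij_betw_byWitness[where f' = h'])
      (auto simp: h_def h'_def triples_def inj_def fun_eq_iff split: idx.splits)
  from sum.reindex_bij_betw[OF this, of "\<lambda>(i, j, k). F i j k"] show ?thesis
    by (simp add: h_def)
qed

text \<open>By \<open>edge_act\<close> the summand of a frame depends only on its embedding, so each
  triple is counted \<open>K\<close> times, once per choice of signs and transpose. Dividing by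
  38400 K leaves 48/38400 = 1/800.\<close>

lemma triple_sum_sos:
  fixes e :: "'i::finite \<Rightarrow> 'i \<Rightarrow> 'g::group_add"
  assumes e: "steinberg e"
  shows "(\<Sum>(i, j, k)\<in>triples. edge e i j * edge e i k) - cst (1/800) * (\<Sum>(i, j, k)\<in>triples. edge e i j)
    \<in> sos (ball2 e)"
proof -
  define K where "K = card (UNIV :: ((idx \<Rightarrow> bool) \<times> bool) set)"
  have K: "K > 0" by (simp add: K_def finite_UNIV_card_ge_0)
  define F where "F i j k = cst 38400 * (edge e i j * edge e i k) - cst 48 * edge e i j" for i j k
  have "(\<Sum>f\<in>frames. cst 38400 * (edge (fr e f) I1 I2 * edge (fr e f) I1 I3)
            - cst 48 * edge (fr e f) I1 I2) = (\<Sum>(m, st)\<in>{m. inj m} \<times> (UNIV :: ((idx \<Rightarrow> bool) \<times> bool) set). F (m I1) (m I2) (m I3))"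
    unfolding frames_def by (rule sum.cong[OF refl]) (auto simp: fr_def edge_act F_def)
  also have "\<dots> = of_nat K * (\<Sum>(i, j, k)\<in>triples. F i j k)"
    by (simp add: sum.cartesian_product[symmetric] K_def sum_distrib_left sum_inj_idx[symmetric]
        del: card_UNIV_unit UNIV_Times_UNIV)
  finally have "cst (1 / (38400 * K)) * (of_nat K * (\<Sum>(i, j, k)\<in>triples. F i j k)) \<in> sos (ball2 e)"
    using frame_sum_sos[OF e] by (intro sos_cst_mult) auto
  also have "cst (1 / (38400 * K)) * (of_nat K * (\<Sum>(i, j, k)\<in>triples. F i j k))
      = cst (1 / 38400) * (\<Sum>(i, j, k)\<in>triples. F i j k)"
    using K unfolding single_of_nat[symmetric] cst_mult_cst by simp
  also have "\<dots> = (\<Sum>(i, j, k)\<in>triples. edge e i j * edge e i k) - cst (1/800) * (\<Sum>(i, j, k)\<in>triples. edge e i j)"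
    by (simp add: F_def sum_distrib_left right_diff_distrib sum_subtractf case_prod_unfold cst_mult_cst
        del: single_numeral)
  finally show ?thesis .
qed

section \<open>Squares of edges and products of disjoint edges\<close>

definition diff1 :: "'g::group_add \<Rightarrow> 'g \<Rightarrow>\<^sub>0 real" where
  "diff1 x = 1 - pt x"

lemma edge_diff1: "edge e i j = star (diff1 (e i j)) * diff1 (e i j) + star (diff1 (e j i)) * diff1 (e j i)"
  by (simp add: edge_def diff1_def star_diff algebra_simps mult_single)

text \<open>When \<open>x\<close> and \<open>y\<close> commute, the four factors commute as well and
  regroup into one square. Its root is supported on 0, x, y and x + y, which lies in the ball of
  radius two for generators.\<close>

lemma commuting_squares:
  fixes x y :: "'g::group_add"
  assumes "x + y = y + x"
  shows "star (diff1 x) * diff1 x * (star (diff1 y) * diff1 y)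
    = star (diff1 x * diff1 y) * (diff1 x * diff1 y)"
proof -
  have "star (diff1 y) * star (diff1 x) = star (diff1 x) * star (diff1 y)"
    "star (diff1 y) * diff1 x = diff1 x * star (diff1 y)"
    using assms commute_uminus[OF assms]
    by (simp_all add: diff1_def star_diff ring_distribs mult_single del: add_uminus_conv_diff)
  thus ?thesis
    by (simp add: star_mult) (metis mult.assoc)
qed

lemma commuting_product_sos:
  assumes "x + y = y + x" "x \<in> gens e" "y \<in> gens e"
  shows "star (diff1 x) * diff1 x * (star (diff1 y) * diff1 y) \<in> sos (ball2 e)"
proof -
  have "diff1 x * diff1 y = pt 0 - pt x - pt y + pt (x + y)"
    by (simp add: diff1_def algebra_simps mult_single)
  hence "keys (diff1 x * diff1 y) \<subseteq> {0, x, y, x + y}"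
    by (auto simp: in_keys_iff lookup_add lookup_minus lookup_single lookup_one lookup_numeral when_def split: if_splits)
  also have "\<dots> \<subseteq> ball2 e"
    using assms by (auto intro: ball2I)
  finally show ?thesis
    unfolding commuting_squares[OF assms(1)] by (rule sos_square)
qed

lemma disjoint_edges_sos:
  assumes e: "steinberg e" and "i \<noteq> j" "k \<noteq> l" "i \<noteq> k" "i \<noteq> l" "j \<noteq> k" "j \<noteq> l"
  shows "edge e i j * edge e k l \<in> sos (ball2 e)"
proof -
  have "e a b + e c d = e c d + e a b" if "{a, b} = {i, j}" "{c, d} = {k, l}" for a b c d
    using that assms by (intro steinberg_commute[OF e]) (auto simp: doubleton_eq_iff)
  thus ?thesis
    unfolding edge_diff1 distrib_left distrib_right using assms(2,3)
    by (intro sos_add commuting_product_sos gensI) auto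
qed

lemma edge_square_sos: "i \<noteq> j \<Longrightarrow> edge e i j * edge e i j \<in> sos (ball2 e)"
proof -
  assume "i \<noteq> j"
  have "edge e i j = pt 0 + pt 0 + pt 0 + pt 0 - pt (e i j) - pt (- e i j) - pt (e j i) - pt (- e j i)"
    by (simp add: edge_def)
  hence "keys (edge e i j) \<subseteq> {0, e i j, - e i j, e j i, - e j i}"
    by (auto simp: in_keys_iff lookup_add lookup_minus lookup_single lookup_one lookup_numeral when_def split: if_splits)
  also have "\<dots> \<subseteq> ball2 e"
    using \<open>i \<noteq> j\<close> by (auto intro: ball2I gensI)
  finally show ?thesis
    using sos_square[of "edge e i j" "ball2 e"] by (simp add: star_edge)
qed

text \<open>Every edge is counted in both directions, so for the matrix generators this is twice the
  Laplacian (\<open>edges_sum_elg\<close>).\<close>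

definition edges_sum :: "('i::finite \<Rightarrow> 'i \<Rightarrow> 'g::group_add) \<Rightarrow> 'g \<Rightarrow>\<^sub>0 real" where
  "edges_sum e = (\<Sum>i\<in>UNIV. \<Sum>j\<in>-{i}. edge e i j)"

lemma sum_triples:
  fixes F :: "'i::finite \<Rightarrow> 'i \<Rightarrow> 'i \<Rightarrow> 'c::comm_monoid_add"
  shows "(\<Sum>(i, j, k)\<in>triples. F i j k) = (\<Sum>i\<in>UNIV. \<Sum>j\<in>-{i}. \<Sum>k\<in>-{i,j}. F i j k)"
proof -
  have "triples = Sigma UNIV (\<lambda>i :: 'i. Sigma (-{i}) (\<lambda>j. -{i,j}))"
    by (auto simp: triples_def)
  thus ?thesis by (simp add: sum.Sigma)
qed

lemma sum_pairs_swap: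
  fixes F :: "'i::finite \<Rightarrow> 'i \<Rightarrow> 'c::comm_monoid_add"
  shows "(\<Sum>i\<in>UNIV. \<Sum>j\<in>-{i}. F i j) = (\<Sum>i\<in>UNIV. \<Sum>j\<in>-{i}. F j i)"
proof -
  have *: "(\<Sum>i\<in>UNIV. \<Sum>j\<in>-{i}. F i j) = (\<Sum>i\<in>UNIV. \<Sum>j\<in>UNIV. if i = j then 0 else F i j)" for F :: "'i \<Rightarrow> 'i \<Rightarrow> 'c"
    by (intro sum.cong refl sum.mono_neutral_cong_left) auto
  have "(\<Sum>i\<in>UNIV. \<Sum>j\<in>UNIV. if i = j then 0 else F i j) = (\<Sum>j\<in>UNIV. \<Sum>i\<in>UNIV. if j = i then 0 else F i j)"
    by (subst sum.swap) (simp add: eq_commute)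
  thus ?thesis by (simp only: *)
qed

text \<open>With the first edge fixed, the ordered pairs for the second one are sorted by how they
  meet {i, j}: the same edge (two pairs), a common end i, a common end j, or disjoint. Each case of
  one common end contributes the sum over triples twice, hence the factor 4.\<close>

lemma edges_sum_square:
  fixes e :: "'i::finite \<Rightarrow> 'i \<Rightarrow> 'g::group_add"
  shows "edges_sum e * edges_sum e
    = 2 * (\<Sum>i\<in>UNIV. \<Sum>j\<in>-{i}. edge e i j * edge e i j)
      + 4 * (\<Sum>(i, j, k)\<in>triples. edge e i j * edge e i k)
      + (\<Sum>i\<in>UNIV. \<Sum>j\<in>-{i}. \<Sum>k\<in>-{i,j}. \<Sum>l\<in>-{i,j,k}. edge e i j * edge e k l)"
proof -
  have split: "edges_sum e = 2 * edge e i j + 2 * (\<Sum>k\<in>-{i,j}. edge e i k)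
      + 2 * (\<Sum>k\<in>-{i,j}. edge e j k) + (\<Sum>k\<in>-{i,j}. \<Sum>l\<in>-{i,j,k}. edge e k l)" if "i \<noteq> j" for i j
  proof -
    have out: "sum f UNIV = f i + (f j + sum f (-{i,j}))" for f :: "'i \<Rightarrow> 'g \<Rightarrow>\<^sub>0 real"
    proof -
      have "(UNIV :: 'i set) = insert i (insert j (-{i,j}))" by auto
      thus ?thesis using that by (metis (no_types, lifting) ComplD finite insert_iff sum.insert singletonD)
    qed
    have "-{i} = insert j (-{i,j})" "-{j} = insert i (-{i,j})"
      using that by auto
    hence 1: "(\<Sum>k\<in>-{i}. edge e i k) = edge e i j + (\<Sum>k\<in>-{i,j}. edge e i k)"
      "(\<Sum>k\<in>-{j}. edge e j k) = edge e i j + (\<Sum>k\<in>-{i,j}. edge e j k)"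
      using that by (simp_all add: edge_commute[of e j i])
    have 2: "(\<Sum>l\<in>-{k}. edge e k l) = edge e i k + (edge e j k + (\<Sum>l\<in>-{i,j,k}. edge e k l))"
      if "k \<in> -{i,j}" for k
    proof -
      have "-{k} = insert i (insert j (-{i,j,k}))" using that \<open>i \<noteq> j\<close> by auto
      thus ?thesis using \<open>i \<noteq> j\<close> by (simp add: edge_commute[of e k])
    qed
    have "edges_sum e = (edge e i j + (\<Sum>k\<in>-{i,j}. edge e i k)) + ((edge e i j + (\<Sum>k\<in>-{i,j}. edge e j k))
        + ((\<Sum>k\<in>-{i,j}. edge e i k) + ((\<Sum>k\<in>-{i,j}. edge e j k)
        + (\<Sum>k\<in>-{i,j}. \<Sum>l\<in>-{i,j,k}. edge e k l))))"
      unfolding edges_sum_def out 1 by (simp add: 2 sum.distrib)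
    thus ?thesis by (simp add: algebra_simps mult_2)
  qed
  define A where "A = (\<Sum>(i, j, k)\<in>triples. edge e i j * edge e i k)"
  have A1: "(\<Sum>i\<in>UNIV. \<Sum>j\<in>-{i}. edge e i j * (\<Sum>k\<in>-{i,j}. edge e i k)) = A"
    by (simp add: A_def sum_triples sum_distrib_left)
  \<comment> \<open>Reversing the direction of the first edge turns the common end \<open>j\<close>
    into the first index of the triple.\<close>
  have A2: "(\<Sum>i\<in>UNIV. \<Sum>j\<in>-{i}. edge e i j * (\<Sum>k\<in>-{i,j}. edge e j k)) = A"
    by (subst sum_pairs_swap) (simp add: A1[symmetric] insert_commute edge_commute)
  have "edges_sum e * edges_sum e = (\<Sum>i\<in>UNIV. \<Sum>j\<in>-{i}. edge e i j * edges_sum e)"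
    by (subst (1) edges_sum_def) (simp add: sum_distrib_right)
  also have "\<dots> = (\<Sum>i\<in>UNIV. \<Sum>j\<in>-{i}. 2 * (edge e i j * edge e i j)
      + 2 * (edge e i j * (\<Sum>k\<in>-{i,j}. edge e i k)) + 2 * (edge e i j * (\<Sum>k\<in>-{i,j}. edge e j k))
      + (\<Sum>k\<in>-{i,j}. \<Sum>l\<in>-{i,j,k}. edge e i j * edge e k l))"
    by (intro sum.cong refl, subst split) (auto simp: distrib_left sum_distrib_left mult_2 mult_2_right)
  also have "\<dots> = 2 * (\<Sum>i\<in>UNIV. \<Sum>j\<in>-{i}. edge e i j * edge e i j) + 2 * A + 2 * A
      + (\<Sum>i\<in>UNIV. \<Sum>j\<in>-{i}. \<Sum>k\<in>-{i,j}. \<Sum>l\<in>-{i,j,k}. edge e i j * edge e k l)"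
    unfolding A1[symmetric] sum.distrib sum_distrib_left[symmetric]
    using A1 A2 by (simp add: sum_distrib_left)
  also have "2 * (\<Sum>i\<in>UNIV. \<Sum>j\<in>-{i}. edge e i j * edge e i j) + 2 * A + 2 * A
      = 2 * (\<Sum>i\<in>UNIV. \<Sum>j\<in>-{i}. edge e i j * edge e i j) + 4 * A"
    by (simp add: add.assoc flip: distrib_right)
  finally show ?thesis
    by (simp add: A_def)
qed

theorem edges_sum_sos:
  fixes e :: "'i::finite \<Rightarrow> 'i \<Rightarrow> 'g::group_add"
  assumes e: "steinberg e" and card: "CARD('i) \<ge> 2"
  shows "edges_sum e * edges_sum e - cst ((real CARD('i) - 2) / 200) * edges_sum e \<in> sos (ball2 e)"
proof -
  define A where "A = (\<Sum>(i, j, k)\<in>triples. edge e i j * edge e i k)"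
  \<comment> \<open>An ordered pair extends to a triple in n - 2 ways. The gap 4 (n - 2)/800 of the
    conclusion results.\<close>
  have "(\<Sum>(i, j, k)\<in>triples. edge e i j) = (\<Sum>i\<in>UNIV. \<Sum>j\<in>-{i}. of_nat (CARD('i) - 2) * edge e i j)"
    by (simp add: sum_triples Compl_eq_Diff_UNIV card_Diff_subset eq_commute numeral_2_eq_2)
  also have "\<dots> = cst (real CARD('i) - 2) * edges_sum e"
    using card by (simp add: edges_sum_def sum_distrib_left of_nat_diff flip: single_of_nat)
  finally have B: "(\<Sum>(i, j, k)\<in>triples. edge e i j) = cst (real CARD('i) - 2) * edges_sum e" .
  have "cst 2 * (\<Sum>i\<in>UNIV. \<Sum>j\<in>-{i}. edge e i j * edge e i j)
      + cst 4 * (A - cst (1/800) * (\<Sum>(i, j, k)\<in>triples. edge e i j))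
      + (\<Sum>i\<in>UNIV. \<Sum>j\<in>-{i}. \<Sum>k\<in>-{i,j}. \<Sum>l\<in>-{i,j,k}. edge e i j * edge e k l) \<in> sos (ball2 e)"
    unfolding A_def
    by (intro sos_add sos_cst_mult sos_sum triple_sum_sos[OF e] edge_square_sos disjoint_edges_sos[OF e]) auto
  also have "cst 2 * (\<Sum>i\<in>UNIV. \<Sum>j\<in>-{i}. edge e i j * edge e i j)
      + cst 4 * (A - cst (1/800) * (\<Sum>(i, j, k)\<in>triples. edge e i j))
      + (\<Sum>i\<in>UNIV. \<Sum>j\<in>-{i}. \<Sum>k\<in>-{i,j}. \<Sum>l\<in>-{i,j,k}. edge e i j * edge e k l)
     = edges_sum e * edges_sum e - cst 4 * (cst (1/800) * (cst (real CARD('i) - 2) * edges_sum e))"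
    unfolding edges_sum_square A_def[symmetric] B
    by (simp add: algebra_simps)
  also have "cst 4 * (cst (1/800) * (cst (real CARD('i) - 2) * edges_sum e))
      = cst ((real CARD('i) - 2) / 200) * edges_sum e"
    unfolding cst_mult_cst by (rule arg_cong[of _ _ "\<lambda>c. cst c * edges_sum e"]) simp
  finally show ?thesis .
qed

section \<open>Elementary matrices generate the special linear group\<close>

text \<open>The parameter \<open>c\<close> makes this the c-th power of an elementary matrix for i
  different from j; inverses and multiples of row operations are then covered uniformly.\<close>

definition emat :: "'n::finite \<Rightarrow> 'n \<Rightarrow> int \<Rightarrow> int^'n^'n" where
  "emat i j c = (\<chi> a b. (if a = b then 1 else 0) + (if a = i \<and> b = j then c else 0))"

lemma emat_mult_nth: "(emat i j c ** A) $ a $ b = A $ a $ b + (if a = i then c * A $ j $ b else 0)"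
proof -
  have "(emat i j c ** A) $ a $ b = (\<Sum>k\<in>UNIV. (if k = a then A $ k $ b else 0)
      + (if k = j then if a = i then c * A $ k $ b else 0 else 0))"
    unfolding matrix_matrix_mult_def emat_def by (auto intro!: sum.cong simp: distrib_right)
  thus ?thesis by (simp add: sum.distrib)
qed

lemma mult_emat_nth: "(A ** emat i j c) $ a $ b = A $ a $ b + (if b = j then c * A $ a $ i else 0)"
proof -
  have "(A ** emat i j c) $ a $ b = (\<Sum>k\<in>UNIV. (if k = b then A $ a $ k else 0)
      + (if k = i then if b = j then c * A $ a $ k else 0 else 0))"
    unfolding matrix_matrix_mult_def emat_def by (auto intro!: sum.cong simp: distrib_left)
  thus ?thesis by (simp add: sum.distrib)
qed

lemma mat_1_nth: "(mat 1 :: int^'n^'n::finite) $ a $ b = (if a = b then 1 else 0)"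
  by (simp add: mat_def)

lemma emat_nth: "emat i j c $ a $ b = (if a = b then 1 else 0) + (if a = i \<and> b = j then c else 0)"
  by (simp add: emat_def)

lemma emat_0 [simp]: "emat i j 0 = mat 1"
  by (simp add: vec_eq_iff emat_nth mat_1_nth)

lemma emat_mult_emat: "i \<noteq> j \<Longrightarrow> emat i j c ** emat i j d = emat i j (c + d)"
  by (auto simp: vec_eq_iff emat_mult_nth emat_nth algebra_simps)

lemma det_emat_mult:
  assumes "i \<noteq> j" shows "det (emat i j c ** A) = det A"
proof -
  have "emat i j c ** A = (\<chi> k. if k = i then row i A + c *s row j A else row k A)"
    by (auto simp: vec_eq_iff emat_mult_nth row_def)
  thus ?thesis by (simp add: det_row_operation[OF assms])
qed

lemma det_emat: "i \<noteq> j \<Longrightarrow> det (emat i j c) = 1"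
  using det_emat_mult[of i j c "mat 1"] by simp

inductive_set EL :: "(int^'n^'n::finite) set" where
  one: "mat 1 \<in> EL"
| emat: "A \<in> EL \<Longrightarrow> i \<noteq> j \<Longrightarrow> emat i j c ** A \<in> EL"

lemma EL_mult_emat: "A \<in> EL \<Longrightarrow> i \<noteq> j \<Longrightarrow> A ** emat i j c \<in> EL"
proof (induction rule: EL.induct)
  case one
  thus ?case using EL.emat[OF EL.one, of i j c] by simp
qed (auto simp: matrix_mul_assoc[symmetric] intro: EL.emat)

lemma EL_cancel_left:
  assumes "emat i j c ** A \<in> EL" "i \<noteq> j" shows "A \<in> EL"
  using EL.emat[OF assms, of "- c"] assms(2) by (simp add: matrix_mul_assoc emat_mult_emat)

lemma EL_cancel_right:
  assumes "A ** emat i j c \<in> EL" "i \<noteq> j" shows "A \<in> EL"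
  using EL_mult_emat[OF assms, of "- c"] assms(2)
  by (simp add: matrix_mul_assoc[symmetric] emat_mult_emat)

lemma EL_right_inverse: "A \<in> EL \<Longrightarrow> \<exists>B\<in>EL. A ** B = mat 1"
proof (induction rule: EL.induct)
  case one
  show ?case using EL.one by (intro bexI[of _ "mat 1"]) auto
next
  case (emat A i j c)
  then obtain B where B: "B \<in> EL" "A ** B = mat 1" by blast
  have "emat i j c ** A ** (B ** emat i j (- c)) = emat i j c ** (A ** B) ** emat i j (- c)"
    by (simp only: matrix_mul_assoc)
  also have "\<dots> = mat 1" using B emat.hyps by (simp add: emat_mult_emat)
  finally show ?case using EL_mult_emat[OF B(1) emat.hyps(2)] by blast
qed

text \<open>Being the identity outside the block \<open>K\<close> stands in for a smaller matrix, so
  that the induction can run over \<open>card K\<close> while the matrix type stays fixed.\<close>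

definition agree :: "'n set \<Rightarrow> int^'n^'n::finite \<Rightarrow> bool" where
  "agree K A \<longleftrightarrow> (\<forall>i j. i \<notin> K \<or> j \<notin> K \<longrightarrow> A $ i $ j = (if i = j then 1 else 0))"

lemma agreeD: "agree K A \<Longrightarrow> i \<notin> K \<or> j \<notin> K \<Longrightarrow> A $ i $ j = (if i = j then 1 else 0)"
  by (simp add: agree_def)

lemma agree_emat_mult: "agree K A \<Longrightarrow> i \<in> K \<Longrightarrow> j \<in> K \<Longrightarrow> agree K (emat i j c ** A)"
  by (auto simp: agree_def emat_mult_nth)

lemma agree_mult_emat: "agree K A \<Longrightarrow> i \<in> K \<Longrightarrow> j \<in> K \<Longrightarrow> agree K (A ** emat i j c)"
  by (auto simp: agree_def mult_emat_nth)

text \<open>The common divisor \<open>v\<close> is pulled out of column \<open>k\<close>, read as a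
  row of the transpose. With v = 0 this says that a zero column forces determinant 0.\<close>

lemma dvd_det:
  fixes A :: "int^'n^'n::finite"
  assumes "\<And>i. v dvd A $ i $ k" shows "v dvd det A"
proof -
  define w where "w = (\<chi> i. A $ i $ k div v)"
  have "transpose A = (\<chi> i. if i = k then v *s w else transpose A $ i)"
    using assms by (auto simp: vec_eq_iff transpose_def w_def)
  hence "det (transpose A) = det (\<chi> i. if i = k then v *s w else transpose A $ i)"
    by (rule arg_cong)
  also have "\<dots> = v * det (\<chi> i. if i = k then w else transpose A $ i)"
    by (rule det_row_mul)
  finally show ?thesis by simp
qed

text \<open>Euclid's algorithm as an extremal argument: among all matrices reachable from
  \<open>A\<close>, take one whose column \<open>k\<close> has least sum of absolute values. Two
  nonzero entries could still be reduced, and a single one divides the determinant 1.\<close>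

lemma column_reduction:
  fixes A :: "int^'n^'n::finite"
  assumes "agree K A" "k \<in> K" "det A = 1"
  obtains B r where "agree K B" "det B = 1" "B \<in> EL \<Longrightarrow> A \<in> EL" "r \<in> K"
    "B $ r $ k = 1 \<or> B $ r $ k = -1" "\<And>i. i \<noteq> r \<Longrightarrow> B $ i $ k = 0"
proof -
  define P where "P B \<longleftrightarrow> agree K B \<and> det B = 1 \<and> (B \<in> EL \<longrightarrow> A \<in> EL)" for B
  define \<mu> where "\<mu> B = (\<Sum>i\<in>UNIV. nat \<bar>B $ i $ k\<bar>)" for B :: "int^'n^'n"
  have "P A" using assms by (simp add: P_def)
  then obtain B where B: "P B" and min: "\<And>C. P C \<Longrightarrow> \<mu> B \<le> \<mu> C"
    using ex_has_least_nat[of P A \<mu>] by blast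
  have K: "i \<in> K" if "B $ i $ k \<noteq> 0" for i
    using that B \<open>k \<in> K\<close> unfolding P_def agree_def by metis
  have small: False if "i \<noteq> j" "B $ i $ k \<noteq> 0" "B $ j $ k \<noteq> 0" "\<bar>B $ j $ k\<bar> \<le> \<bar>B $ i $ k\<bar>" for i j
  proof -
    \<comment> \<open>Subtract or add row \<open>j\<close> according to the signs, so that the
      larger entry moves towards zero.\<close>
    define c :: int where "c = (if B $ i $ k > 0 \<longleftrightarrow> B $ j $ k > 0 then - 1 else 1)"
    define C where "C = emat i j c ** B"
    have "P C"
      using B K that(1-3) EL_cancel_left[of i j c B]
      by (auto simp: P_def C_def agree_emat_mult det_emat_mult)
    moreover have "\<mu> C < \<mu> B"
      unfolding \<mu>_def
    proof (rule sum_strict_mono_ex1)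
      have "\<bar>C $ i $ k\<bar> < \<bar>B $ i $ k\<bar>"
        using that by (auto simp: C_def emat_mult_nth c_def)
      thus "\<exists>a\<in>UNIV. nat \<bar>C $ a $ k\<bar> < nat \<bar>B $ a $ k\<bar>"
        by (intro bexI[of _ i]) auto
      have "\<bar>C $ a $ k\<bar> \<le> \<bar>B $ a $ k\<bar>" for a
        using \<open>\<bar>C $ i $ k\<bar> < \<bar>B $ i $ k\<bar>\<close> by (cases "a = i") (auto simp: C_def emat_mult_nth)
      thus "\<forall>a\<in>UNIV. nat \<bar>C $ a $ k\<bar> \<le> nat \<bar>B $ a $ k\<bar>" by (auto intro: nat_mono)
    qed simp
    ultimately show False using min by (meson not_le)
  qed
  have "\<exists>r. B $ r $ k \<noteq> 0"
  proof (rule ccontr)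
    assume "\<nexists>r. B $ r $ k \<noteq> 0"
    hence "0 dvd det B" by (intro dvd_det[of _ _ k]) auto
    thus False using B by (simp add: P_def)
  qed
  then obtain r where r: "B $ r $ k \<noteq> 0" by blast
  have zero: "B $ i $ k = 0" if "i \<noteq> r" for i
    using small[of i r] small[of r i] that r by (metis linear)
  have "B $ r $ k dvd det B"
    by (rule dvd_det[of _ _ k]) (metis zero dvd_0_right dvd_refl)
  hence "B $ r $ k = 1 \<or> B $ r $ k = -1" using B by (auto simp: P_def)
  with that[of B r] B K[OF r] zero show ?thesis by (auto simp: P_def)
qed

text \<open>Column \<open>k\<close> is already a unit vector, so adding a multiple of it to column
  \<open>j\<close> changes the entry (k, j) only. A matrix with the fewest nonzero off-diagonal
  entries in row \<open>k\<close> therefore has none.\<close>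

lemma row_clearing:
  fixes A :: "int^'n^'n::finite"
  assumes "agree K A" "k \<in> K" "det A = 1" "\<And>i. A $ i $ k = (if i = k then 1 else 0)"
  obtains B where "agree (K - {k}) B" "det B = 1" "B \<in> EL \<Longrightarrow> A \<in> EL"
proof -
  define P where "P B \<longleftrightarrow> agree K B \<and> det B = 1 \<and> (B \<in> EL \<longrightarrow> A \<in> EL)
    \<and> (\<forall>i. B $ i $ k = (if i = k then 1 else 0))" for B
  define \<mu> where "\<mu> B = card {j. j \<noteq> k \<and> B $ k $ j \<noteq> 0}" for B :: "int^'n^'n"
  have "P A" using assms by (simp add: P_def)
  then obtain B where B: "P B" and min: "\<And>C. P C \<Longrightarrow> \<mu> B \<le> \<mu> C"
    using ex_has_least_nat[of P A \<mu>] by blast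
  have "B $ k $ j = 0" if "j \<noteq> k" for j
  proof (rule ccontr)
    assume nz: "B $ k $ j \<noteq> 0"
    hence "j \<in> K" using B that unfolding P_def agree_def by metis
    define C where "C = B ** emat k j (- B $ k $ j)"
    have "det C = det B"
    proof -
      have "C = B ** emat k j (- B $ k $ j)" by (simp add: C_def)
      thus ?thesis using that by (simp add: det_mul det_emat)
    qed
    hence "P C"
      using B that \<open>k \<in> K\<close> \<open>j \<in> K\<close> EL_cancel_right[of B k j "- B $ k $ j"]
      by (auto simp: P_def C_def agree_mult_emat mult_emat_nth)
    moreover have "{l. l \<noteq> k \<and> C $ k $ l \<noteq> 0} \<subset> {l. l \<noteq> k \<and> B $ k $ l \<noteq> 0}"
      using B that nz by (auto simp: P_def C_def mult_emat_nth split: if_splits)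
    hence "\<mu> C < \<mu> B" unfolding \<mu>_def by (rule psubset_card_mono[rotated]) simp
    ultimately show False using min by (meson not_le)
  qed
  hence "agree (K - {k}) B"
    using B by (auto simp: P_def agree_def)
  with that[of B] B show ?thesis by (auto simp: P_def)
qed

theorem det_1_imp_EL:
  fixes A :: "int^'n^'n::finite"
  assumes "det A = 1" shows "A \<in> EL"
proof -
  have "A \<in> EL" if "agree K A" "det A = 1" for K :: "'n set" and A
    using that
  proof (induction "card K" arbitrary: K A)
    case 0
    hence "A = mat 1" by (auto simp: agree_def vec_eq_iff mat_1_nth)
    thus ?case by (simp add: EL.one)
  next
    case (Suc n)
    then obtain k where k: "k \<in> K" by (metis card.empty equals0I nat.distinct(1))
    obtain B r where B: "agree K B" "det B = 1" "B \<in> EL \<Longrightarrow> A \<in> EL" "r \<in> K"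
      "B $ r $ k = 1 \<or> B $ r $ k = -1" "\<And>i. i \<noteq> r \<Longrightarrow> B $ i $ k = 0"
      using column_reduction[OF Suc.prems(1) k Suc.prems(2)] by metis
    show ?case
    proof (cases "K = {k}")
      case True
      \<comment> \<open>With a single index left the determinant is the only free entry, which rules
        out the value -1.\<close>
      have "B $ i $ j = 0" if "i \<noteq> j" for i j
        using agreeD[OF B(1), of i j] True that by auto
      hence "det B = (\<Prod>a\<in>UNIV. B $ a $ a)"
        by (intro det_diagonal) auto
      also have "\<dots> = (\<Prod>a\<in>{k}. B $ a $ a)"
        using agreeD[OF B(1)] True by (intro prod.mono_neutral_right) auto
      finally have "B $ k $ k = 1" using B(2) by simp
      hence "B $ i $ j = (if i = j then 1 else 0)" for i j
        using agreeD[OF B(1), of i j] True by (cases "i = k"; cases "j = k") auto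
      hence "B = mat 1" by (simp add: vec_eq_iff mat_1_nth)
      thus ?thesis using B(3) EL.one by simp
    next
      case False
      then obtain j where j: "j \<in> K" "j \<noteq> k" using k by blast
      have "\<exists>B r. agree K B \<and> det B = 1 \<and> (B \<in> EL \<longrightarrow> A \<in> EL) \<and> r \<in> K \<and> r \<noteq> k \<and>
        (B $ r $ k = 1 \<or> B $ r $ k = -1) \<and> (\<forall>i. i \<noteq> r \<longrightarrow> B $ i $ k = 0)"
      proof (cases "r = k")
        case True
        \<comment> \<open>Row \<open>k\<close> is added to row \<open>j\<close> and then row
          \<open>j\<close> subtracted from row \<open>k\<close>; this moves the pivot off the
          diagonal.\<close>
        define C where "C = emat k j (-1) ** (emat j k 1 ** B)"
        have "C \<in> EL \<longrightarrow> A \<in> EL"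
          unfolding C_def using B(3) j EL_cancel_left by metis
        moreover have "agree K C" "det C = 1"
          using B j k by (auto simp: C_def agree_emat_mult det_emat_mult)
        ultimately show ?thesis using B(5,6) j True
          by (intro exI[of _ C] exI[of _ j]) (auto simp: C_def emat_mult_nth)
      qed (use B in blast)
      then obtain B r where B: "agree K B" "det B = 1" "B \<in> EL \<Longrightarrow> A \<in> EL" "r \<in> K" "r \<noteq> k"
        "B $ r $ k = 1 \<or> B $ r $ k = -1" "\<And>i. i \<noteq> r \<Longrightarrow> B $ i $ k = 0" by blast
      \<comment> \<open>With pivot u = 1 or -1 in row r, the first operation puts u u = 1 at (k, k)
        and the second clears (r, k). An off-diagonal pivot is what allows the sign to be
        corrected.\<close>
      define C where "C = emat r k (- B $ r $ k) ** (emat k r (B $ r $ k) ** B)"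
      have "C \<in> EL \<Longrightarrow> A \<in> EL"
        unfolding C_def using B(3,5) EL_cancel_left by metis
      moreover have "agree K C" "det C = 1"
        using B k by (auto simp: C_def agree_emat_mult det_emat_mult)
      moreover have "C $ i $ k = (if i = k then 1 else 0)" for i
        using B(5-7) by (auto simp: C_def emat_mult_nth)
      ultimately obtain D where D: "agree (K - {k}) D" "det D = 1" "D \<in> EL \<Longrightarrow> A \<in> EL"
        using row_clearing[of K C k] k by metis
      have "n = card (K - {k})" using Suc.hyps(2) k by simp
      from Suc.hyps(1)[OF this D(1,2)] D(3) show ?thesis by simp
    qed
  qed
  from this[of UNIV] assms show ?thesis by (simp add: agree_def)
qed

section \<open>From a spectral gap to invariant vectors\<close>

text \<open>Positivity, \<open>gap\<close> and \<open>upper\<close> already make one step of the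
  iteration shrink T v by the factor \<open>s\<close>, without spectral theory. An almost invariant
  start keeps the total displacement below 1, so the limit is nonzero.\<close>

lemma spectral_gap_kernel:
  fixes T :: "'h::{real_inner, complete_space} \<Rightarrow> 'h"
  assumes lin: "linear T" and sym: "\<And>u v. T u \<bullet> v = u \<bullet> T v"
    and pos: "\<And>v. 0 \<le> T v \<bullet> v"
    and gap: "\<And>v. c * (T v \<bullet> v) \<le> (norm (T v))\<^sup>2" and upper: "\<And>v. (norm (T v))\<^sup>2 \<le> M * (T v \<bullet> v)"
    and "c > 0" "M > 0"
    and small: "\<And>\<epsilon>. \<epsilon> > 0 \<Longrightarrow> \<exists>v. norm v = 1 \<and> norm (T v) < \<epsilon>"
  shows "\<exists>w. w \<noteq> 0 \<and> T w = 0"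
proof -
  \<comment> \<open>The minimum with \<open>M\<close> keeps 1 - d/M nonnegative.\<close>
  define d where "d = min c M"
  have d: "0 < d" "d \<le> c" "d \<le> M" using assms(6,7) by (auto simp: d_def)
  define s where "s = sqrt (1 - d / M)"
  have s: "0 \<le> s" "s < 1" "s\<^sup>2 = 1 - d / M"
    using d \<open>M > 0\<close> by (auto simp: s_def)
  have range_gap: "d * (norm (T v))\<^sup>2 \<le> T (T v) \<bullet> T v" for v
  proof -
    \<comment> \<open>The gap becomes a lower bound d for \<open>T\<close> on its own range: expand
      positivity at T v - d v.\<close>
    have "0 \<le> T (T v - d *\<^sub>R v) \<bullet> (T v - d *\<^sub>R v)" by (rule pos)
    also have "\<dots> = T (T v) \<bullet> T v - 2 * d * (norm (T v))\<^sup>2 + d * (d * (T v \<bullet> v))"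
      using sym[of "T v" v]
      by (simp add: linear_diff[OF lin] linear_scale[OF lin] inner_diff_left inner_diff_right
          power2_norm_eq_inner algebra_simps)
    also have "d * (T v \<bullet> v) \<le> (norm (T v))\<^sup>2"
      using gap[of v] mult_right_mono[OF d(2) pos[of v]] by simp
    finally show ?thesis using d(1) by (simp add: mult_left_mono)
  qed
  have contract: "norm (T (v - (1/M) *\<^sub>R T v)) \<le> s * norm (T v)" for v
  proof -
    have "(norm (T (v - (1/M) *\<^sub>R T v)))\<^sup>2
        = (norm (T v))\<^sup>2 - 2 / M * (T (T v) \<bullet> T v) + (norm (T (T v)))\<^sup>2 / M\<^sup>2"
      unfolding power2_norm_eq_inner
      by (simp add: linear_diff[OF lin] linear_scale[OF lin] inner_diff_left inner_diff_right
          inner_commute[of "T v" "T (T v)"] power2_eq_square diff_divide_distrib)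
    also have "(norm (T (T v)))\<^sup>2 / M\<^sup>2 \<le> T (T v) \<bullet> T v / M"
      using upper[of "T v"] \<open>M > 0\<close> by (simp add: field_simps power2_eq_square)
    also have "(norm (T v))\<^sup>2 - 2 / M * (T (T v) \<bullet> T v) + T (T v) \<bullet> T v / M
        = (norm (T v))\<^sup>2 - T (T v) \<bullet> T v / M"
      by (simp add: field_simps)
    also have "\<dots> \<le> (norm (T v))\<^sup>2 - d * (norm (T v))\<^sup>2 / M"
      using range_gap[of v] \<open>M > 0\<close> by (simp add: divide_right_mono)
    also have "\<dots> = (s * norm (T v))\<^sup>2"
      using s(3) by (simp add: power_mult_distrib left_diff_distrib)
    finally show ?thesis
      by (rule power2_le_imp_le) (simp_all add: zero_le_mult_iff s(1))
  qed
  \<comment> \<open>The displacements form a geometric series with sum at most |T v| / (M (1 - s)),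
    and this choice makes it less than 1 = |v|.\<close>
  obtain v where v: "norm v = 1" "norm (T v) < (1 - s) * M"
    using small[of "(1 - s) * M"] s \<open>M > 0\<close> by auto
  define x where "x k = ((\<lambda>v. v - (1/M) *\<^sub>R T v) ^^ k) v" for k
  have x_Suc: "x (Suc k) = x k - (1/M) *\<^sub>R T (x k)" and x_0: "x 0 = v" for k
    by (simp_all add: x_def)
  have decay: "norm (T (x k)) \<le> s ^ k * norm (T v)" for k
  proof (induction k)
    case (Suc k)
    have "norm (T (x (Suc k))) \<le> s * norm (T (x k))"
      unfolding x_Suc by (rule contract)
    also have "\<dots> \<le> s * (s ^ k * norm (T v))"
      by (rule mult_left_mono[OF Suc s(1)])
    finally show ?case by (simp add: mult.assoc)
  qed (simp add: x_0)
  define C where "C = norm (T v) / M"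
  have C: "0 \<le> C" "C / (1 - s) < 1"
    using v(2) s \<open>M > 0\<close> by (auto simp: C_def field_simps)
  define S where "S k = (\<Sum>i<k. C * s ^ i)" for k
  have S_sums: "S \<longlonglongrightarrow> C / (1 - s)"
    using sums_mult[OF geometric_sums[of s], of C] s unfolding sums_def S_def by simp
  have S_mono: "S m \<le> S n" if "m \<le> n" for m n
    unfolding S_def using that C(1) s(1) by (intro sum_mono2) auto
  have step: "norm (x n - x m) \<le> S n - S m" if "m \<le> n" for m n
    using that
  proof (induction n rule: dec_induct)
    case (step n)
    have "norm (x (Suc n) - x m) \<le> norm (x n - x m) + norm ((1/M) *\<^sub>R T (x n))"
      unfolding x_Suc using norm_triangle_ineq4[of "x n - x m" "(1/M) *\<^sub>R T (x n)"]
      by (simp add: algebra_simps)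
    moreover have "norm ((1/M) *\<^sub>R T (x n)) \<le> C * s ^ n"
      using decay[of n] \<open>M > 0\<close> by (simp add: C_def field_simps)
    ultimately show ?case using step.IH by (simp add: S_def)
  qed simp
  have "Cauchy x"
  proof (rule metric_CauchyI)
    fix \<epsilon> :: real assume "\<epsilon> > 0"
    then obtain n0 where n0: "\<And>m n. m \<ge> n0 \<Longrightarrow> n \<ge> n0 \<Longrightarrow> dist (S m) (S n) < \<epsilon>"
      using LIMSEQ_imp_Cauchy[OF S_sums] metric_CauchyD by blast
    have "dist (x m) (x n) \<le> dist (S m) (S n)" for m n
      using step[of m n] step[of n m] S_mono[of m n] S_mono[of n m]
      by (cases "m \<le> n") (auto simp: dist_norm norm_minus_commute)
    thus "\<exists>n0. \<forall>m\<ge>n0. \<forall>n\<ge>n0. dist (x m) (x n) < \<epsilon>"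
      using n0 by (meson order_le_less_trans)
  qed
  then obtain w where x_lim: "x \<longlonglongrightarrow> w"
    using Cauchy_convergent convergent_def by blast
  have "norm (x k - v) \<le> C / (1 - s)" for k
  proof -
    have "S k \<le> C / (1 - s)"
      by (rule LIMSEQ_le_const[OF S_sums]) (use S_mono in blast)
    thus ?thesis using step[of 0 k] by (simp add: x_0 S_def[of 0])
  qed
  hence "norm (w - v) \<le> C / (1 - s)"
    by (intro LIMSEQ_le_const2[OF tendsto_norm[OF tendsto_diff[OF x_lim tendsto_const]]]) auto
  hence nz: "w \<noteq> 0" using v(1) C(2) by auto
  \<comment> \<open>With Cauchy-Schwarz, \<open>upper\<close> bounds \<open>T\<close>, which allows
    it to pass to the limit.\<close>
  have "norm (T u) \<le> norm u * M" for u
  proof -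
    have "norm (T u) * norm (T u) \<le> M * (T u \<bullet> u)"
      using upper[of u] by (simp add: power2_eq_square)
    also have "\<dots> \<le> M * (norm (T u) * norm u)"
      using \<open>M > 0\<close> norm_cauchy_schwarz[of "T u" u] by (intro mult_left_mono) auto
    finally have "norm (T u) * norm (T u) \<le> norm (T u) * (norm u * M)"
      by (simp add: mult_ac)
    thus ?thesis
      using \<open>M > 0\<close> by (cases "T u = 0") (auto dest: mult_left_le_imp_le)
  qed
  hence "bounded_linear T"
    using lin by (intro bounded_linear.intro) (auto simp: bounded_linear_axioms_def)
  hence "(\<lambda>k. T (x k)) \<longlonglongrightarrow> T w"
    using x_lim by (rule bounded_linear.tendsto)
  moreover have "(\<lambda>k. T (x k)) \<longlonglongrightarrow> 0"
  proof (rule Lim_null_comparison)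
    show "\<forall>\<^sub>F k in sequentially. norm (T (x k)) \<le> s ^ k * norm (T v)"
      using decay by simp
    show "(\<lambda>k. s ^ k * norm (T v)) \<longlonglongrightarrow> 0"
      using s by (intro tendsto_mult_left_zero LIMSEQ_power_zero) simp
  qed
  ultimately have "T w = 0" by (rule LIMSEQ_unique)
  with nz show ?thesis by blast
qed

section \<open>The group ring acting through an isometric representation\<close>

definition rep_act :: "('g \<Rightarrow> 'h \<Rightarrow> 'h) \<Rightarrow> ('g \<Rightarrow>\<^sub>0 real) \<Rightarrow> 'h \<Rightarrow> 'h::real_vector" where
  "rep_act \<rho> x v = (\<Sum>g\<in>keys x. lookup x g *\<^sub>R \<rho> g v)"

lemma rep_act_superset:
  "finite A \<Longrightarrow> keys x \<subseteq> A \<Longrightarrow> rep_act \<rho> x v = (\<Sum>g\<in>A. lookup x g *\<^sub>R \<rho> g v)"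
  unfolding rep_act_def by (intro sum.mono_neutral_left) (auto simp: in_keys_iff)

lemma rep_act_zero [simp]: "rep_act \<rho> 0 v = 0"
  by (simp add: rep_act_def)

lemma rep_act_add: "rep_act \<rho> (x + y) v = rep_act \<rho> x v + rep_act \<rho> y v"
  by (simp add: rep_act_superset[of "keys x \<union> keys y"] Poly_Mapping.keys_add lookup_add
      scaleR_left_distrib sum.distrib)

lemma rep_act_single [simp]: "rep_act \<rho> (Poly_Mapping.single g c) v = c *\<^sub>R \<rho> g v"
  by (simp add: rep_act_superset[of "{g}"])

lemma rep_act_uminus: "rep_act \<rho> (- x) v = - rep_act \<rho> x v"
  by (simp add: rep_act_superset[of "keys x"] sum_negf)

lemma rep_act_diff: "rep_act \<rho> (x - y) v = rep_act \<rho> x v - rep_act \<rho> y v"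
  using rep_act_add[of \<rho> x "- y"] by (simp add: rep_act_uminus)

lemma rep_act_sum: "rep_act \<rho> (sum f A) v = (\<Sum>a\<in>A. rep_act \<rho> (f a) v)"
  by (induction A rule: infinite_finite_induct) (auto simp: rep_act_add)

lemma rep_act_cst_mult: "rep_act \<rho> (cst c * x) v = c *\<^sub>R rep_act \<rho> x v"
  by (induction x rule: gring_induct) (auto simp: distrib_left rep_act_add mult_single scaleR_right_distrib)

locale isometric_rep =
  fixes \<rho> :: "'g::group_add \<Rightarrow> 'h \<Rightarrow> 'h::real_inner"
  assumes linear_rep: "linear (\<rho> g)" and norm_rep: "norm (\<rho> g v) = norm v"
    and rep_zero: "\<rho> 0 v = v" and rep_add: "\<rho> (g + h) v = \<rho> g (\<rho> h v)"
begin

lemma inner_rep: "\<rho> g u \<bullet> \<rho> g v = u \<bullet> v"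
  by (simp add: dot_norm norm_rep flip: linear_add[OF linear_rep])

lemma adjoint_rep: "\<rho> (- g) u \<bullet> v = u \<bullet> \<rho> g v"
  using inner_rep[of g "\<rho> (- g) u" v] rep_add[of g "- g" u] by (simp add: rep_zero)

lemma linear_rep_act: "linear (rep_act \<rho> x)"
  unfolding rep_act_def using linear_rep
  by (intro linear_compose_sum ballI linear_compose_scale_right) auto

lemma rep_act_mult: "rep_act \<rho> (x * y) v = rep_act \<rho> x (rep_act \<rho> y v)"
proof (induction x rule: gring_induct)
  case (single g c)
  have "rep_act \<rho> (Poly_Mapping.single g c * y) v = c *\<^sub>R \<rho> g (rep_act \<rho> y v)"
    by (induction y rule: gring_induct)
      (auto simp: linear_0[OF linear_rep] mult_single rep_add linear_scale[OF linear_rep] distrib_left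
        rep_act_add linear_add[OF linear_rep] scaleR_right_distrib)
  thus ?case by simp
qed (auto simp: distrib_right rep_act_add)

lemma rep_act_star: "rep_act \<rho> (star x) u \<bullet> v = u \<bullet> rep_act \<rho> x v"
  by (induction x rule: gring_induct)
    (auto simp: star_add rep_act_add inner_add_left inner_add_right adjoint_rep)

lemma sos_nonneg: "a \<in> sos B \<Longrightarrow> 0 \<le> rep_act \<rho> a v \<bullet> v"
  by (induction rule: sos.induct)
    (auto simp: rep_act_add inner_add_left rep_act_mult rep_act_star)

end

definition lap :: "'g::group_add set \<Rightarrow> 'g \<Rightarrow>\<^sub>0 real" where
  "lap S = (\<Sum>s\<in>S. 1 - pt s)"

context isometric_rep
begin

lemma rep_act_lap: "rep_act \<rho> (lap S) v = (\<Sum>s\<in>S. v - \<rho> s v)"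
  by (simp add: lap_def rep_act_sum rep_act_diff rep_zero flip: single_one)

lemma inner_lap: "rep_act \<rho> (lap S) v \<bullet> v = (\<Sum>s\<in>S. (norm (v - \<rho> s v))\<^sup>2) / 2"
proof -
  have "(norm (v - \<rho> s v))\<^sup>2 = 2 * ((v - \<rho> s v) \<bullet> v)" for s
    using inner_rep[of s v v]
    by (simp add: power2_norm_eq_inner inner_diff_left inner_diff_right inner_commute)
  thus ?thesis
    by (simp add: rep_act_lap inner_sum_left sum_distrib_left[symmetric])
qed

end

text \<open>The lower estimate for the Laplacian comes from the sum of squares, the upper one from
  Cauchy-Schwarz over \<open>S\<close>. A kernel vector is fixed by \<open>S\<close> because the
  form of the Laplacian is half the sum of the squared displacements.\<close>

theorem sos_imp_invariant_vector:
  fixes \<rho> :: "'g::group_add \<Rightarrow> 'h \<Rightarrow> 'h::{real_inner, complete_space}"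
  assumes "isometric_rep \<rho>" and S: "finite S" "\<And>s. s \<in> S \<Longrightarrow> - s \<in> S"
    and gap: "c > 0" "lap S * lap S - cst c * lap S \<in> sos B"
    and almost: "\<And>\<epsilon>. \<epsilon> > 0 \<Longrightarrow> \<exists>v. norm v = 1 \<and> (\<forall>s\<in>S. norm (\<rho> s v - v) < \<epsilon>)"
  shows "\<exists>v. v \<noteq> 0 \<and> (\<forall>s\<in>S. \<rho> s v = v)"
proof -
  interpret isometric_rep \<rho> by fact
  define T where "T = rep_act \<rho> (lap S)"
  \<comment> \<open>The added 1 keeps \<open>N\<close> positive even for empty
    \<open>S\<close>.\<close>
  define N where "N = real (card S) + 1"
  have "(\<Sum>s\<in>S. 1 - pt (- s)) = (\<Sum>s\<in>S. 1 - pt s :: 'g \<Rightarrow>\<^sub>0 real)"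
    by (rule sum.reindex_bij_witness[of _ uminus uminus]) (auto simp: S)
  hence star_lap: "star (lap S) = lap S"
    by (simp add: lap_def star_sum star_diff)
  have sym: "T u \<bullet> v = u \<bullet> T v" for u v
    using rep_act_star[of "lap S" u v] by (simp add: T_def star_lap)
  have inner_T: "T v \<bullet> v = (\<Sum>s\<in>S. (norm (v - \<rho> s v))\<^sup>2) / 2" for v
    by (simp add: T_def inner_lap)
  have norm_T: "norm (T v) \<le> (\<Sum>s\<in>S. norm (v - \<rho> s v))" for v
    by (simp add: T_def rep_act_lap norm_sum)
  have "\<exists>w. w \<noteq> 0 \<and> T w = 0"
  proof (rule spectral_gap_kernel[of T c "2 * N"])
    show "linear T" by (simp add: T_def linear_rep_act)
    show "0 \<le> T v \<bullet> v" for v by (simp add: inner_T sum_nonneg)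
    show "c * (T v \<bullet> v) \<le> (norm (T v))\<^sup>2" for v
    proof -
      have "0 \<le> (T (T v) - c *\<^sub>R T v) \<bullet> v"
        using sos_nonneg[OF gap(2), of v]
        by (simp add: T_def rep_act_diff rep_act_mult[of "lap S" "lap S"] rep_act_cst_mult)
      thus ?thesis
        using sym[of "T v" v] by (simp add: inner_diff_left power2_norm_eq_inner)
    qed
    show "(norm (T v))\<^sup>2 \<le> 2 * N * (T v \<bullet> v)" for v
    proof -
      have "(norm (T v))\<^sup>2 \<le> (\<Sum>s\<in>S. norm (v - \<rho> s v))\<^sup>2"
        by (rule power_mono[OF norm_T]) simp
      also have "\<dots> \<le> real (card S) * (\<Sum>s\<in>S. (norm (v - \<rho> s v))\<^sup>2)"
        using sum_squared_le_sum_of_squares[of "\<lambda>s. norm (v - \<rho> s v)" S] S(1) by (simp add: mult.commute)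
      also have "\<dots> \<le> N * (\<Sum>s\<in>S. (norm (v - \<rho> s v))\<^sup>2)"
        by (intro mult_right_mono sum_nonneg) (auto simp: N_def)
      finally show ?thesis by (simp add: inner_T)
    qed
    show "\<exists>v. norm v = 1 \<and> norm (T v) < \<epsilon>" if "\<epsilon> > 0" for \<epsilon>
    proof -
      have "\<epsilon> / N > 0" using that by (simp add: N_def)
      then obtain v where v: "norm v = 1" "\<And>s. s \<in> S \<Longrightarrow> norm (\<rho> s v - v) < \<epsilon> / N"
        using almost by blast
      have "norm (T v) \<le> (\<Sum>s\<in>S. \<epsilon> / N)"
        using v(2) by (intro order_trans[OF norm_T] sum_mono) (simp add: norm_minus_commute less_imp_le)
      also have "\<dots> < \<epsilon>" using that by (simp add: N_def field_simps)
      finally show ?thesis using v(1) by blast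
    qed
  qed (use gap sym in \<open>auto simp: N_def\<close>)
  then obtain w where "w \<noteq> 0" "T w = 0" by blast
  moreover have "(\<Sum>s\<in>S. (norm (w - \<rho> s w))\<^sup>2) = 0"
    using inner_T[of w] \<open>T w = 0\<close> by simp
  hence "\<forall>s\<in>S. \<rho> s w = w"
    using S(1) by (simp add: sum_nonneg_eq_0_iff)
  ultimately show ?thesis by blast
qed

section \<open>The group SL_n(Z) as a type\<close>

text \<open>The convolution ring is attached to a type class, so the special linear group is copied
  into a type whose addition is matrix multiplication.\<close>

typedef 'n sl = "{A :: int^'n^'n::finite. det A = 1}"
  morphisms mat_of Sl
  by (rule exI[of _ "mat 1"]) simp

lemma det_mat_of [simp]: "det (mat_of x) = 1"
  using mat_of[of x] by simp

lemma mat_of_Sl: "det A = 1 \<Longrightarrow> mat_of (Sl A) = A"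
  by (simp add: Sl_inverse)

instantiation sl :: (finite) group_add
begin

definition zero_sl :: "'a sl" where "0 = Sl (mat 1)"
definition plus_sl :: "'a sl \<Rightarrow> 'a sl \<Rightarrow> 'a sl" where "x + y = Sl (mat_of x ** mat_of y)"
definition uminus_sl :: "'a sl \<Rightarrow> 'a sl" where "- x = (SOME y :: 'a sl. y + x = 0)"
definition minus_sl :: "'a sl \<Rightarrow> 'a sl \<Rightarrow> 'a sl" where "x - y = x + - (y :: 'a sl)"

lemma mat_of_zero: "mat_of (0 :: 'a sl) = mat 1"
  by (simp add: zero_sl_def mat_of_Sl)

lemma mat_of_plus: "mat_of (x + y :: 'a sl) = mat_of x ** mat_of y"
  by (simp add: plus_sl_def mat_of_Sl det_mul)

instance
proof
  fix a b c :: "'a sl"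
  show "a + b + c = a + (b + c)"
    by (simp add: mat_of_inject[symmetric] mat_of_plus matrix_mul_assoc)
  show "0 + a = a" "a + 0 = a"
    by (simp_all add: mat_of_inject[symmetric] mat_of_plus mat_of_zero)
  show "a + - b = a - b"
    by (simp add: minus_sl_def)
  \<comment> \<open>Generation by elementary matrices provides right inverses. A right inverse
    \<open>C\<close> of the right inverse \<open>B\<close> of a equals a, so \<open>B\<close> is
    also a left inverse.\<close>
  obtain B where B: "B \<in> EL" "mat_of a ** B = mat 1"
    using EL_right_inverse[OF det_1_imp_EL[OF det_mat_of[of a]]] by blast
  obtain C where C: "B ** C = mat 1"
    using EL_right_inverse[OF B(1)] by blast
  have "mat_of a = mat_of a ** (B ** C)" by (simp add: C)
  also have "\<dots> = C" by (simp add: matrix_mul_assoc B)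
  finally have "B ** mat_of a = mat 1" using C by simp
  moreover from this have "det B = 1"
    using det_mul[of B "mat_of a"] by simp
  ultimately have "Sl B + a = 0"
    by (simp add: mat_of_inject[symmetric] mat_of_plus mat_of_zero mat_of_Sl)
  thus "- a + a = 0"
    unfolding uminus_sl_def by (rule someI)
qed

end

lemma carrier_SL [simp]: "A \<in> carrier SL \<longleftrightarrow> det A = 1"
  and mult_SL [simp]: "A \<otimes>\<^bsub>SL\<^esub> B = A ** B"
  and one_SL [simp]: "\<one>\<^bsub>SL\<^esub> = mat 1"
  by (simp_all add: SL_def)

lemma inv_SL:
  assumes "det A = 1" shows "inv\<^bsub>SL\<^esub> A = mat_of (- Sl A)"
  unfolding m_inv_def carrier_SL mult_SL one_SL
proof (rule the_equality)
  have "mat_of (Sl A + - Sl A) = mat 1" "mat_of (- Sl A + Sl A) = mat 1"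
    by (simp_all add: mat_of_zero)
  thus "det (mat_of (- Sl A)) = 1 \<and> A ** mat_of (- Sl A) = mat 1 \<and> mat_of (- Sl A) ** A = mat 1"
    using assms unfolding mat_of_plus by (simp add: mat_of_Sl)
  fix B assume B: "det B = 1 \<and> A ** B = mat 1 \<and> B ** A = mat 1"
  hence "Sl A + Sl B = 0"
    using assms by (simp add: mat_of_inject[symmetric] mat_of_plus mat_of_zero mat_of_Sl)
  hence "Sl B = - Sl A" by (metis minus_unique)
  thus "B = mat_of (- Sl A)" using B by (metis mat_of_Sl)
qed

definition elg :: "'n::finite \<Rightarrow> 'n \<Rightarrow> 'n sl" where
  "elg i j = Sl (emat i j 1)"

lemma mat_of_elg: "i \<noteq> j \<Longrightarrow> mat_of (elg i j) = emat i j 1"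
  by (simp add: elg_def mat_of_Sl det_emat)

lemma elem_mat_eq: "elem_mat i j = emat i j 1"
  by (simp add: elem_mat_def emat_def vec_eq_iff mat_def)

lemma mat_of_uminus_elg:
  assumes "i \<noteq> j" shows "mat_of (- elg i j) = emat i j (- 1)"
proof -
  have "elg i j + Sl (emat i j (- 1)) = 0"
    using assms by (simp add: mat_of_inject[symmetric] mat_of_plus mat_of_zero mat_of_elg
        mat_of_Sl det_emat emat_mult_emat)
  hence "- elg i j = Sl (emat i j (- 1))" by (rule minus_unique)
  thus ?thesis using assms by (simp add: mat_of_Sl det_emat)
qed

lemma steinberg_elg: "steinberg (elg :: 'n::finite \<Rightarrow> 'n \<Rightarrow> 'n sl)"
  unfolding steinberg_def
proof (intro conjI allI impI)
  fix i j k l :: 'n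
  assume "i \<noteq> j" "k \<noteq> l" "j \<noteq> k" "i \<noteq> l"
  thus "elg i j + elg k l = elg k l + elg i j"
    by (auto simp: mat_of_inject[symmetric] mat_of_plus mat_of_elg vec_eq_iff emat_mult_nth emat_nth)
next
  fix i j k :: 'n
  assume "i \<noteq> j" "j \<noteq> k" "i \<noteq> k"
  thus "elg i j + elg j k = elg i k + (elg j k + elg i j)"
    by (auto simp: mat_of_inject[symmetric] mat_of_plus mat_of_elg vec_eq_iff emat_mult_nth emat_nth)
qed

text \<open>Ensures that distinct index pairs and signs give distinct generators, so that the sum
  over the set \<open>gens elg\<close> is a sum over index pairs.\<close>

lemma elg_inject: "i \<noteq> j \<Longrightarrow> k \<noteq> l \<Longrightarrow> elg i j = elg k l \<longleftrightarrow> i = k \<and> j = l"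
  and elg_neq_uminus: "i \<noteq> j \<Longrightarrow> k \<noteq> l \<Longrightarrow> elg i j \<noteq> - elg k l"
proof -
  assume ij: "i \<noteq> j" and kl: "k \<noteq> l"
  \<comment> \<open>All comparisons are made at the position (i, j), where an inverse generator has
    entry 0 or -1.\<close>
  have *: "mat_of (elg i j) $ i $ j = 1" "mat_of (- elg k l) $ i $ j \<le> 0"
    "mat_of (elg k l) $ i $ j = (if i = k \<and> j = l then 1 else 0)"
    using ij kl by (auto simp: mat_of_elg mat_of_uminus_elg emat_nth)
  show "elg i j = elg k l \<longleftrightarrow> i = k \<and> j = l"
    using *(1,3) by (metis zero_neq_one)
  show "elg i j \<noteq> - elg k l"
    using *(1,2) by (metis not_one_le_zero)
qed

lemma S_gen_eq: "S_gen = mat_of ` gens elg"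
proof -
  have 1: "elem_mat i j = mat_of (elg i j)" if "i \<noteq> j" for i j :: 'a
    using that by (simp add: elem_mat_eq mat_of_elg)
  have 2: "inv\<^bsub>SL\<^esub> (elem_mat i j) = mat_of (- elg i j)" if "i \<noteq> j" for i j :: 'a
    using that by (simp add: elem_mat_eq inv_SL det_emat elg_def)
  have "S_gen = {mat_of (elg i j) | i j :: 'a. i \<noteq> j} \<union> {mat_of (- elg i j) | i j. i \<noteq> j}"
    unfolding S_gen_def by (intro arg_cong2[of _ _ _ _ "(\<union>)"] Collect_cong) (metis 1, metis 2)
  also have "\<dots> = mat_of ` gens elg"
    unfolding gens_def by blast
  finally show ?thesis .
qed

lemma finite_gens [simp]: "finite (gens (e :: 'i::finite \<Rightarrow> 'i \<Rightarrow> 'g::group_add))"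
proof -
  have "gens e \<subseteq> case_prod e ` UNIV \<union> (\<lambda>(i, j). - e i j) ` UNIV"
    by (auto simp: gens_def)
  thus ?thesis by (rule finite_subset) simp
qed

lemma edges_sum_elg: "edges_sum elg = 2 * lap (gens (elg :: 'n::finite \<Rightarrow> 'n \<Rightarrow> 'n sl))"
proof -
  define P where "P = {(i, j). i \<noteq> (j :: 'n)}"
  have P: "P = (SIGMA i:UNIV. - {i})" by (auto simp: P_def)
  let ?e = "\<lambda>(i, j). elg i j :: 'n sl"
  have inj: "inj_on ?e P" "inj_on (\<lambda>p. - ?e p) P"
    by (auto simp: inj_on_def P_def elg_inject)
  have g: "gens elg = ?e ` P \<union> (\<lambda>p. - ?e p) ` P" "?e ` P \<inter> (\<lambda>p. - ?e p) ` P = {}"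
    by (force simp: gens_def P_def, auto simp: P_def elg_neq_uminus)
  have "lap (gens elg) = (\<Sum>s\<in>?e ` P. 1 - pt s) + (\<Sum>s\<in>(\<lambda>p. - ?e p) ` P. 1 - pt s)"
    unfolding lap_def g(1) by (rule sum.union_disjoint[OF _ _ g(2)]) simp_all
  also have "\<dots> = (\<Sum>p\<in>P. 1 - pt (?e p)) + (\<Sum>p\<in>P. 1 - pt (- ?e p))"
    by (simp only: sum.reindex[OF inj(1)] sum.reindex[OF inj(2)] comp_def)
  also have "\<dots> = (\<Sum>i\<in>UNIV. \<Sum>j\<in>-{i}. (1 - pt (elg i j)) + (1 - pt (- elg i j)))"
    unfolding P sum.distrib by (simp add: sum.Sigma case_prod_unfold)
  finally have *: "lap (gens elg) = (\<Sum>i\<in>UNIV. \<Sum>j\<in>-{i}. (1 - pt (elg i j :: 'n sl)) + (1 - pt (- elg i j)))" .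
  define h :: "'n \<Rightarrow> 'n \<Rightarrow> 'n sl \<Rightarrow>\<^sub>0 real" where "h i j = (1 - pt (elg i j)) + (1 - pt (- elg i j))" for i j
  have "edges_sum elg = (\<Sum>i\<in>UNIV. \<Sum>j\<in>-{i}. h i j + h j i)"
    by (simp add: edges_sum_def edge_def h_def algebra_simps)
  also have "\<dots> = lap (gens elg) + lap (gens elg)"
    unfolding * h_def[symmetric] by (simp only: sum.distrib sum_pairs_swap[of "\<lambda>i j. h j i"])
  finally show ?thesis by (simp add: mult_2)
qed

section \<open>Transfer to functions on matrices\<close>

definition to_fun :: "('n::finite sl \<Rightarrow>\<^sub>0 real) \<Rightarrow> int^'n^'n \<Rightarrow> real" where
  "to_fun x A = (if det A = 1 then lookup x (Sl A) else 0)"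

lemma to_fun_mat_of [simp]: "to_fun x (mat_of g) = lookup x g"
  by (simp add: to_fun_def mat_of_inverse)

lemma to_fun_add: "to_fun (x + y) = (\<lambda>A. to_fun x A + to_fun y A)"
  by (auto simp: to_fun_def lookup_add)

lemma support_to_fun: "{A. to_fun x A \<noteq> 0} = mat_of ` keys x"
proof -
  have "A \<in> mat_of ` keys x" if "to_fun x A \<noteq> 0" for A
    using that by (intro image_eqI[of _ _ "Sl A"]) (auto simp: to_fun_def mat_of_Sl in_keys_iff split: if_splits)
  thus ?thesis by (auto simp: in_keys_iff)
qed

lemma gr_elem_to_fun: "gr_elem SL (to_fun x)"
  by (auto simp: gr_elem_def support_to_fun)

lemma gr_star_to_fun: "gr_star SL (to_fun x) = to_fun (star x)"
  by (auto simp: gr_star_def to_fun_def fun_eq_iff inv_SL mat_of_inverse)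

lemma lookup_mult_sum:
  fixes x y :: "'g::group_add \<Rightarrow>\<^sub>0 real"
  shows "lookup (x * y) g = (\<Sum>(h, k)\<in>{(h, k). h \<in> keys x \<and> k \<in> keys y \<and> h + k = g}. lookup x h * lookup y k)"
proof -
  have "x * y = (\<Sum>h\<in>keys x. Poly_Mapping.single h (lookup x h)) * (\<Sum>k\<in>keys y. Poly_Mapping.single k (lookup y k))"
    by (simp add: sum_singles)
  also have "\<dots> = (\<Sum>(h, k)\<in>keys x \<times> keys y. Poly_Mapping.single (h + k) (lookup x h * lookup y k))"
    by (simp add: sum_product mult_single sum.cartesian_product)
  finally have "lookup (x * y) g = (\<Sum>(h, k)\<in>keys x \<times> keys y. if h + k = g then lookup x h * lookup y k else 0)"
    by (simp add: lookup_sum lookup_single when_def case_prod_unfold)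
  also have "\<dots> = (\<Sum>(h, k)\<in>{(h, k). h \<in> keys x \<and> k \<in> keys y \<and> h + k = g}. lookup x h * lookup y k)"
    by (rule sum.mono_neutral_cong_right) (auto split: if_splits)
  finally show ?thesis .
qed

text \<open>For determinant 1 the pairs summed over correspond under \<open>mat_of\<close>;
  otherwise there are none, because supports have determinant 1 and the determinant is
  multiplicative.\<close>

lemma gr_mult_to_fun: "gr_mult SL (to_fun x) (to_fun y) = to_fun (x * y)"
proof
  fix A :: "int^'a^'a"
  let ?P = "{(h, k). to_fun x h \<noteq> 0 \<and> to_fun y k \<noteq> 0 \<and> h ** k = A}"
  show "gr_mult SL (to_fun x) (to_fun y) A = to_fun (x * y) A"
  proof (cases "det A = 1")
    case True
    define g where "g = Sl A"
    have A: "A = mat_of g" using True by (simp add: g_def mat_of_Sl)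
    define Q where "Q = {(h, k). h \<in> keys x \<and> k \<in> keys y \<and> h + k = g}"
    have "?P = map_prod mat_of mat_of ` Q"
    proof (intro equalityI subsetI)
      fix p assume p: "p \<in> ?P"
      then obtain h k where hk: "h \<in> keys x" "k \<in> keys y" "p = (mat_of h, mat_of k)"
        using support_to_fun[of x] support_to_fun[of y] by blast
      moreover have "h + k = g"
        using p hk by (simp add: A mat_of_inject[symmetric] mat_of_plus)
      ultimately show "p \<in> map_prod mat_of mat_of ` Q"
        by (force simp: Q_def)
    qed (auto simp: Q_def A mat_of_plus[symmetric] in_keys_iff)
    moreover have "inj_on (map_prod mat_of mat_of) Q"
      by (auto simp: inj_on_def mat_of_inject)
    ultimately have "(\<Sum>(h, k)\<in>?P. to_fun x h * to_fun y k) = (\<Sum>(h, k)\<in>Q. lookup x h * lookup y k)"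
      by (simp only: sum.reindex comp_def) (simp add: case_prod_unfold)
    hence "gr_mult SL (to_fun x) (to_fun y) A = (\<Sum>(h, k)\<in>Q. lookup x h * lookup y k)"
      by (simp add: gr_mult_def)
    thus ?thesis by (simp add: A lookup_mult_sum Q_def)
  next
    case False
    hence P: "?P = {}"
      using support_to_fun[of x] support_to_fun[of y] by (auto simp: det_mul to_fun_def split: if_splits)
    have "gr_mult SL (to_fun x) (to_fun y) A = 0"
      unfolding gr_mult_def mult_SL P by simp
    thus ?thesis using False by (simp add: to_fun_def)
  qed
qed

lemma word_ball_ball2: "mat_of ` ball2 (elg :: 'n::finite \<Rightarrow> 'n \<Rightarrow> 'n sl) \<subseteq> word_ball SL S_gen 2"
proof -
  have *: "foldr (\<lambda>s acc. s \<otimes>\<^bsub>SL\<^esub> acc) ws \<one>\<^bsub>SL\<^esub> \<in> word_ball SL S_gen 2"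
    if "set ws \<subseteq> S_gen" "length ws \<le> 2" for ws :: "(int^'n^'n) list"
    using that unfolding word_ball_def by blast
  have "mat_of (0 :: 'n sl) \<in> word_ball SL S_gen 2" "x \<in> gens elg \<Longrightarrow> mat_of x \<in> word_ball SL S_gen 2"
    "x \<in> gens elg \<Longrightarrow> y \<in> gens elg \<Longrightarrow> mat_of (x + y) \<in> word_ball SL S_gen 2" for x y :: "'n sl"
    using *[of "[]"] *[of "[mat_of x]"] *[of "[mat_of x, mat_of y]"]
    by (simp_all add: S_gen_eq mat_of_zero mat_of_plus)
  thus ?thesis by (auto simp: ball2_def)
qed

lemma sos_to_fun: "a \<in> sos (ball2 elg) \<Longrightarrow> to_fun a \<in> sos_R SL S_gen 2"
proof (induction rule: sos.induct)
  case zero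
  show ?case
    unfolding sos_R_def by (intro CollectI exI[of _ 0]) (auto simp: to_fun_def)
next
  case (step a x)
  then obtain m \<xi> where \<xi>: "\<forall>i<m. gr_elem SL (\<xi> i) \<and> {g. \<xi> i g \<noteq> 0} \<subseteq> word_ball SL S_gen 2"
    "to_fun a = (\<lambda>g. \<Sum>i<(m::nat). gr_mult SL (gr_star SL (\<xi> i)) (\<xi> i) g)"
    unfolding sos_R_def by blast
  let ?\<xi> = "\<xi>(m := to_fun x)"
  have "\<forall>i<Suc m. gr_elem SL (?\<xi> i) \<and> {g. ?\<xi> i g \<noteq> 0} \<subseteq> word_ball SL S_gen 2"
    using \<xi>(1) order_trans[OF image_mono[OF step.hyps(2)] word_ball_ball2]
    by (auto simp: less_Suc_eq gr_elem_to_fun support_to_fun)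
  moreover have "to_fun (a + star x * x) = (\<lambda>g. \<Sum>i<Suc m. gr_mult SL (gr_star SL (?\<xi> i)) (?\<xi> i) g)"
    by (simp add: to_fun_add \<xi>(2) gr_star_to_fun gr_mult_to_fun)
  ultimately show ?case
    unfolding sos_R_def by blast
qed

lemma laplacian_to_fun: "laplacian SL S_gen = to_fun (lap (gens elg))"
proof
  fix A :: "int^'n^'n"
  have card: "card (mat_of ` gens (elg :: 'n \<Rightarrow> 'n \<Rightarrow> 'n sl)) = card (gens (elg :: 'n \<Rightarrow> 'n \<Rightarrow> 'n sl))"
    by (rule card_image) (simp add: inj_on_def mat_of_inject)
  show "laplacian SL S_gen A = to_fun (lap (gens elg)) A"
  proof (cases "det A = 1")
    case True
    then obtain g where A: "A = mat_of g" by (metis mat_of_Sl)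
    have "lookup (lap (gens elg)) g = real (card (gens (elg :: 'n \<Rightarrow> 'n \<Rightarrow> 'n sl))) * (if g = 0 then 1 else 0)
        - (if g \<in> gens elg then 1 else 0)"
      by (simp add: lap_def sum_subtractf lookup_minus lookup_sum lookup_single lookup_of_nat when_def)
    thus ?thesis
      by (auto simp: laplacian_def card A S_gen_eq mat_of_inject inj_image_mem_iff inj_def
          simp flip: mat_of_zero)
  next
    case False
    hence "A \<noteq> mat 1" "A \<notin> S_gen" by (auto simp: S_gen_eq)
    thus ?thesis using False by (simp add: laplacian_def to_fun_def)
  qed
qed

theorem lap_elg_sos:
  assumes "CARD('n::finite) \<ge> 3"
  shows "\<exists>c>0. lap (gens (elg :: 'n \<Rightarrow> 'n \<Rightarrow> 'n sl)) * lap (gens elg) - cst c * lap (gens elg) \<in> sos (ball2 elg)"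
proof -
  \<comment> \<open>With edges_sum = 2 L, the element (2 L)^2 - 2c (2 L) is 4 (L^2 - c L), so the
    gap (n - 2)/200 is halved; it is positive as n is at least 3.\<close>
  define c where "c = (real CARD('n) - 2) / 400"
  have c2: "2 * c = (real CARD('n) - 2) / 200" by (simp add: c_def)
  let ?L = "lap (gens (elg :: 'n \<Rightarrow> 'n \<Rightarrow> 'n sl))"
  have "cst (1/4) * (edges_sum elg * edges_sum elg - cst (2 * c) * edges_sum (elg :: 'n \<Rightarrow> 'n \<Rightarrow> 'n sl)) \<in> sos (ball2 elg)"
    using edges_sum_sos[OF steinberg_elg[where 'n = 'n]] assms unfolding c2 by (intro sos_cst_mult) auto
  also have "edges_sum (elg :: 'n \<Rightarrow> 'n \<Rightarrow> 'n sl) = cst 2 * ?L"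
    by (simp add: edges_sum_elg)
  also have "cst (1/4) * ((cst 2 * ?L) * (cst 2 * ?L) - cst (2 * c) * (cst 2 * ?L)) = ?L * ?L - cst c * ?L"
    by (simp add: cst_mult_mult cst_mult_cst right_diff_distrib del: single_numeral)
  finally show ?thesis
    using assms by (intro exI[of _ c]) (simp add: c_def)
qed

text \<open>Invariance under an elementary matrix and its inverse spreads to all integer parameters
  by induction in both directions, and then along the construction of \<open>EL\<close>.\<close>

lemma invariant_under_SL:
  fixes \<pi> :: "int^'n^'n::finite \<Rightarrow> 'h::real_inner \<Rightarrow> 'h"
  assumes rep: "orth_rep SL \<pi>" and inv: "\<forall>s\<in>S_gen. \<pi> s v = v" and "det A = 1"
  shows "\<pi> A v = v"
proof -
  have mult: "\<pi> (A ** B) v = v" if "det A = 1" "det B = 1" "\<pi> A v = v" "\<pi> B v = v" for A B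
    using rep that by (simp add: orth_rep_def)
  have one: "\<pi> (mat 1) v = v"
    using rep by (simp add: orth_rep_def)
  have gen: "\<pi> (emat i j 1) v = v" "\<pi> (emat i j (- 1)) v = v" if "i \<noteq> j" for i j
    using inv that gensI[of i j elg] by (auto simp: S_gen_eq simp flip: mat_of_elg mat_of_uminus_elg)
  have emat: "\<pi> (emat i j c) v = v" if "i \<noteq> j" for i j c
  proof (induction c rule: int_induct[of _ 0])
    case base
    show ?case by (simp add: one)
  next
    case (step1 c)
    thus ?case
      using mult[OF det_emat[OF that] det_emat[OF that], of c 1] gen[OF that] that by (simp add: emat_mult_emat)
  next
    case (step2 c)
    thus ?case
      using mult[OF det_emat[OF that] det_emat[OF that], of c "- 1"] gen[OF that] that by (simp add: emat_mult_emat)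
  qed
  have "det A = 1 \<and> \<pi> A v = v" if "A \<in> EL" for A
    using that by induction (simp_all add: one mult emat det_emat_mult det_emat)
  with det_1_imp_EL[OF assms(3)] show ?thesis by blast
qed

theorem theorem5p3:
  assumes "CARD('n::finite) \<ge> 3"
  shows "(\<forall>\<pi> :: int^'n^'n \<Rightarrow> 'h::{real_inner, complete_space} \<Rightarrow> 'h.
            property_T_rep (SL :: (int^'n^'n) monoid) S_gen \<pi>)
         \<and> kazhdan_radius_le (SL :: (int^'n^'n) monoid) S_gen 2"
proof (intro conjI allI)
  let ?L = "lap (gens (elg :: 'n \<Rightarrow> 'n \<Rightarrow> 'n sl))"
  obtain c where c: "c > 0" "?L * ?L - cst c * ?L \<in> sos (ball2 elg)"
    using lap_elg_sos[OF assms] by blast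
  have "(\<lambda>A. gr_mult SL (laplacian SL S_gen) (laplacian SL S_gen) A - c * laplacian SL S_gen A)
      = to_fun (?L * ?L - cst c * ?L)"
    by (auto simp: laplacian_to_fun gr_mult_to_fun) (auto simp: to_fun_def lookup_minus)
  with c sos_to_fun[OF c(2)] show "kazhdan_radius_le (SL :: (int^'n^'n) monoid) S_gen 2"
    unfolding kazhdan_radius_le_def by auto
  fix \<pi> :: "int^'n^'n \<Rightarrow> 'h \<Rightarrow> 'h"
  show "property_T_rep (SL :: (int^'n^'n) monoid) S_gen \<pi>"
    unfolding property_T_rep_def
  proof (intro impI, elim conjE)
    assume rep: "orth_rep SL \<pi>"
      and almost: "\<forall>\<epsilon>>0. \<exists>v. norm v = 1 \<and> (\<forall>s\<in>S_gen. norm (\<pi> s v - v) < \<epsilon>)"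
    \<comment> \<open>Pulling the representation back to the type \<open>'n sl\<close> makes the
      same sum of squares that proves the radius bound available here.\<close>
    define \<rho> where "\<rho> g = \<pi> (mat_of g)" for g
    have "isometric_rep \<rho>"
      using rep by (intro isometric_rep.intro) (auto simp: \<rho>_def orth_rep_def mat_of_zero mat_of_plus)
    moreover have "\<exists>v. norm v = 1 \<and> (\<forall>s\<in>gens elg. norm (\<rho> s v - v) < \<epsilon>)" if "\<epsilon> > 0" for \<epsilon>
      using almost that unfolding S_gen_eq \<rho>_def by simp
    ultimately obtain v where "v \<noteq> 0" "\<forall>s\<in>gens elg. \<rho> s v = v"
      using sos_imp_invariant_vector[OF _ finite_gens uminus_gens c] by blast
    hence "\<forall>s\<in>S_gen. \<pi> s v = v"
      unfolding S_gen_eq \<rho>_def by simp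
    with \<open>v \<noteq> 0\<close> show "\<exists>v. v \<noteq> 0 \<and> (\<forall>A\<in>carrier SL. \<pi> A v = v)"
      using invariant_under_SL[OF rep] by auto
  qed
qed

end
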